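(* For any symmetric monoidal categories $\mathcal A,\mathcal B,\mathcal C$, there exists a 2-cell in $\mathrm{SMC}$ (that is, a monoidal natural transformation) $$A'_{\mathcal A,\mathcal B,\mathcal C}\circ A_{\mathcal A,\mathcal B,\mathcal C}\to1:\mathcal A\otimes(\mathcal B\otimes\mathcal C)\to\mathcal A\otimes(\mathcal B\otimes\mathcal C).$$
   Context: **Basics.** All symmetric monoidal categories are small, with tensor $\otimes$, unit $I$ and natural isomorphisms $ass_{a,b,c}:a\otimes(b\otimes c)\to(a\otimes b)\otimes c$, $r_a:a\otimes I\to a$, $l_a:I\otimes a\to a$, $s_{a,b}:a\otimes b\to b\otimes a$ satisfying the usual coherence axioms. A symmetric monoidal functor $F:\mathcal A\to\mathcal B$ is a lax one: a functor with an arrow $F^0:I\to F(I)$ and a natural family $F^2_{x,y}:Fx\otimes Fy\to F(x\otimes y)$ satisfying the usual associativity, unit and symmetry axioms; it is strict (resp. strong) if $F^0$ and all $F^2_{x,y}$ are identities (resp. isomorphisms). $\mathrm{SMC}$ is the 2-category of symmetric monoidal categories, symmetric monoidal functors and monoidal natural transformations. **Internal hom.** $[\mathcal A,\mathcal B]$ is the category $\mathrm{SMC}(\mathcal A,\mathcal B)$ with the pointwise symmetric monoidal structure: $(F\Box G)(a)=Fa\otimes Ga$, $(F\Box G)^0$ is $I\cong I\otimes I\xrightarrow{F^0\otimes G^0}F(I)\otimes G(I)$, $(F\Box G)^2_{a,b}$ is the canonical interchange $(Fa\otimes Ga)\otimes(Fb\otimes Gb)\cong(Fa\otimes Fb)\otimes(Ga\otimes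 Gb)$ followed by $F^2_{a,b}\otimes G^2_{a,b}$; $(\sigma\Box\tau)_a=\sigma_a\otimes\tau_a$; the unit is the constant functor at $I_{\mathcal B}$ (with $I\to I$ the identity and $I\otimes I\to I$ the canonical arrow); $ass,r,l,s$ are pointwise. For $F:\mathcal B\to\mathcal C$, $[\mathcal A,F]:[\mathcal A,\mathcal B]\to[\mathcal A,\mathcal C]$ is $H\mapsto F\circ H$, $\theta\mapsto F*\theta$, with $[\mathcal A,F]^0$ having all components $F^0$ and $[\mathcal A,F]^2_{H,K}$ having component $F^2_{Ha,Ka}$ at $a$; for a 2-cell $\sigma$, $[\mathcal A,\sigma]_H=\sigma*H$. **Tensor.** $\mathcal A\otimes\mathcal B$ is the following symmetric monoidal category. Its objects are the formal words freely generated from a constant $I$ and symbols $a\otimes b$ ($a$ in $\mathcal A$, $b$ in $\mathcal B$) under a formal binary operation $X\otimes Y$. Its arrows are freely generated, under composition and the operations $p\mapsto X\otimes p$, $p\mapsto p\otimes X$ for objects $X$, by formal arrows $ass,r,l$ (with formal inverses) and $s$ for all objects, and by arrows $\alpha_b:I\to I_{\mathcal A}\otimes b$; $\beta_a:I\to a\otimes I_{\mathcal B}$; $\gamma_{a,a',b}:(a\otimes b)\otimes(a'\otimes b)\to(a\otimes a')\otimes b$; $\delta_{a,b,b'}:(a\otimes b)\otimes(a\otimes b')\to a\otimes(b\otimes b')$; $a\otimes g:a\otimes b\to a\otimes b'$ for $g:b\to b'$ in $\mathcal B$; $f\otimes b:a\otimes b\to a'\otimes b$ for $f:a\to a'$ in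 $\mathcal A$; modulo the smallest congruence, compatible with all $X\otimes-$ and $-\otimes X$, such that: (i) $\otimes$ is a bifunctor and $\otimes,I,ass,r,l,s$ form a symmetric monoidal structure; (ii) for each $a$, $b\mapsto a\otimes b$, $g\mapsto a\otimes g$ with structure $\beta_a$, $\delta_{a,-,-}$ is a symmetric monoidal functor $\eta(a):\mathcal B\to\mathcal A\otimes\mathcal B$; (iii) for each $b$, $a\mapsto a\otimes b$, $f\mapsto f\otimes b$ with structure $\alpha_b$, $\gamma_{-,-,b}$ is a symmetric monoidal functor $\mathcal A\to\mathcal A\otimes\mathcal B$; (iv) for each $f:a\to a'$ the family $(f\otimes b)_b$, and for each $g:b\to b'$ the family $(a\otimes g)_a$, is a monoidal natural transformation between the corresponding functors of (ii), resp. (iii); (v) with $c:I\otimes I\to I$ canonical, $\alpha_{b\otimes b'}\circ c=\delta_{I_{\mathcal A},b,b'}\circ(\alpha_b\otimes\alpha_{b'})$, $\beta_{a\otimes a'}\circ c=\gamma_{a,a',I_{\mathcal B}}\circ(\beta_a\otimes\beta_{a'})$, and $\beta_{I_{\mathcal A}}=\alpha_{I_{\mathcal B}}$; (vi) $\gamma_{a,a',b\otimes b'}\circ(\delta_{a,b,b'}\otimes\delta_{a',b,b'})=\delta_{a\otimes a',b,b'}\circ(\gamma_{a,a',b}\otimes\gamma_{a,a',b'})\circ m$, where $m$ is the canonical isomorphism exchanging the two middle factors $a\otimes b'$ and $a'\otimes b$. The symmetric monoidal functor $\eta:\mathcal A\to[\mathcal B,\mathcal A\otimes\mathcal B]$ is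 $a\mapsto\eta(a)$, $\eta(f)_b=f\otimes b$, $(\eta^0)_b=\alpha_b$, $(\eta^2_{a,a'})_b=\gamma_{a,a',b}$. **$En$ and $Rn$.** For $F:\mathcal A\to[\mathcal B,\mathcal C]$, $En(F):\mathcal A\otimes\mathcal B\to\mathcal C$ is the strict symmetric monoidal functor with $a\otimes b\mapsto F(a)(b)$, $\alpha_b\mapsto(F^0)_b$, $\beta_a\mapsto(Fa)^0$, $\gamma_{a,a',b}\mapsto(F^2_{a,a'})_b$, $\delta_{a,b,b'}\mapsto(Fa)^2_{b,b'}$, $f\otimes b\mapsto F(f)_b$, $a\otimes g\mapsto F(a)(g)$. For a 2-cell $\sigma:F\to G$, $En(\sigma)_I=1$, $En(\sigma)_{a\otimes b}=(\sigma_a)_b$, $En(\sigma)_{X\otimes Y}=En(\sigma)_X\otimes En(\sigma)_Y$. $Rn:[\mathcal A\otimes\mathcal B,\mathcal C]\to[\mathcal A,[\mathcal B,\mathcal C]]$ is the strict symmetric monoidal functor $F\mapsto[\mathcal B,F]\circ\eta$, $\sigma\mapsto[\mathcal B,\sigma]*\eta$. One has $Rn\circ En=1$ and a natural $\epsilon_F:En(Rn(F))\to F$ with $(\epsilon_F)_{a\otimes b}=1$, $(\epsilon_F)_I=F^0$, $(\epsilon_F)_{X\otimes Y}=F^2_{X,Y}\circ((\epsilon_F)_X\otimes(\epsilon_F)_Y)$. $En:[\mathcal A,[\mathcal B,\mathcal C]]\to[\mathcal A\otimes\mathcal B,\mathcal C]$ is a (strong) symmetric monoidal functor with $En^2_{F,G}$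 the inverse of $\epsilon_{En(F)\Box En(G)}:En(F\Box G)\to En(F)\Box En(G)$ and $En^0$ the inverse of $\epsilon$ at the unit of $[\mathcal A\otimes\mathcal B,\mathcal C]$. **Associativity arrows.** $A_{\mathcal A,\mathcal B,\mathcal C}:\mathcal A\otimes(\mathcal B\otimes\mathcal C)\to(\mathcal A\otimes\mathcal B)\otimes\mathcal C$ is $En$ of the composite $\mathcal A\xrightarrow{\eta}[\mathcal B,\mathcal A\otimes\mathcal B]\xrightarrow{[\mathcal B,\eta]}[\mathcal B,[\mathcal C,(\mathcal A\otimes\mathcal B)\otimes\mathcal C]]\xrightarrow{En}[\mathcal B\otimes\mathcal C,(\mathcal A\otimes\mathcal B)\otimes\mathcal C]$. $A'_{\mathcal A,\mathcal B,\mathcal C}:(\mathcal A\otimes\mathcal B)\otimes\mathcal C\to\mathcal A\otimes(\mathcal B\otimes\mathcal C)$ is $En(En(K))$ where $K$ is the composite $\mathcal A\xrightarrow{\eta}[\mathcal B\otimes\mathcal C,\mathcal A\otimes(\mathcal B\otimes\mathcal C)]\xrightarrow{Rn}[\mathcal B,[\mathcal C,\mathcal A\otimes(\mathcal B\otimes\mathcal C)]]$. *)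

theory Defs
  imports "HOL-Library.FuncSet"
begin

section \<open>Symmetric monoidal categories, functors and transformations\<close>

record ('o, 'm) smc =
  Obj :: "'o set"
  Arr :: "'m set"
  Dom :: "'m \<Rightarrow> 'o"
  Cod :: "'m \<Rightarrow> 'o"
  Ide :: "'o \<Rightarrow> 'm"
  Comp :: "'m \<Rightarrow> 'm \<Rightarrow> 'm" (infixr "\<cdot>\<index>" 70)
  Unit :: "'o" ("\<one>\<index>")
  TenO :: "'o \<Rightarrow> 'o \<Rightarrow> 'o" (infixr "\<otimes>\<index>" 75)
  TenA :: "'m \<Rightarrow> 'm \<Rightarrow> 'm" (infixr "\<odot>\<index>" 75)
  ass :: "'o \<Rightarrow> 'o \<Rightarrow> 'o \<Rightarrow> 'm"
  run :: "'o \<Rightarrow> 'm"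
  lun :: "'o \<Rightarrow> 'm"
  braid :: "'o \<Rightarrow> 'o \<Rightarrow> 'm"

definition hom :: "('o, 'm) smc \<Rightarrow> 'o \<Rightarrow> 'o \<Rightarrow> 'm set" where
  "hom C a b = {f \<in> Arr C. Dom C f = a \<and> Cod C f = b}"

definition inverses :: "('o, 'm) smc \<Rightarrow> 'm \<Rightarrow> 'm \<Rightarrow> bool" where
  "inverses C f g \<longleftrightarrow> f \<in> Arr C \<and> g \<in> hom C (Cod C f) (Dom C f) \<and>
     g \<cdot>\<^bsub>C\<^esub> f = Ide C (Dom C f) \<and> f \<cdot>\<^bsub>C\<^esub> g = Ide C (Cod C f)"

definition iso :: "('o, 'm) smc \<Rightarrow> 'm \<Rightarrow> bool" where
  "iso C f \<longleftrightarrow> (\<exists>g. inverses C f g)"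

definition inv_arr :: "('o, 'm) smc \<Rightarrow> 'm \<Rightarrow> 'm" where
  "inv_arr C f = (THE g. inverses C f g)"

locale sm_category =
  fixes C :: "('o, 'm) smc" (structure)
  assumes Dom_in: "f \<in> Arr C \<Longrightarrow> Dom C f \<in> Obj C"
    and Cod_in: "f \<in> Arr C \<Longrightarrow> Cod C f \<in> Obj C"
    and Ide_hom: "a \<in> Obj C \<Longrightarrow> Ide C a \<in> hom C a a"
    and Comp_hom: "\<lbrakk>f \<in> hom C a b; g \<in> hom C b c\<rbrakk> \<Longrightarrow> g \<cdot> f \<in> hom C a c"
    and Comp_Ide: "f \<in> hom C a b \<Longrightarrow> f \<cdot> Ide C a = f"
    and Ide_Comp: "f \<in> hom C a b \<Longrightarrow> Ide C b \<cdot> f = f"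
    and Comp_assoc: "\<lbrakk>f \<in> hom C a b; g \<in> hom C b c; h \<in> hom C c d\<rbrakk> \<Longrightarrow> (h \<cdot> g) \<cdot> f = h \<cdot> (g \<cdot> f)"
    and Unit_in: "\<one> \<in> Obj C"
    and TenO_in: "\<lbrakk>a \<in> Obj C; b \<in> Obj C\<rbrakk> \<Longrightarrow> a \<otimes> b \<in> Obj C"
    and TenA_hom: "\<lbrakk>f \<in> hom C a a'; g \<in> hom C b b'\<rbrakk> \<Longrightarrow> f \<odot> g \<in> hom C (a \<otimes> b) (a' \<otimes> b')"
    and TenA_Ide: "\<lbrakk>a \<in> Obj C; b \<in> Obj C\<rbrakk> \<Longrightarrow> Ide C a \<odot> Ide C b = Ide C (a \<otimes> b)"
    and TenA_Comp:
      "\<lbrakk>f \<in> hom C a a'; f' \<in> hom C a' a''; g \<in> hom C b b'; g' \<in> hom C b' b''\<rbrakk>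
        \<Longrightarrow> (f' \<cdot> f) \<odot> (g' \<cdot> g) = (f' \<odot> g') \<cdot> (f \<odot> g)"
    and ass_hom: "\<lbrakk>a \<in> Obj C; b \<in> Obj C; c \<in> Obj C\<rbrakk>
        \<Longrightarrow> ass C a b c \<in> hom C (a \<otimes> (b \<otimes> c)) ((a \<otimes> b) \<otimes> c)"
    and ass_iso: "\<lbrakk>a \<in> Obj C; b \<in> Obj C; c \<in> Obj C\<rbrakk> \<Longrightarrow> iso C (ass C a b c)"
    and ass_natural: "\<lbrakk>f \<in> hom C a a'; g \<in> hom C b b'; h \<in> hom C c c'\<rbrakk>
        \<Longrightarrow> ass C a' b' c' \<cdot> (f \<odot> (g \<odot> h)) = ((f \<odot> g) \<odot> h) \<cdot> ass C a b c"
    and run_hom: "a \<in> Obj C \<Longrightarrow> run C a \<in> hom C (a \<otimes> \<one>) a"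
    and run_iso: "a \<in> Obj C \<Longrightarrow> iso C (run C a)"
    and run_natural: "f \<in> hom C a a' \<Longrightarrow> run C a' \<cdot> (f \<odot> Ide C \<one>) = f \<cdot> run C a"
    and lun_hom: "a \<in> Obj C \<Longrightarrow> lun C a \<in> hom C (\<one> \<otimes> a) a"
    and lun_iso: "a \<in> Obj C \<Longrightarrow> iso C (lun C a)"
    and lun_natural: "f \<in> hom C a a' \<Longrightarrow> lun C a' \<cdot> (Ide C \<one> \<odot> f) = f \<cdot> lun C a"
    and sym_hom: "\<lbrakk>a \<in> Obj C; b \<in> Obj C\<rbrakk> \<Longrightarrow> braid C a b \<in> hom C (a \<otimes> b) (b \<otimes> a)"
    and sym_natural: "\<lbrakk>f \<in> hom C a a'; g \<in> hom C b b'\<rbrakk>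
        \<Longrightarrow> braid C a' b' \<cdot> (f \<odot> g) = (g \<odot> f) \<cdot> braid C a b"
    and sym_sym: "\<lbrakk>a \<in> Obj C; b \<in> Obj C\<rbrakk> \<Longrightarrow> braid C b a \<cdot> braid C a b = Ide C (a \<otimes> b)"
    and pentagon: "\<lbrakk>a \<in> Obj C; b \<in> Obj C; c \<in> Obj C; d \<in> Obj C\<rbrakk>
        \<Longrightarrow> ass C (a \<otimes> b) c d \<cdot> ass C a b (c \<otimes> d)
          = (ass C a b c \<odot> Ide C d) \<cdot> ass C a (b \<otimes> c) d \<cdot> (Ide C a \<odot> ass C b c d)"
    and triangle: "\<lbrakk>a \<in> Obj C; b \<in> Obj C\<rbrakk>
        \<Longrightarrow> (run C a \<odot> Ide C b) \<cdot> ass C a \<one> b = Ide C a \<odot> lun C b"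
    and hexagon: "\<lbrakk>a \<in> Obj C; b \<in> Obj C; c \<in> Obj C\<rbrakk>
        \<Longrightarrow> ass C c a b \<cdot> braid C (a \<otimes> b) c \<cdot> ass C a b c
          = (braid C a c \<odot> Ide C b) \<cdot> ass C a c b \<cdot> (Ide C a \<odot> braid C b c)"
    and unit_sym: "a \<in> Obj C \<Longrightarrow> run C a = lun C a \<cdot> braid C a \<one>"

text \<open>Maps are extensional (\<^term>\<open>undefined\<close> off the carriers), so that equality of records
  is equality of functors, respectively of transformations.\<close>

record ('oa, 'ma, 'ob, 'mb) smf =
  FO :: "'oa \<Rightarrow> 'ob"
  FA :: "'ma \<Rightarrow> 'mb"
  F0 :: "'mb"
  F2 :: "'oa \<Rightarrow> 'oa \<Rightarrow> 'mb"

locale sm_functor = A: sm_category A + B: sm_category B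
  for A :: "('oa, 'ma) smc" and B :: "('ob, 'mb) smc" +
  fixes F :: "('oa, 'ma, 'ob, 'mb) smf"
  assumes FO_ext: "FO F \<in> extensional (Obj A)"
    and FA_ext: "FA F \<in> extensional (Arr A)"
    and F2_ext: "F2 F \<in> extensional (Obj A)"
    and F2_ext': "x \<in> Obj A \<Longrightarrow> F2 F x \<in> extensional (Obj A)"
    and FO_in: "x \<in> Obj A \<Longrightarrow> FO F x \<in> Obj B"
    and FA_hom: "f \<in> hom A x y \<Longrightarrow> FA F f \<in> hom B (FO F x) (FO F y)"
    and FA_Ide: "x \<in> Obj A \<Longrightarrow> FA F (Ide A x) = Ide B (FO F x)"
    and FA_Comp: "\<lbrakk>f \<in> hom A x y; g \<in> hom A y z\<rbrakk> \<Longrightarrow> FA F (g \<cdot>\<^bsub>A\<^esub> f) = FA F g \<cdot>\<^bsub>B\<^esub> FA F f"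
    and F0_hom: "F0 F \<in> hom B \<one>\<^bsub>B\<^esub> (FO F \<one>\<^bsub>A\<^esub>)"
    and F2_hom: "\<lbrakk>x \<in> Obj A; y \<in> Obj A\<rbrakk> \<Longrightarrow> F2 F x y \<in> hom B (FO F x \<otimes>\<^bsub>B\<^esub> FO F y) (FO F (x \<otimes>\<^bsub>A\<^esub> y))"
    and F2_natural: "\<lbrakk>f \<in> hom A x x'; g \<in> hom A y y'\<rbrakk>
        \<Longrightarrow> F2 F x' y' \<cdot>\<^bsub>B\<^esub> (FA F f \<odot>\<^bsub>B\<^esub> FA F g) = FA F (f \<odot>\<^bsub>A\<^esub> g) \<cdot>\<^bsub>B\<^esub> F2 F x y"
    and F2_ass: "\<lbrakk>x \<in> Obj A; y \<in> Obj A; z \<in> Obj A\<rbrakk>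
        \<Longrightarrow> F2 F (x \<otimes>\<^bsub>A\<^esub> y) z \<cdot>\<^bsub>B\<^esub> (F2 F x y \<odot>\<^bsub>B\<^esub> Ide B (FO F z)) \<cdot>\<^bsub>B\<^esub> ass B (FO F x) (FO F y) (FO F z)
          = FA F (ass A x y z) \<cdot>\<^bsub>B\<^esub> F2 F x (y \<otimes>\<^bsub>A\<^esub> z) \<cdot>\<^bsub>B\<^esub> (Ide B (FO F x) \<odot>\<^bsub>B\<^esub> F2 F y z)"
    and F2_run: "x \<in> Obj A
        \<Longrightarrow> FA F (run A x) \<cdot>\<^bsub>B\<^esub> F2 F x \<one>\<^bsub>A\<^esub> \<cdot>\<^bsub>B\<^esub> (Ide B (FO F x) \<odot>\<^bsub>B\<^esub> F0 F) = run B (FO F x)"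
    and F2_lun: "x \<in> Obj A
        \<Longrightarrow> FA F (lun A x) \<cdot>\<^bsub>B\<^esub> F2 F \<one>\<^bsub>A\<^esub> x \<cdot>\<^bsub>B\<^esub> (F0 F \<odot>\<^bsub>B\<^esub> Ide B (FO F x)) = lun B (FO F x)"
    and F2_sym: "\<lbrakk>x \<in> Obj A; y \<in> Obj A\<rbrakk>
        \<Longrightarrow> FA F (braid A x y) \<cdot>\<^bsub>B\<^esub> F2 F x y = F2 F y x \<cdot>\<^bsub>B\<^esub> braid B (FO F x) (FO F y)"

record ('oa, 'ma, 'ob, 'mb) smt =
  Src :: "('oa, 'ma, 'ob, 'mb) smf"
  Tgt :: "('oa, 'ma, 'ob, 'mb) smf"
  Cpt :: "'oa \<Rightarrow> 'mb"

locale sm_transformation = S: sm_functor A B "Src \<sigma>" + T: sm_functor A B "Tgt \<sigma>"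
  for A :: "('oa, 'ma) smc" and B :: "('ob, 'mb) smc" and \<sigma> :: "('oa, 'ma, 'ob, 'mb) smt" +
  assumes Cpt_ext: "Cpt \<sigma> \<in> extensional (Obj A)"
    and Cpt_hom: "x \<in> Obj A \<Longrightarrow> Cpt \<sigma> x \<in> hom B (FO (Src \<sigma>) x) (FO (Tgt \<sigma>) x)"
    and Cpt_natural: "f \<in> hom A x y
        \<Longrightarrow> Cpt \<sigma> y \<cdot>\<^bsub>B\<^esub> FA (Src \<sigma>) f = FA (Tgt \<sigma>) f \<cdot>\<^bsub>B\<^esub> Cpt \<sigma> x"
    and Cpt_unit: "Cpt \<sigma> \<one>\<^bsub>A\<^esub> \<cdot>\<^bsub>B\<^esub> F0 (Src \<sigma>) = F0 (Tgt \<sigma>)"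
    and Cpt_tensor: "\<lbrakk>x \<in> Obj A; y \<in> Obj A\<rbrakk>
        \<Longrightarrow> Cpt \<sigma> (x \<otimes>\<^bsub>A\<^esub> y) \<cdot>\<^bsub>B\<^esub> F2 (Src \<sigma>) x y = F2 (Tgt \<sigma>) x y \<cdot>\<^bsub>B\<^esub> (Cpt \<sigma> x \<odot>\<^bsub>B\<^esub> Cpt \<sigma> y)"

definition id_smf :: "('o, 'm) smc \<Rightarrow> ('o, 'm, 'o, 'm) smf" where
  "id_smf A = \<lparr>FO = (\<lambda>x\<in>Obj A. x), FA = (\<lambda>f\<in>Arr A. f), F0 = Ide A \<one>\<^bsub>A\<^esub>,
     F2 = (\<lambda>x\<in>Obj A. \<lambda>y\<in>Obj A. Ide A (x \<otimes>\<^bsub>A\<^esub> y))\<rparr>"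

definition comp_smf ::
  "('oa, 'ma) smc \<Rightarrow> ('oc, 'mc) smc \<Rightarrow> ('ob, 'mb, 'oc, 'mc) smf \<Rightarrow> ('oa, 'ma, 'ob, 'mb) smf
    \<Rightarrow> ('oa, 'ma, 'oc, 'mc) smf" where
  "comp_smf A C G F =
     \<lparr>FO = (\<lambda>x\<in>Obj A. FO G (FO F x)),
      FA = (\<lambda>f\<in>Arr A. FA G (FA F f)),
      F0 = FA G (F0 F) \<cdot>\<^bsub>C\<^esub> F0 G,
      F2 = (\<lambda>x\<in>Obj A. \<lambda>y\<in>Obj A. FA G (F2 F x y) \<cdot>\<^bsub>C\<^esub> F2 G (FO F x) (FO F y))\<rparr>"

definition whisker_left ::
  "('oa, 'ma) smc \<Rightarrow> ('oc, 'mc) smc \<Rightarrow> ('ob, 'mb, 'oc, 'mc) smf \<Rightarrow> ('oa, 'ma, 'ob, 'mb) smt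
    \<Rightarrow> ('oa, 'ma, 'oc, 'mc) smt" where
  "whisker_left A C G \<theta> =
     \<lparr>Src = comp_smf A C G (Src \<theta>), Tgt = comp_smf A C G (Tgt \<theta>), Cpt = (\<lambda>x\<in>Obj A. FA G (Cpt \<theta> x))\<rparr>"

definition whisker_right ::
  "('oa, 'ma) smc \<Rightarrow> ('oc, 'mc) smc \<Rightarrow> ('ob, 'mb, 'oc, 'mc) smt \<Rightarrow> ('oa, 'ma, 'ob, 'mb) smf
    \<Rightarrow> ('oa, 'ma, 'oc, 'mc) smt" where
  "whisker_right A C \<sigma> H =
     \<lparr>Src = comp_smf A C (Src \<sigma>) H, Tgt = comp_smf A C (Tgt \<sigma>) H, Cpt = (\<lambda>x\<in>Obj A. Cpt \<sigma> (FO H x))\<rparr>"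


section \<open>The internal hom\<close>

text \<open>The canonical isomorphism from \<open>(a \<otimes> b) \<otimes> (c \<otimes> d)\<close> to \<open>(a \<otimes> c) \<otimes> (b \<otimes> d)\<close>.\<close>

definition interchange :: "('o, 'm) smc \<Rightarrow> 'o \<Rightarrow> 'o \<Rightarrow> 'o \<Rightarrow> 'o \<Rightarrow> 'm" where
  "interchange C a b c d =
     ass C a c (b \<otimes>\<^bsub>C\<^esub> d) \<cdot>\<^bsub>C\<^esub>
     (Ide C a \<odot>\<^bsub>C\<^esub> (inv_arr C (ass C c b d) \<cdot>\<^bsub>C\<^esub> (braid C b c \<odot>\<^bsub>C\<^esub> Ide C d) \<cdot>\<^bsub>C\<^esub> ass C b c d)) \<cdot>\<^bsub>C\<^esub>
     inv_arr C (ass C a b (c \<otimes>\<^bsub>C\<^esub> d))"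

definition box_smf ::
  "('oa, 'ma) smc \<Rightarrow> ('ob, 'mb) smc \<Rightarrow> ('oa, 'ma, 'ob, 'mb) smf \<Rightarrow> ('oa, 'ma, 'ob, 'mb) smf
    \<Rightarrow> ('oa, 'ma, 'ob, 'mb) smf" where
  "box_smf A B F G =
     \<lparr>FO = (\<lambda>x\<in>Obj A. FO F x \<otimes>\<^bsub>B\<^esub> FO G x),
      FA = (\<lambda>f\<in>Arr A. FA F f \<odot>\<^bsub>B\<^esub> FA G f),
      F0 = (F0 F \<odot>\<^bsub>B\<^esub> F0 G) \<cdot>\<^bsub>B\<^esub> inv_arr B (run B \<one>\<^bsub>B\<^esub>),
      F2 = (\<lambda>x\<in>Obj A. \<lambda>y\<in>Obj A.
              (F2 F x y \<odot>\<^bsub>B\<^esub> F2 G x y) \<cdot>\<^bsub>B\<^esub> interchange B (FO F x) (FO G x) (FO F y) (FO G y))\<rparr>"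

definition unit_smf :: "('oa, 'ma) smc \<Rightarrow> ('ob, 'mb) smc \<Rightarrow> ('oa, 'ma, 'ob, 'mb) smf" where
  "unit_smf A B =
     \<lparr>FO = (\<lambda>x\<in>Obj A. \<one>\<^bsub>B\<^esub>), FA = (\<lambda>f\<in>Arr A. Ide B \<one>\<^bsub>B\<^esub>), F0 = Ide B \<one>\<^bsub>B\<^esub>,
      F2 = (\<lambda>x\<in>Obj A. \<lambda>y\<in>Obj A. run B \<one>\<^bsub>B\<^esub>)\<rparr>"

definition ihom ::
  "('oa, 'ma) smc \<Rightarrow> ('ob, 'mb) smc \<Rightarrow> (('oa, 'ma, 'ob, 'mb) smf, ('oa, 'ma, 'ob, 'mb) smt) smc" where
  "ihom A B = (let bx = box_smf A B; u = unit_smf A B in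
     \<lparr>Obj = {F. sm_functor A B F},
      Arr = {\<sigma>. sm_transformation A B \<sigma>},
      Dom = Src,
      Cod = Tgt,
      Ide = (\<lambda>F. \<lparr>Src = F, Tgt = F, Cpt = (\<lambda>x\<in>Obj A. Ide B (FO F x))\<rparr>),
      Comp = (\<lambda>\<tau> \<sigma>. \<lparr>Src = Src \<sigma>, Tgt = Tgt \<tau>, Cpt = (\<lambda>x\<in>Obj A. Cpt \<tau> x \<cdot>\<^bsub>B\<^esub> Cpt \<sigma> x)\<rparr>),
      Unit = u,
      TenO = bx,
      TenA = (\<lambda>\<sigma> \<tau>. \<lparr>Src = bx (Src \<sigma>) (Src \<tau>), Tgt = bx (Tgt \<sigma>) (Tgt \<tau>),
                     Cpt = (\<lambda>x\<in>Obj A. Cpt \<sigma> x \<odot>\<^bsub>B\<^esub> Cpt \<tau> x)\<rparr>),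
      ass = (\<lambda>F G H. \<lparr>Src = bx F (bx G H), Tgt = bx (bx F G) H,
                      Cpt = (\<lambda>x\<in>Obj A. ass B (FO F x) (FO G x) (FO H x))\<rparr>),
      run = (\<lambda>F. \<lparr>Src = bx F u, Tgt = F, Cpt = (\<lambda>x\<in>Obj A. run B (FO F x))\<rparr>),
      lun = (\<lambda>F. \<lparr>Src = bx u F, Tgt = F, Cpt = (\<lambda>x\<in>Obj A. lun B (FO F x))\<rparr>),
      braid = (\<lambda>F G. \<lparr>Src = bx F G, Tgt = bx G F, Cpt = (\<lambda>x\<in>Obj A. braid B (FO F x) (FO G x))\<rparr>)\<rparr>)"

text \<open>The functor \<open>[A, F]\<close> from \<open>[A, B]\<close> to \<open>[A, C]\<close>, and \<open>[A, \<sigma>]\<close> for a 2-cell \<open>\<sigma>\<close>.\<close>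

definition ihom_map ::
  "('oa, 'ma) smc \<Rightarrow> ('ob, 'mb) smc \<Rightarrow> ('oc, 'mc) smc \<Rightarrow> ('ob, 'mb, 'oc, 'mc) smf \<Rightarrow>
    (('oa, 'ma, 'ob, 'mb) smf, ('oa, 'ma, 'ob, 'mb) smt,
     ('oa, 'ma, 'oc, 'mc) smf, ('oa, 'ma, 'oc, 'mc) smt) smf" where
  "ihom_map A B C F =
     \<lparr>FO = (\<lambda>H\<in>Obj (ihom A B). comp_smf A C F H),
      FA = (\<lambda>\<theta>\<in>Arr (ihom A B). whisker_left A C F \<theta>),
      F0 = \<lparr>Src = unit_smf A C, Tgt = comp_smf A C F (unit_smf A B), Cpt = (\<lambda>x\<in>Obj A. F0 F)\<rparr>,
      F2 = (\<lambda>H\<in>Obj (ihom A B). \<lambda>K\<in>Obj (ihom A B).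
              \<lparr>Src = box_smf A C (comp_smf A C F H) (comp_smf A C F K),
               Tgt = comp_smf A C F (box_smf A B H K),
               Cpt = (\<lambda>x\<in>Obj A. F2 F (FO H x) (FO K x))\<rparr>)\<rparr>"

definition ihom_map2 ::
  "('oa, 'ma) smc \<Rightarrow> ('ob, 'mb) smc \<Rightarrow> ('oc, 'mc) smc \<Rightarrow> ('ob, 'mb, 'oc, 'mc) smt \<Rightarrow>
    (('oa, 'ma, 'ob, 'mb) smf, ('oa, 'ma, 'ob, 'mb) smt,
     ('oa, 'ma, 'oc, 'mc) smf, ('oa, 'ma, 'oc, 'mc) smt) smt" where
  "ihom_map2 A B C \<sigma> =
     \<lparr>Src = ihom_map A B C (Src \<sigma>), Tgt = ihom_map A B C (Tgt \<sigma>),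
      Cpt = (\<lambda>H\<in>Obj (ihom A B). whisker_right A C \<sigma> H)\<rparr>"


section \<open>The tensor product\<close>

datatype ('oa, 'ob) tobj =
    TUnit
  | TGen 'oa 'ob
  | TTen "('oa, 'ob) tobj" "('oa, 'ob) tobj" (infixr "\<otimes>\<^sub>t" 75)

datatype ('oa, 'ma, 'ob, 'mb) tarr =
    TIde "('oa, 'ob) tobj"
  | TComp "('oa, 'ma, 'ob, 'mb) tarr" "('oa, 'ma, 'ob, 'mb) tarr" (infixr "\<cdot>\<^sub>t" 70)
  | TLeft "('oa, 'ob) tobj" "('oa, 'ma, 'ob, 'mb) tarr" (infixr "\<lhd>\<^sub>t" 74)
  | TRight "('oa, 'ma, 'ob, 'mb) tarr" "('oa, 'ob) tobj" (infixl "\<rhd>\<^sub>t" 74)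
  | TAss "('oa, 'ob) tobj" "('oa, 'ob) tobj" "('oa, 'ob) tobj"
  | TAssInv "('oa, 'ob) tobj" "('oa, 'ob) tobj" "('oa, 'ob) tobj"
  | TRun "('oa, 'ob) tobj"
  | TRunInv "('oa, 'ob) tobj"
  | TLun "('oa, 'ob) tobj"
  | TLunInv "('oa, 'ob) tobj"
  | TSym "('oa, 'ob) tobj" "('oa, 'ob) tobj"
  | Alpha 'ob
  | Beta 'oa
  | Gamma 'oa 'oa 'ob
  | Delta 'oa 'ob 'ob
  | GenR 'oa 'mb
  | GenL 'ma 'ob

text \<open>\<^term>\<open>X \<lhd>\<^sub>t p\<close> and \<^term>\<open>p \<rhd>\<^sub>t X\<close> are the formal \<open>X \<otimes> p\<close> and \<open>p \<otimes> X\<close>; \<^term>\<open>GenR a g\<close> and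
  \<^term>\<open>GenL f b\<close> are \<open>a \<otimes> g\<close> and \<open>f \<otimes> b\<close>.\<close>

context
  fixes A :: "('oa, 'ma) smc" and B :: "('ob, 'mb) smc"
begin

primrec wf_obj :: "('oa, 'ob) tobj \<Rightarrow> bool" where
  "wf_obj TUnit \<longleftrightarrow> True"
| "wf_obj (TGen a b) \<longleftrightarrow> a \<in> Obj A \<and> b \<in> Obj B"
| "wf_obj (X \<otimes>\<^sub>t Y) \<longleftrightarrow> wf_obj X \<and> wf_obj Y"

primrec tdom :: "('oa, 'ma, 'ob, 'mb) tarr \<Rightarrow> ('oa, 'ob) tobj" where
  "tdom (TIde X) = X"
| "tdom (q \<cdot>\<^sub>t p) = tdom p"
| "tdom (X \<lhd>\<^sub>t p) = X \<otimes>\<^sub>t tdom p"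
| "tdom (p \<rhd>\<^sub>t X) = tdom p \<otimes>\<^sub>t X"
| "tdom (TAss X Y Z) = X \<otimes>\<^sub>t (Y \<otimes>\<^sub>t Z)"
| "tdom (TAssInv X Y Z) = (X \<otimes>\<^sub>t Y) \<otimes>\<^sub>t Z"
| "tdom (TRun X) = X \<otimes>\<^sub>t TUnit"
| "tdom (TRunInv X) = X"
| "tdom (TLun X) = TUnit \<otimes>\<^sub>t X"
| "tdom (TLunInv X) = X"
| "tdom (TSym X Y) = X \<otimes>\<^sub>t Y"
| "tdom (Alpha b) = TUnit"
| "tdom (Beta a) = TUnit"
| "tdom (Gamma a a' b) = TGen a b \<otimes>\<^sub>t TGen a' b"
| "tdom (Delta a b b') = TGen a b \<otimes>\<^sub>t TGen a b'"
| "tdom (GenR a g) = TGen a (Dom B g)"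
| "tdom (GenL f b) = TGen (Dom A f) b"

primrec tcod :: "('oa, 'ma, 'ob, 'mb) tarr \<Rightarrow> ('oa, 'ob) tobj" where
  "tcod (TIde X) = X"
| "tcod (q \<cdot>\<^sub>t p) = tcod q"
| "tcod (X \<lhd>\<^sub>t p) = X \<otimes>\<^sub>t tcod p"
| "tcod (p \<rhd>\<^sub>t X) = tcod p \<otimes>\<^sub>t X"
| "tcod (TAss X Y Z) = (X \<otimes>\<^sub>t Y) \<otimes>\<^sub>t Z"
| "tcod (TAssInv X Y Z) = X \<otimes>\<^sub>t (Y \<otimes>\<^sub>t Z)"
| "tcod (TRun X) = X"
| "tcod (TRunInv X) = X \<otimes>\<^sub>t TUnit"
| "tcod (TLun X) = X"
| "tcod (TLunInv X) = TUnit \<otimes>\<^sub>t X"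
| "tcod (TSym X Y) = Y \<otimes>\<^sub>t X"
| "tcod (Alpha b) = TGen \<one>\<^bsub>A\<^esub> b"
| "tcod (Beta a) = TGen a \<one>\<^bsub>B\<^esub>"
| "tcod (Gamma a a' b) = TGen (a \<otimes>\<^bsub>A\<^esub> a') b"
| "tcod (Delta a b b') = TGen a (b \<otimes>\<^bsub>B\<^esub> b')"
| "tcod (GenR a g) = TGen a (Cod B g)"
| "tcod (GenL f b) = TGen (Cod A f) b"

primrec wf_arr :: "('oa, 'ma, 'ob, 'mb) tarr \<Rightarrow> bool" where
  "wf_arr (TIde X) \<longleftrightarrow> wf_obj X"
| "wf_arr (q \<cdot>\<^sub>t p) \<longleftrightarrow> wf_arr q \<and> wf_arr p \<and> tdom q = tcod p"
| "wf_arr (X \<lhd>\<^sub>t p) \<longleftrightarrow> wf_obj X \<and> wf_arr p"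
| "wf_arr (p \<rhd>\<^sub>t X) \<longleftrightarrow> wf_arr p \<and> wf_obj X"
| "wf_arr (TAss X Y Z) \<longleftrightarrow> wf_obj X \<and> wf_obj Y \<and> wf_obj Z"
| "wf_arr (TAssInv X Y Z) \<longleftrightarrow> wf_obj X \<and> wf_obj Y \<and> wf_obj Z"
| "wf_arr (TRun X) \<longleftrightarrow> wf_obj X"
| "wf_arr (TRunInv X) \<longleftrightarrow> wf_obj X"
| "wf_arr (TLun X) \<longleftrightarrow> wf_obj X"
| "wf_arr (TLunInv X) \<longleftrightarrow> wf_obj X"
| "wf_arr (TSym X Y) \<longleftrightarrow> wf_obj X \<and> wf_obj Y"
| "wf_arr (Alpha b) \<longleftrightarrow> b \<in> Obj B"
| "wf_arr (Beta a) \<longleftrightarrow> a \<in> Obj A"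
| "wf_arr (Gamma a a' b) \<longleftrightarrow> a \<in> Obj A \<and> a' \<in> Obj A \<and> b \<in> Obj B"
| "wf_arr (Delta a b b') \<longleftrightarrow> a \<in> Obj A \<and> b \<in> Obj B \<and> b' \<in> Obj B"
| "wf_arr (GenR a g) \<longleftrightarrow> a \<in> Obj A \<and> g \<in> Arr B"
| "wf_arr (GenL f b) \<longleftrightarrow> f \<in> Arr A \<and> b \<in> Obj B"

definition parallel :: "('oa, 'ma, 'ob, 'mb) tarr \<Rightarrow> ('oa, 'ma, 'ob, 'mb) tarr \<Rightarrow> bool" where
  "parallel p q \<longleftrightarrow> wf_arr p \<and> wf_arr q \<and> tdom p = tdom q \<and> tcod p = tcod q"

definition tten :: "('oa, 'ma, 'ob, 'mb) tarr \<Rightarrow> ('oa, 'ma, 'ob, 'mb) tarr \<Rightarrow> ('oa, 'ma, 'ob, 'mb) tarr"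
    (infixr "\<odot>\<^sub>t" 75) where
  "p \<odot>\<^sub>t q = (p \<rhd>\<^sub>t tcod q) \<cdot>\<^sub>t (tdom p \<lhd>\<^sub>t q)"

definition tinterchange :: "('oa, 'ob) tobj \<Rightarrow> ('oa, 'ob) tobj \<Rightarrow> ('oa, 'ob) tobj \<Rightarrow> ('oa, 'ob) tobj
    \<Rightarrow> ('oa, 'ma, 'ob, 'mb) tarr" where
  "tinterchange X Y Z W =
     TAss X Z (Y \<otimes>\<^sub>t W) \<cdot>\<^sub>t
     (X \<lhd>\<^sub>t (TAssInv Z Y W \<cdot>\<^sub>t (TSym Y Z \<rhd>\<^sub>t W) \<cdot>\<^sub>t TAss Y Z W)) \<cdot>\<^sub>t
     TAssInv X Y (Z \<otimes>\<^sub>t W)"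

text \<open>The defining equations, as raw pairs of terms. Only the instances with well-formed parallel
  sides are used in the congruence below: this leaves the variables ranging over exactly the
  objects and arrows for which the equation makes sense.\<close>

inductive tgen :: "('oa, 'ma, 'ob, 'mb) tarr \<Rightarrow> ('oa, 'ma, 'ob, 'mb) tarr \<Rightarrow> bool" where
  comp_ide: "tgen (p \<cdot>\<^sub>t TIde X) p"
| ide_comp: "tgen (TIde X \<cdot>\<^sub>t p) p"
| comp_assoc: "tgen ((r \<cdot>\<^sub>t q) \<cdot>\<^sub>t p) (r \<cdot>\<^sub>t (q \<cdot>\<^sub>t p))"
| left_ide: "tgen (X \<lhd>\<^sub>t TIde Y) (TIde (X \<otimes>\<^sub>t Y))"
| left_comp: "tgen (X \<lhd>\<^sub>t (q \<cdot>\<^sub>t p)) ((X \<lhd>\<^sub>t q) \<cdot>\<^sub>t (X \<lhd>\<^sub>t p))"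
| right_ide: "tgen (TIde X \<rhd>\<^sub>t Y) (TIde (X \<otimes>\<^sub>t Y))"
| right_comp: "tgen ((q \<cdot>\<^sub>t p) \<rhd>\<^sub>t X) ((q \<rhd>\<^sub>t X) \<cdot>\<^sub>t (p \<rhd>\<^sub>t X))"
| left_right: "tgen ((p \<rhd>\<^sub>t tcod q) \<cdot>\<^sub>t (tdom p \<lhd>\<^sub>t q)) ((tcod p \<lhd>\<^sub>t q) \<cdot>\<^sub>t (p \<rhd>\<^sub>t tdom q))"
| ass_assinv: "tgen (TAss X Y Z \<cdot>\<^sub>t TAssInv X Y Z) (TIde ((X \<otimes>\<^sub>t Y) \<otimes>\<^sub>t Z))"
| assinv_ass: "tgen (TAssInv X Y Z \<cdot>\<^sub>t TAss X Y Z) (TIde (X \<otimes>\<^sub>t (Y \<otimes>\<^sub>t Z)))"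
| run_runinv: "tgen (TRun X \<cdot>\<^sub>t TRunInv X) (TIde X)"
| runinv_run: "tgen (TRunInv X \<cdot>\<^sub>t TRun X) (TIde (X \<otimes>\<^sub>t TUnit))"
| lun_luninv: "tgen (TLun X \<cdot>\<^sub>t TLunInv X) (TIde X)"
| luninv_lun: "tgen (TLunInv X \<cdot>\<^sub>t TLun X) (TIde (TUnit \<otimes>\<^sub>t X))"
| sym_sym: "tgen (TSym Y X \<cdot>\<^sub>t TSym X Y) (TIde (X \<otimes>\<^sub>t Y))"
| ass_nat: "tgen (TAss (tcod p) (tcod q) (tcod r) \<cdot>\<^sub>t (p \<odot>\<^sub>t (q \<odot>\<^sub>t r)))
                 (((p \<odot>\<^sub>t q) \<odot>\<^sub>t r) \<cdot>\<^sub>t TAss (tdom p) (tdom q) (tdom r))"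
| run_nat: "tgen (TRun (tcod p) \<cdot>\<^sub>t (p \<rhd>\<^sub>t TUnit)) (p \<cdot>\<^sub>t TRun (tdom p))"
| lun_nat: "tgen (TLun (tcod p) \<cdot>\<^sub>t (TUnit \<lhd>\<^sub>t p)) (p \<cdot>\<^sub>t TLun (tdom p))"
| sym_nat: "tgen (TSym (tcod p) (tcod q) \<cdot>\<^sub>t (p \<odot>\<^sub>t q)) ((q \<odot>\<^sub>t p) \<cdot>\<^sub>t TSym (tdom p) (tdom q))"
| pentagon: "tgen (TAss (X \<otimes>\<^sub>t Y) Z W \<cdot>\<^sub>t TAss X Y (Z \<otimes>\<^sub>t W))
                  ((TAss X Y Z \<rhd>\<^sub>t W) \<cdot>\<^sub>t TAss X (Y \<otimes>\<^sub>t Z) W \<cdot>\<^sub>t (X \<lhd>\<^sub>t TAss Y Z W))"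
| triangle: "tgen ((TRun X \<rhd>\<^sub>t Y) \<cdot>\<^sub>t TAss X TUnit Y) (X \<lhd>\<^sub>t TLun Y)"
| hexagon: "tgen (TAss Z X Y \<cdot>\<^sub>t TSym (X \<otimes>\<^sub>t Y) Z \<cdot>\<^sub>t TAss X Y Z)
                 ((TSym X Z \<rhd>\<^sub>t Y) \<cdot>\<^sub>t TAss X Z Y \<cdot>\<^sub>t (X \<lhd>\<^sub>t TSym Y Z))"
| unit_sym: "tgen (TRun X) (TLun X \<cdot>\<^sub>t TSym X TUnit)"
  \<comment> \<open>\<open>a \<otimes> -\<close> is a symmetric monoidal functor\<close>
| genR_ide: "tgen (GenR a (Ide B b)) (TIde (TGen a b))"
| genR_comp: "tgen (GenR a (h \<cdot>\<^bsub>B\<^esub> g)) (GenR a h \<cdot>\<^sub>t GenR a g)"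
| delta_nat: "tgen (Delta a (Cod B g) (Cod B h) \<cdot>\<^sub>t (GenR a g \<odot>\<^sub>t GenR a h))
                   (GenR a (g \<odot>\<^bsub>B\<^esub> h) \<cdot>\<^sub>t Delta a (Dom B g) (Dom B h))"
| delta_ass: "tgen (Delta a (b \<otimes>\<^bsub>B\<^esub> b') b'' \<cdot>\<^sub>t (Delta a b b' \<rhd>\<^sub>t TGen a b'') \<cdot>\<^sub>t
                      TAss (TGen a b) (TGen a b') (TGen a b''))
                   (GenR a (ass B b b' b'') \<cdot>\<^sub>t Delta a b (b' \<otimes>\<^bsub>B\<^esub> b'') \<cdot>\<^sub>t (TGen a b \<lhd>\<^sub>t Delta a b' b''))"
| delta_run: "tgen (GenR a (run B b) \<cdot>\<^sub>t Delta a b \<one>\<^bsub>B\<^esub> \<cdot>\<^sub>t (TGen a b \<lhd>\<^sub>t Beta a)) (TRun (TGen a b))"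
| delta_lun: "tgen (GenR a (lun B b) \<cdot>\<^sub>t Delta a \<one>\<^bsub>B\<^esub> b \<cdot>\<^sub>t (Beta a \<rhd>\<^sub>t TGen a b)) (TLun (TGen a b))"
| delta_sym: "tgen (GenR a (braid B b b') \<cdot>\<^sub>t Delta a b b')
                   (Delta a b' b \<cdot>\<^sub>t TSym (TGen a b) (TGen a b'))"
  \<comment> \<open>\<open>- \<otimes> b\<close> is a symmetric monoidal functor\<close>
| genL_ide: "tgen (GenL (Ide A a) b) (TIde (TGen a b))"
| genL_comp: "tgen (GenL (h \<cdot>\<^bsub>A\<^esub> f) b) (GenL h b \<cdot>\<^sub>t GenL f b)"
| gamma_nat: "tgen (Gamma (Cod A f) (Cod A h) b \<cdot>\<^sub>t (GenL f b \<odot>\<^sub>t GenL h b))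
                   (GenL (f \<odot>\<^bsub>A\<^esub> h) b \<cdot>\<^sub>t Gamma (Dom A f) (Dom A h) b)"
| gamma_ass: "tgen (Gamma (a \<otimes>\<^bsub>A\<^esub> a') a'' b \<cdot>\<^sub>t (Gamma a a' b \<rhd>\<^sub>t TGen a'' b) \<cdot>\<^sub>t
                      TAss (TGen a b) (TGen a' b) (TGen a'' b))
                   (GenL (ass A a a' a'') b \<cdot>\<^sub>t Gamma a (a' \<otimes>\<^bsub>A\<^esub> a'') b \<cdot>\<^sub>t (TGen a b \<lhd>\<^sub>t Gamma a' a'' b))"
| gamma_run: "tgen (GenL (run A a) b \<cdot>\<^sub>t Gamma a \<one>\<^bsub>A\<^esub> b \<cdot>\<^sub>t (TGen a b \<lhd>\<^sub>t Alpha b)) (TRun (TGen a b))"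
| gamma_lun: "tgen (GenL (lun A a) b \<cdot>\<^sub>t Gamma \<one>\<^bsub>A\<^esub> a b \<cdot>\<^sub>t (Alpha b \<rhd>\<^sub>t TGen a b)) (TLun (TGen a b))"
| gamma_sym: "tgen (GenL (braid A a a') b \<cdot>\<^sub>t Gamma a a' b)
                   (Gamma a' a b \<cdot>\<^sub>t TSym (TGen a b) (TGen a' b))"
  \<comment> \<open>\<open>f \<otimes> -\<close> and \<open>- \<otimes> g\<close> are monoidal natural transformations\<close>
| genL_genR: "tgen (GenL f (Cod B g) \<cdot>\<^sub>t GenR (Dom A f) g) (GenR (Cod A f) g \<cdot>\<^sub>t GenL f (Dom B g))"
| genL_beta: "tgen (GenL f \<one>\<^bsub>B\<^esub> \<cdot>\<^sub>t Beta (Dom A f)) (Beta (Cod A f))"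
| genL_delta: "tgen (GenL f (b \<otimes>\<^bsub>B\<^esub> b') \<cdot>\<^sub>t Delta (Dom A f) b b')
                    (Delta (Cod A f) b b' \<cdot>\<^sub>t (GenL f b \<odot>\<^sub>t GenL f b'))"
| genR_alpha: "tgen (GenR \<one>\<^bsub>A\<^esub> g \<cdot>\<^sub>t Alpha (Dom B g)) (Alpha (Cod B g))"
| genR_gamma: "tgen (GenR (a \<otimes>\<^bsub>A\<^esub> a') g \<cdot>\<^sub>t Gamma a a' (Dom B g))
                    (Gamma a a' (Cod B g) \<cdot>\<^sub>t (GenR a g \<odot>\<^sub>t GenR a' g))"
| alpha_delta: "tgen (Alpha (b \<otimes>\<^bsub>B\<^esub> b') \<cdot>\<^sub>t TRun TUnit) (Delta \<one>\<^bsub>A\<^esub> b b' \<cdot>\<^sub>t (Alpha b \<odot>\<^sub>t Alpha b'))"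
| beta_gamma: "tgen (Beta (a \<otimes>\<^bsub>A\<^esub> a') \<cdot>\<^sub>t TRun TUnit) (Gamma a a' \<one>\<^bsub>B\<^esub> \<cdot>\<^sub>t (Beta a \<odot>\<^sub>t Beta a'))"
| alpha_beta: "tgen (Beta \<one>\<^bsub>A\<^esub>) (Alpha \<one>\<^bsub>B\<^esub>)"
| gamma_delta: "tgen (Gamma a a' (b \<otimes>\<^bsub>B\<^esub> b') \<cdot>\<^sub>t (Delta a b b' \<odot>\<^sub>t Delta a' b b'))
                     (Delta (a \<otimes>\<^bsub>A\<^esub> a') b b' \<cdot>\<^sub>t (Gamma a a' b \<odot>\<^sub>t Gamma a a' b') \<cdot>\<^sub>t
                       tinterchange (TGen a b) (TGen a b') (TGen a' b) (TGen a' b'))"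

inductive teq :: "('oa, 'ma, 'ob, 'mb) tarr \<Rightarrow> ('oa, 'ma, 'ob, 'mb) tarr \<Rightarrow> bool" where
  gen: "\<lbrakk>tgen p q; parallel p q\<rbrakk> \<Longrightarrow> teq p q"
| refl: "wf_arr p \<Longrightarrow> teq p p"
| symm: "teq p q \<Longrightarrow> teq q p"
| trans: "\<lbrakk>teq p q; teq q r\<rbrakk> \<Longrightarrow> teq p r"
| comp: "\<lbrakk>teq p p'; teq q q'; tdom q = tcod p\<rbrakk> \<Longrightarrow> teq (q \<cdot>\<^sub>t p) (q' \<cdot>\<^sub>t p')"
| left: "\<lbrakk>teq p q; wf_obj X\<rbrakk> \<Longrightarrow> teq (X \<lhd>\<^sub>t p) (X \<lhd>\<^sub>t q)"
| right: "\<lbrakk>teq p q; wf_obj X\<rbrakk> \<Longrightarrow> teq (p \<rhd>\<^sub>t X) (q \<rhd>\<^sub>t X)"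

definition tclass :: "('oa, 'ma, 'ob, 'mb) tarr \<Rightarrow> ('oa, 'ma, 'ob, 'mb) tarr set" where
  "tclass p = {q. teq p q}"

definition trep :: "('oa, 'ma, 'ob, 'mb) tarr set \<Rightarrow> ('oa, 'ma, 'ob, 'mb) tarr" where
  "trep c = (SOME p. p \<in> c)"

definition tensor :: "(('oa, 'ob) tobj, ('oa, 'ma, 'ob, 'mb) tarr set) smc" where
  "tensor =
     \<lparr>Obj = {X. wf_obj X},
      Arr = tclass ` {p. wf_arr p},
      Dom = (\<lambda>c. tdom (trep c)),
      Cod = (\<lambda>c. tcod (trep c)),
      Ide = (\<lambda>X. tclass (TIde X)),
      Comp = (\<lambda>d c. tclass (trep d \<cdot>\<^sub>t trep c)),
      Unit = TUnit,
      TenO = TTen,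
      TenA = (\<lambda>c d. tclass (trep c \<odot>\<^sub>t trep d)),
      ass = (\<lambda>X Y Z. tclass (TAss X Y Z)),
      run = (\<lambda>X. tclass (TRun X)),
      lun = (\<lambda>X. tclass (TLun X)),
      braid = (\<lambda>X Y. tclass (TSym X Y))\<rparr>"

definition eta_at :: "'oa \<Rightarrow> ('ob, 'mb, ('oa, 'ob) tobj, ('oa, 'ma, 'ob, 'mb) tarr set) smf" where
  "eta_at a =
     \<lparr>FO = (\<lambda>b\<in>Obj B. TGen a b),
      FA = (\<lambda>g\<in>Arr B. tclass (GenR a g)),
      F0 = tclass (Beta a),
      F2 = (\<lambda>b\<in>Obj B. \<lambda>b'\<in>Obj B. tclass (Delta a b b'))\<rparr>"

definition eta :: "('oa, 'ma,
    ('ob, 'mb, ('oa, 'ob) tobj, ('oa, 'ma, 'ob, 'mb) tarr set) smf,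
    ('ob, 'mb, ('oa, 'ob) tobj, ('oa, 'ma, 'ob, 'mb) tarr set) smt) smf" where
  "eta =
     \<lparr>FO = (\<lambda>a\<in>Obj A. eta_at a),
      FA = (\<lambda>f\<in>Arr A. \<lparr>Src = eta_at (Dom A f), Tgt = eta_at (Cod A f),
                       Cpt = (\<lambda>b\<in>Obj B. tclass (GenL f b))\<rparr>),
      F0 = \<lparr>Src = unit_smf B tensor, Tgt = eta_at \<one>\<^bsub>A\<^esub>, Cpt = (\<lambda>b\<in>Obj B. tclass (Alpha b))\<rparr>,
      F2 = (\<lambda>a\<in>Obj A. \<lambda>a'\<in>Obj A.
              \<lparr>Src = box_smf B tensor (eta_at a) (eta_at a'), Tgt = eta_at (a \<otimes>\<^bsub>A\<^esub> a'),
               Cpt = (\<lambda>b\<in>Obj B. tclass (Gamma a a' b))\<rparr>)\<rparr>"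

end


section \<open>\<open>En\<close>, \<open>Rn\<close> and the associativity arrows\<close>

primrec en_obj ::
  "('oc, 'mc) smc \<Rightarrow> ('oa, 'ma, ('ob, 'mb, 'oc, 'mc) smf, ('ob, 'mb, 'oc, 'mc) smt) smf
    \<Rightarrow> ('oa, 'ob) tobj \<Rightarrow> 'oc" where
  "en_obj C F TUnit = \<one>\<^bsub>C\<^esub>"
| "en_obj C F (TGen a b) = FO (FO F a) b"
| "en_obj C F (X \<otimes>\<^sub>t Y) = en_obj C F X \<otimes>\<^bsub>C\<^esub> en_obj C F Y"

primrec en_arr ::
  "('oc, 'mc) smc \<Rightarrow> ('oa, 'ma, ('ob, 'mb, 'oc, 'mc) smf, ('ob, 'mb, 'oc, 'mc) smt) smf
    \<Rightarrow> ('oa, 'ma, 'ob, 'mb) tarr \<Rightarrow> 'mc" where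
  "en_arr C F (TIde X) = Ide C (en_obj C F X)"
| "en_arr C F (q \<cdot>\<^sub>t p) = en_arr C F q \<cdot>\<^bsub>C\<^esub> en_arr C F p"
| "en_arr C F (X \<lhd>\<^sub>t p) = Ide C (en_obj C F X) \<odot>\<^bsub>C\<^esub> en_arr C F p"
| "en_arr C F (p \<rhd>\<^sub>t X) = en_arr C F p \<odot>\<^bsub>C\<^esub> Ide C (en_obj C F X)"
| "en_arr C F (TAss X Y Z) = ass C (en_obj C F X) (en_obj C F Y) (en_obj C F Z)"
| "en_arr C F (TAssInv X Y Z) = inv_arr C (ass C (en_obj C F X) (en_obj C F Y) (en_obj C F Z))"
| "en_arr C F (TRun X) = run C (en_obj C F X)"
| "en_arr C F (TRunInv X) = inv_arr C (run C (en_obj C F X))"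
| "en_arr C F (TLun X) = lun C (en_obj C F X)"
| "en_arr C F (TLunInv X) = inv_arr C (lun C (en_obj C F X))"
| "en_arr C F (TSym X Y) = braid C (en_obj C F X) (en_obj C F Y)"
| "en_arr C F (Alpha b) = Cpt (F0 F) b"
| "en_arr C F (Beta a) = F0 (FO F a)"
| "en_arr C F (Gamma a a' b) = Cpt (F2 F a a') b"
| "en_arr C F (Delta a b b') = F2 (FO F a) b b'"
| "en_arr C F (GenR a g) = FA (FO F a) g"
| "en_arr C F (GenL f b) = Cpt (FA F f) b"

definition en ::
  "('oa, 'ma) smc \<Rightarrow> ('ob, 'mb) smc \<Rightarrow> ('oc, 'mc) smc \<Rightarrow>
    ('oa, 'ma, ('ob, 'mb, 'oc, 'mc) smf, ('ob, 'mb, 'oc, 'mc) smt) smf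
    \<Rightarrow> (('oa, 'ob) tobj, ('oa, 'ma, 'ob, 'mb) tarr set, 'oc, 'mc) smf" where
  "en A B C F =
     \<lparr>FO = (\<lambda>X\<in>Obj (tensor A B). en_obj C F X),
      FA = (\<lambda>c\<in>Arr (tensor A B). en_arr C F (trep c)),
      F0 = Ide C \<one>\<^bsub>C\<^esub>,
      F2 = (\<lambda>X\<in>Obj (tensor A B). \<lambda>Y\<in>Obj (tensor A B). Ide C (en_obj C F X \<otimes>\<^bsub>C\<^esub> en_obj C F Y))\<rparr>"

primrec en2_cpt ::
  "('oc, 'mc) smc \<Rightarrow> ('oa, 'ma, ('ob, 'mb, 'oc, 'mc) smf, ('ob, 'mb, 'oc, 'mc) smt) smt
    \<Rightarrow> ('oa, 'ob) tobj \<Rightarrow> 'mc" where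
  "en2_cpt C \<sigma> TUnit = Ide C \<one>\<^bsub>C\<^esub>"
| "en2_cpt C \<sigma> (TGen a b) = Cpt (Cpt \<sigma> a) b"
| "en2_cpt C \<sigma> (X \<otimes>\<^sub>t Y) = en2_cpt C \<sigma> X \<odot>\<^bsub>C\<^esub> en2_cpt C \<sigma> Y"

definition en2 ::
  "('oa, 'ma) smc \<Rightarrow> ('ob, 'mb) smc \<Rightarrow> ('oc, 'mc) smc \<Rightarrow>
    ('oa, 'ma, ('ob, 'mb, 'oc, 'mc) smf, ('ob, 'mb, 'oc, 'mc) smt) smt
    \<Rightarrow> (('oa, 'ob) tobj, ('oa, 'ma, 'ob, 'mb) tarr set, 'oc, 'mc) smt" where
  "en2 A B C \<sigma> =
     \<lparr>Src = en A B C (Src \<sigma>), Tgt = en A B C (Tgt \<sigma>), Cpt = (\<lambda>X\<in>Obj (tensor A B). en2_cpt C \<sigma> X)\<rparr>"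

definition Rn ::
  "('oa, 'ma) smc \<Rightarrow> ('ob, 'mb) smc \<Rightarrow> ('oc, 'mc) smc \<Rightarrow>
    ((('oa, 'ob) tobj, ('oa, 'ma, 'ob, 'mb) tarr set, 'oc, 'mc) smf,
     (('oa, 'ob) tobj, ('oa, 'ma, 'ob, 'mb) tarr set, 'oc, 'mc) smt,
     ('oa, 'ma, ('ob, 'mb, 'oc, 'mc) smf, ('ob, 'mb, 'oc, 'mc) smt) smf,
     ('oa, 'ma, ('ob, 'mb, 'oc, 'mc) smf, ('ob, 'mb, 'oc, 'mc) smt) smt) smf" where
  "Rn A B C =
     (let T = tensor A B; H = ihom A (ihom B C);
          rn = (\<lambda>F. comp_smf A (ihom B C) (ihom_map B T C F) (eta A B))
      in \<lparr>FO = (\<lambda>F\<in>Obj (ihom T C). rn F),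
          FA = (\<lambda>\<sigma>\<in>Arr (ihom T C). whisker_right A (ihom B C) (ihom_map2 B T C \<sigma>) (eta A B)),
          F0 = Ide H \<one>\<^bsub>H\<^esub>,
          F2 = (\<lambda>F\<in>Obj (ihom T C). \<lambda>G\<in>Obj (ihom T C). Ide H (rn F \<otimes>\<^bsub>H\<^esub> rn G))\<rparr>)"

primrec eps_cpt ::
  "('oc, 'mc) smc \<Rightarrow> (('oa, 'ob) tobj, ('oa, 'ma, 'ob, 'mb) tarr set, 'oc, 'mc) smf
    \<Rightarrow> ('oa, 'ob) tobj \<Rightarrow> 'mc" where
  "eps_cpt C F TUnit = F0 F"
| "eps_cpt C F (TGen a b) = Ide C (FO F (TGen a b))"
| "eps_cpt C F (X \<otimes>\<^sub>t Y) = F2 F X Y \<cdot>\<^bsub>C\<^esub> (eps_cpt C F X \<odot>\<^bsub>C\<^esub> eps_cpt C F Y)"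

definition eps ::
  "('oa, 'ma) smc \<Rightarrow> ('ob, 'mb) smc \<Rightarrow> ('oc, 'mc) smc \<Rightarrow>
    (('oa, 'ob) tobj, ('oa, 'ma, 'ob, 'mb) tarr set, 'oc, 'mc) smf
    \<Rightarrow> (('oa, 'ob) tobj, ('oa, 'ma, 'ob, 'mb) tarr set, 'oc, 'mc) smt" where
  "eps A B C F =
     \<lparr>Src = en A B C (FO (Rn A B C) F), Tgt = F, Cpt = (\<lambda>X\<in>Obj (tensor A B). eps_cpt C F X)\<rparr>"

definition En ::
  "('oa, 'ma) smc \<Rightarrow> ('ob, 'mb) smc \<Rightarrow> ('oc, 'mc) smc \<Rightarrow>
    (('oa, 'ma, ('ob, 'mb, 'oc, 'mc) smf, ('ob, 'mb, 'oc, 'mc) smt) smf,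
     ('oa, 'ma, ('ob, 'mb, 'oc, 'mc) smf, ('ob, 'mb, 'oc, 'mc) smt) smt,
     (('oa, 'ob) tobj, ('oa, 'ma, 'ob, 'mb) tarr set, 'oc, 'mc) smf,
     (('oa, 'ob) tobj, ('oa, 'ma, 'ob, 'mb) tarr set, 'oc, 'mc) smt) smf" where
  "En A B C =
     (let H = ihom A (ihom B C); K = ihom (tensor A B) C
      in \<lparr>FO = (\<lambda>F\<in>Obj H. en A B C F),
          FA = (\<lambda>\<sigma>\<in>Arr H. en2 A B C \<sigma>),
          F0 = inv_arr K (eps A B C \<one>\<^bsub>K\<^esub>),
          F2 = (\<lambda>F\<in>Obj H. \<lambda>G\<in>Obj H. inv_arr K (eps A B C (en A B C F \<otimes>\<^bsub>K\<^esub> en A B C G)))\<rparr>)"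

definition assoc_arrow where
  "assoc_arrow A B C =
     (let D = tensor (tensor A B) C
      in FO (En A (tensor B C) D)
           (comp_smf A (ihom (tensor B C) D) (En B C D)
             (comp_smf A (ihom B (ihom C D))
               (ihom_map B (tensor A B) (ihom C D) (eta (tensor A B) C))
               (eta A B))))"

definition assoc_arrow' where
  "assoc_arrow' A B C =
     (let D = tensor A (tensor B C);
          K = comp_smf A (ihom B (ihom C D)) (Rn B C D) (eta A (tensor B C))
      in FO (En (tensor A B) C D) (FO (En A B (ihom C D)) K))"

end

theory Submission
  imports Defs
begin

text \<open>\<open>A' \<circ> A\<close> is strict, so it is \<open>En\<close> of its transpose \<open>Rn (A' \<circ> A)\<close>, and likewise the identity is \<open>En\<close> of \<open>\<eta>\<close>.
  It therefore suffices to give a 2-cell \<open>Rn (A' \<circ> A) \<rightarrow> \<eta>\<close>. Its component at \<open>a\<close> is the counit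
  \<open>\<epsilon> : En (Rn (\<eta> a)) \<rightarrow> \<eta> a\<close>, because \<open>A' \<circ> A \<circ> \<eta> a\<close> is strict and has the same transpose as \<open>\<eta> a\<close>.
  All equations between these 2-cells are checked on generators \<open>b \<otimes> c\<close> only: a monoidal transformation out of
  a strong functor on a tensor product is determined by its components there, where \<open>\<epsilon>\<close> is the identity. The same
  principle makes \<open>En\<close> monoidal. That the internal hom is symmetric monoidal at all rests on Mac Lane's coherence
  theorem, which is proved by pulling the letters of a word to the front one at a time.\<close>

section \<open>Calculus in a symmetric monoidal category\<close>

text \<open>A sends a \<otimes> W to the value at W of a strict functor, so the composite A' A fixes
  a \<otimes> (b \<otimes> c) but takes a \<otimes> I to I, and a \<otimes> (X \<otimes> Y) to the
  tensor of the images of a \<otimes> X and a \<otimes> Y. The way back uses \<beta> for I, and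
  \<delta> after the arrows for X and Y; this is the recursion of the counit at \<eta>(a). In
  general \<beta> and \<delta> are not invertible, hence a 2-cell in one direction only. The
  asymmetry shapes the argument. A transformation between lax functors on a tensor product is
  determined by generators once its source is strong, whatever its target; so each equation needs a
  strong source: a unit, a functor with an En on the nose, or a pointwise tensor of such. Functors
  are compared by equality, not by isomorphism: maps are extensional, so Rn En = 1 and En Rn S = S
  for strict S are genuine equations. Coherence is unavoidable because the comparison of a pointwise
  tensor exchanges two middle factors: the monoidal axioms of the internal hom contain diagrams of
  canonical isomorphisms on up to six objects.\<close>

lemma in_hom_iff: "f \<in> hom C a b \<longleftrightarrow> f \<in> Arr C \<and> Dom C f = a \<and> Cod C f = b"
  by (simp add: hom_def)

context sm_category
begin

lemma Dom_Cod_in [simp]: "f \<in> Arr C \<Longrightarrow> Dom C f \<in> Obj C" "f \<in> Arr C \<Longrightarrow> Cod C f \<in> Obj C"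
  by (rule Dom_in Cod_in, assumption)+

lemma Ide_simps [simp]:
  assumes "a \<in> Obj C"
  shows "Ide C a \<in> Arr C" "Dom C (Ide C a) = a" "Cod C (Ide C a) = a"
  using Ide_hom[OF assms] by (simp_all add: in_hom_iff)

lemma Comp_simps [simp]:
  assumes "f \<in> Arr C" "g \<in> Arr C" "Dom C g = Cod C f"
  shows "g \<cdot> f \<in> Arr C" "Dom C (g \<cdot> f) = Dom C f" "Cod C (g \<cdot> f) = Cod C g"
  using Comp_hom[of f "Dom C f" "Cod C f" g "Cod C g"] assms by (simp_all add: in_hom_iff)

lemma Comp_Ide_simps [simp]:
  "f \<in> Arr C \<Longrightarrow> Dom C f = a \<Longrightarrow> f \<cdot> Ide C a = f"
  "f \<in> Arr C \<Longrightarrow> Cod C f = a \<Longrightarrow> Ide C a \<cdot> f = f"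
  using Comp_Ide Ide_Comp by (auto simp: in_hom_iff)

text \<open>Right-nested composites are the normal form of all equational chains below. With typing
  expressed through \<open>Arr\<close>, \<open>Dom\<close> and \<open>Cod\<close> rather than
  \<open>hom\<close>, composability is itself settled by rewriting.\<close>

lemma Comp_assoc_simp [simp]:
  assumes "f \<in> Arr C" "g \<in> Arr C" "h \<in> Arr C" "Dom C g = Cod C f" "Dom C h = Cod C g"
  shows "(h \<cdot> g) \<cdot> f = h \<cdot> g \<cdot> f"
  using assms Comp_assoc by (simp add: in_hom_iff)

lemma Unit_TenO_in [simp]: "\<one> \<in> Obj C" "a \<in> Obj C \<Longrightarrow> b \<in> Obj C \<Longrightarrow> a \<otimes> b \<in> Obj C"
  by (auto intro: Unit_in TenO_in)

lemma TenA_simps [simp]: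
  assumes "f \<in> Arr C" "g \<in> Arr C"
  shows "f \<odot> g \<in> Arr C" "Dom C (f \<odot> g) = Dom C f \<otimes> Dom C g" "Cod C (f \<odot> g) = Cod C f \<otimes> Cod C g"
  using TenA_hom[of f "Dom C f" "Cod C f" g "Dom C g" "Cod C g"] assms by (simp_all add: in_hom_iff)

lemma TenA_Ide_simp [simp]: "a \<in> Obj C \<Longrightarrow> b \<in> Obj C \<Longrightarrow> Ide C a \<odot> Ide C b = Ide C (a \<otimes> b)"
  by (rule TenA_Ide)

lemma TenA_merge:
  assumes "f \<in> Arr C" "f' \<in> Arr C" "g \<in> Arr C" "g' \<in> Arr C" "Dom C f' = Cod C f" "Dom C g' = Cod C g"
  shows "(f' \<odot> g') \<cdot> (f \<odot> g) = (f' \<cdot> f) \<odot> (g' \<cdot> g)"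
  using TenA_Comp[of f _ _ f' _ g _ _ g'] assms by (simp add: in_hom_iff)

text \<open>In a right-nested composite the left side of a known equation occurs as
  \<open>g \<cdot> f \<cdot> h\<close>, with no subterm \<open>g \<cdot> f\<close>. This carries the
  equation over to that position, as in \<open>TenA_merge'\<close>.\<close>

lemma Comp_extend:
  assumes "g \<cdot> f = k" "f \<in> Arr C" "g \<in> Arr C" "h \<in> Arr C" "Dom C g = Cod C f" "Dom C f = Cod C h"
  shows "g \<cdot> f \<cdot> h = k \<cdot> h"
  using assms by (metis Comp_assoc_simp)

lemma TenA_merge':
  assumes "f \<in> Arr C" "f' \<in> Arr C" "g \<in> Arr C" "g' \<in> Arr C" "Dom C f' = Cod C f" "Dom C g' = Cod C g"
    and "h \<in> Arr C" "Cod C h = Dom C f \<otimes> Dom C g"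
  shows "(f' \<odot> g') \<cdot> (f \<odot> g) \<cdot> h = ((f' \<cdot> f) \<odot> (g' \<cdot> g)) \<cdot> h"
  using assms by (intro Comp_extend TenA_merge) auto

lemma ass_simps [simp]:
  assumes "a \<in> Obj C" "b \<in> Obj C" "c \<in> Obj C"
  shows "ass C a b c \<in> Arr C" "Dom C (ass C a b c) = a \<otimes> (b \<otimes> c)"
    "Cod C (ass C a b c) = (a \<otimes> b) \<otimes> c" "iso C (ass C a b c)"
  using ass_hom[OF assms] ass_iso[OF assms] by (simp_all add: in_hom_iff)

lemma run_simps [simp]:
  assumes "a \<in> Obj C"
  shows "run C a \<in> Arr C" "Dom C (run C a) = a \<otimes> \<one>" "Cod C (run C a) = a" "iso C (run C a)"
  using run_hom[OF assms] run_iso[OF assms] by (simp_all add: in_hom_iff)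

lemma lun_simps [simp]:
  assumes "a \<in> Obj C"
  shows "lun C a \<in> Arr C" "Dom C (lun C a) = \<one> \<otimes> a" "Cod C (lun C a) = a" "iso C (lun C a)"
  using lun_hom[OF assms] lun_iso[OF assms] by (simp_all add: in_hom_iff)

lemma braid_simps [simp]:
  assumes "a \<in> Obj C" "b \<in> Obj C"
  shows "braid C a b \<in> Arr C" "Dom C (braid C a b) = a \<otimes> b" "Cod C (braid C a b) = b \<otimes> a"
  using sym_hom[OF assms] by (simp_all add: in_hom_iff)

lemma inverses_unique: "inverses C f g \<Longrightarrow> inverses C f h \<Longrightarrow> g = h"
  unfolding inverses_def in_hom_iff by (metis Comp_Ide_simps Comp_assoc_simp)

lemma inv_arr_eqI: "inverses C f g \<Longrightarrow> inv_arr C f = g"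
  unfolding inv_arr_def using inverses_unique by blast

lemma inverses_inv_arr: "iso C f \<Longrightarrow> inverses C f (inv_arr C f)"
  unfolding iso_def using inv_arr_eqI by blast

lemma inverses_sym: "inverses C f g \<Longrightarrow> inverses C g f"
  unfolding inverses_def in_hom_iff by auto

lemma iso_Arr: "iso C f \<Longrightarrow> f \<in> Arr C"
  unfolding iso_def inverses_def by auto

lemma inv_arr_simps [simp]:
  assumes "iso C f"
  shows "inv_arr C f \<in> Arr C" "Dom C (inv_arr C f) = Cod C f" "Cod C (inv_arr C f) = Dom C f"
    "inv_arr C f \<cdot> f = Ide C (Dom C f)" "f \<cdot> inv_arr C f = Ide C (Cod C f)" "iso C (inv_arr C f)"
  using inverses_inv_arr[OF assms] inverses_sym[OF inverses_inv_arr[OF assms]]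
  unfolding inverses_def in_hom_iff iso_def by auto

lemma inv_arr_cancel [simp]:
  assumes "iso C f" "h \<in> Arr C"
  shows "Cod C h = Dom C f \<Longrightarrow> inv_arr C f \<cdot> f \<cdot> h = h"
    "Cod C h = Cod C f \<Longrightarrow> f \<cdot> inv_arr C f \<cdot> h = h"
  using assms iso_Arr[OF assms(1)] by (simp_all flip: Comp_assoc_simp)

lemma inverses_Comp:
  assumes "inverses C f f'" "inverses C g g'" "Dom C g = Cod C f"
  shows "inverses C (g \<cdot> f) (f' \<cdot> g')"
proof -
  have "f' \<cdot> g' \<cdot> g \<cdot> f = f' \<cdot> (g' \<cdot> g) \<cdot> f" "g \<cdot> f \<cdot> f' \<cdot> g' = g \<cdot> (f \<cdot> f') \<cdot> g'"
    using assms by (simp_all add: inverses_def in_hom_iff del: Comp_assoc_simp add: Comp_assoc_simp[symmetric])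
  with assms show ?thesis unfolding inverses_def in_hom_iff by auto
qed

lemma inverses_TenA:
  "inverses C f f' \<Longrightarrow> inverses C g g' \<Longrightarrow> inverses C (f \<odot> g) (f' \<odot> g')"
  unfolding inverses_def in_hom_iff by (auto simp: TenA_merge)

lemma iso_Comp [simp]: "iso C f \<Longrightarrow> iso C g \<Longrightarrow> Dom C g = Cod C f \<Longrightarrow> iso C (g \<cdot> f)"
  unfolding iso_def using inverses_Comp by blast

lemma iso_TenA [simp]: "iso C f \<Longrightarrow> iso C g \<Longrightarrow> iso C (f \<odot> g)"
  unfolding iso_def using inverses_TenA by blast

lemma inv_arr_TenA: "iso C f \<Longrightarrow> iso C g \<Longrightarrow> inv_arr C (f \<odot> g) = inv_arr C f \<odot> inv_arr C g"
  by (intro inv_arr_eqI inverses_TenA inverses_inv_arr)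

lemma inverses_Ide: "a \<in> Obj C \<Longrightarrow> inverses C (Ide C a) (Ide C a)"
  by (simp add: inverses_def in_hom_iff)

lemma iso_Ide [simp]: "a \<in> Obj C \<Longrightarrow> iso C (Ide C a)"
  unfolding iso_def using inverses_Ide by blast

lemma inv_arr_Ide [simp]: "a \<in> Obj C \<Longrightarrow> inv_arr C (Ide C a) = Ide C a"
  by (intro inv_arr_eqI inverses_Ide)

lemma iso_braid [simp]: "a \<in> Obj C \<Longrightarrow> b \<in> Obj C \<Longrightarrow> iso C (braid C a b)"
  unfolding iso_def inverses_def in_hom_iff by (rule exI[of _ "braid C b a"]) (simp add: sym_sym)

lemma iso_cancel_left:
  assumes "k \<cdot> f = k \<cdot> g" "iso C k" "f \<in> Arr C" "g \<in> Arr C" "Cod C f = Dom C k" "Cod C g = Dom C k"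
  shows "f = g"
  using assms by (metis inv_arr_cancel(1))

lemma iso_cancel_right:
  assumes "f \<cdot> k = g \<cdot> k" "iso C k" "f \<in> Arr C" "g \<in> Arr C" "Dom C f = Cod C k" "Dom C g = Cod C k"
  shows "f = g"
proof -
  have "f = (f \<cdot> k) \<cdot> inv_arr C k" using assms(2-) iso_Arr[OF assms(2)] by simp
  also have "\<dots> = (g \<cdot> k) \<cdot> inv_arr C k" using assms(1) by simp
  also have "\<dots> = g" using assms(2-) iso_Arr[OF assms(2)] by simp
  finally show ?thesis .
qed

text \<open>A commuting square with two invertible parallel sides can be read in the opposite
  direction. Naturality of inverse structural arrows and of inverse transformations is drawn from
  it.\<close>

lemma naturality_inv:
  assumes "iso C k" "iso C k'" "k' \<cdot> f = g \<cdot> k" "f \<in> Arr C" "g \<in> Arr C"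
    "Cod C f = Dom C k'" "Dom C f = Dom C k" "Cod C g = Cod C k'" "Dom C g = Cod C k"
  shows "inv_arr C k' \<cdot> g = f \<cdot> inv_arr C k"
proof (rule iso_cancel_right)
  have [simp]: "k \<in> Arr C" "k' \<in> Arr C" using assms iso_Arr by auto
  have "(inv_arr C k' \<cdot> g) \<cdot> k = inv_arr C k' \<cdot> k' \<cdot> f" using assms(1,2,4-) by (simp add: assms(3))
  also have "\<dots> = (f \<cdot> inv_arr C k) \<cdot> k" using assms(1,2,4-) by simp
  finally show "(inv_arr C k' \<cdot> g) \<cdot> k = (f \<cdot> inv_arr C k) \<cdot> k" .
qed (use assms iso_Arr in auto)

lemma ass_nat:
  assumes "f \<in> Arr C" "g \<in> Arr C" "h \<in> Arr C"
    "Cod C f = a'" "Cod C g = b'" "Cod C h = c'"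
  shows "ass C a' b' c' \<cdot> (f \<odot> (g \<odot> h)) = ((f \<odot> g) \<odot> h) \<cdot> ass C (Dom C f) (Dom C g) (Dom C h)"
  using ass_natural[of f "Dom C f" a' g "Dom C g" b' h "Dom C h" c'] assms by (simp add: in_hom_iff)

lemma ass_inv_nat:
  assumes "f \<in> Arr C" "g \<in> Arr C" "h \<in> Arr C"
    "Cod C f = a'" "Cod C g = b'" "Cod C h = c'"
  shows "inv_arr C (ass C a' b' c') \<cdot> ((f \<odot> g) \<odot> h)
    = (f \<odot> (g \<odot> h)) \<cdot> inv_arr C (ass C (Dom C f) (Dom C g) (Dom C h))"
  using assms by (intro naturality_inv ass_nat) auto

lemma run_nat: "f \<in> Arr C \<Longrightarrow> Cod C f = a' \<Longrightarrow> run C a' \<cdot> (f \<odot> Ide C \<one>) = f \<cdot> run C (Dom C f)"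
  using run_natural[of f "Dom C f" a'] by (simp add: in_hom_iff)

lemma lun_nat: "f \<in> Arr C \<Longrightarrow> Cod C f = a' \<Longrightarrow> lun C a' \<cdot> (Ide C \<one> \<odot> f) = f \<cdot> lun C (Dom C f)"
  using lun_natural[of f "Dom C f" a'] by (simp add: in_hom_iff)

lemma run_inv_nat:
  assumes "f \<in> Arr C" "Cod C f = a'"
  shows "inv_arr C (run C a') \<cdot> f = (f \<odot> Ide C \<one>) \<cdot> inv_arr C (run C (Dom C f))"
  using assms by (intro naturality_inv run_nat) auto

lemma braid_nat:
  assumes "f \<in> Arr C" "g \<in> Arr C" "Cod C f = a'" "Cod C g = b'"
  shows "braid C a' b' \<cdot> (f \<odot> g) = (g \<odot> f) \<cdot> braid C (Dom C f) (Dom C g)"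
  using sym_natural[of f "Dom C f" a' g "Dom C g" b'] assms by (simp add: in_hom_iff)

section \<open>Consequences of pentagon and triangle for the unit isomorphisms\<close>

lemma unit_faithful:
  assumes "f \<in> Arr C" "g \<in> Arr C" "Dom C f = Dom C g" "Cod C f = Cod C g"
  shows "Ide C \<one> \<odot> f = Ide C \<one> \<odot> g \<Longrightarrow> f = g" "f \<odot> Ide C \<one> = g \<odot> Ide C \<one> \<Longrightarrow> f = g"
proof -
  assume h: "Ide C \<one> \<odot> f = Ide C \<one> \<odot> g"
  have "f \<cdot> lun C (Dom C f) = g \<cdot> lun C (Dom C f)"
    using lun_nat[OF assms(1) HOL.refl] lun_nat[OF assms(2) HOL.refl] h assms(3,4) by metis
  then show "f = g" by (rule iso_cancel_right) (use assms in simp_all)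
next
  assume h: "f \<odot> Ide C \<one> = g \<odot> Ide C \<one>"
  have "f \<cdot> run C (Dom C f) = g \<cdot> run C (Dom C f)"
    using run_nat[OF assms(1) HOL.refl] run_nat[OF assms(2) HOL.refl] h assms(3,4) by metis
  then show "f = g" by (rule iso_cancel_right) (use assms in simp_all)
qed

text \<open>Tensoring with \<one> on the left is faithful, so the equation may be proved under it.
  There it comes from the pentagon at \<one>, \<one>, a, b: the triangle is applied twice, and the
  invertible \<open>ass C \<one> a b\<close> cancels.\<close>

lemma lun_TenO:
  assumes [simp]: "a \<in> Obj C" "b \<in> Obj C"
  shows "(lun C a \<odot> Ide C b) \<cdot> ass C \<one> a b = lun C (a \<otimes> b)"
proof (rule unit_faithful(1))
  let ?i = "Ide C \<one>"
  have "ass C \<one> a b \<cdot> (?i \<odot> lun C (a \<otimes> b)) = ass C \<one> a b \<cdot> (run C \<one> \<odot> Ide C (a \<otimes> b)) \<cdot> ass C \<one> \<one> (a \<otimes> b)"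
    by (simp add: triangle)
  also have "\<dots> = (ass C \<one> a b \<cdot> (run C \<one> \<odot> (Ide C a \<odot> Ide C b))) \<cdot> ass C \<one> \<one> (a \<otimes> b)"
    by simp
  also have "\<dots> = ((run C \<one> \<odot> Ide C a) \<odot> Ide C b) \<cdot> ass C (\<one> \<otimes> \<one>) a b \<cdot> ass C \<one> \<one> (a \<otimes> b)"
    by (subst ass_nat) auto
  also have "\<dots> = ((run C \<one> \<odot> Ide C a) \<odot> Ide C b) \<cdot> (ass C \<one> \<one> a \<odot> Ide C b) \<cdot> ass C \<one> (\<one> \<otimes> a) b \<cdot> (?i \<odot> ass C \<one> a b)"
    by (simp add: pentagon)
  also have "\<dots> = ((?i \<odot> lun C a) \<odot> Ide C b) \<cdot> ass C \<one> (\<one> \<otimes> a) b \<cdot> (?i \<odot> ass C \<one> a b)"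
    by (simp add: TenA_merge' triangle)
  also have "\<dots> = (((?i \<odot> lun C a) \<odot> Ide C b) \<cdot> ass C \<one> (\<one> \<otimes> a) b) \<cdot> (?i \<odot> ass C \<one> a b)"
    by simp
  also have "\<dots> = ass C \<one> a b \<cdot> (?i \<odot> (lun C a \<odot> Ide C b)) \<cdot> (?i \<odot> ass C \<one> a b)"
    using ass_nat[of ?i "lun C a" "Ide C b" \<one> a b] by (simp flip: Comp_assoc_simp)
  finally have "?i \<odot> lun C (a \<otimes> b) = (?i \<odot> (lun C a \<odot> Ide C b)) \<cdot> (?i \<odot> ass C \<one> a b)"
    by (rule iso_cancel_left) simp_all
  then show "?i \<odot> ((lun C a \<odot> Ide C b) \<cdot> ass C \<one> a b) = ?i \<odot> lun C (a \<otimes> b)"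
    by (simp add: TenA_merge)
qed auto

text \<open>The mirror argument: tensor with \<one> on the right and use the pentagon at a, b,
  \<one>, \<one>.\<close>

lemma run_TenO:
  assumes [simp]: "a \<in> Obj C" "b \<in> Obj C"
  shows "run C (a \<otimes> b) \<cdot> ass C a b \<one> = Ide C a \<odot> run C b"
proof (rule unit_faithful(2))
  let ?i = "Ide C \<one>" and ?k = "ass C a (b \<otimes> \<one>) \<one> \<cdot> (Ide C a \<odot> ass C b \<one> \<one>)"
  have "((run C (a \<otimes> b) \<cdot> ass C a b \<one>) \<odot> ?i) \<cdot> ?k
      = (run C (a \<otimes> b) \<odot> ?i) \<cdot> (ass C a b \<one> \<odot> ?i) \<cdot> ass C a (b \<otimes> \<one>) \<one> \<cdot> (Ide C a \<odot> ass C b \<one> \<one>)"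
    by (simp add: TenA_merge')
  also have "\<dots> = (run C (a \<otimes> b) \<odot> ?i) \<cdot> ass C (a \<otimes> b) \<one> \<one> \<cdot> ass C a b (\<one> \<otimes> \<one>)"
    by (simp add: pentagon)
  also have "\<dots> = ((Ide C a \<odot> Ide C b) \<odot> lun C \<one>) \<cdot> ass C a b (\<one> \<otimes> \<one>)"
    by (simp add: triangle flip: Comp_assoc_simp)
  also have "\<dots> = ass C a b \<one> \<cdot> (Ide C a \<odot> ((run C b \<odot> ?i) \<cdot> ass C b \<one> \<one>))"
    using ass_nat[of "Ide C a" "Ide C b" "lun C \<one>" a b \<one>] by (simp add: triangle)
  also have "\<dots> = (ass C a b \<one> \<cdot> (Ide C a \<odot> (run C b \<odot> ?i))) \<cdot> (Ide C a \<odot> ass C b \<one> \<one>)"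
    by (simp add: TenA_merge)
  also have "\<dots> = ((Ide C a \<odot> run C b) \<odot> ?i) \<cdot> ?k"
    by (subst ass_nat) auto
  finally show "(run C (a \<otimes> b) \<cdot> ass C a b \<one>) \<odot> ?i = (Ide C a \<odot> run C b) \<odot> ?i"
    by (rule iso_cancel_right) simp_all
qed auto

text \<open>Naturality of \<open>lun\<close> at \<open>lun C \<one>\<close> identifies
  \<open>lun C (\<one> \<otimes> \<one>)\<close> with
  \<open>Ide C \<one> \<odot> lun C \<one>\<close>. The triangle and \<open>lun_TenO\<close> then
  give both unit isomorphisms the same tensor with the identity of \<one>.\<close>

lemma run_Unit: "run C \<one> = lun C \<one>"
proof (rule unit_faithful(2))
  have "lun C \<one> \<cdot> lun C (\<one> \<otimes> \<one>) = lun C \<one> \<cdot> (Ide C \<one> \<odot> lun C \<one>)"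
    using lun_nat[of "lun C \<one>" \<one>] by simp
  then have "lun C (\<one> \<otimes> \<one>) = Ide C \<one> \<odot> lun C \<one>"
    by (rule iso_cancel_left) simp_all
  then have "(run C \<one> \<odot> Ide C \<one>) \<cdot> ass C \<one> \<one> \<one> = (lun C \<one> \<odot> Ide C \<one>) \<cdot> ass C \<one> \<one> \<one>"
    by (simp add: triangle lun_TenO)
  then show "run C \<one> \<odot> Ide C \<one> = lun C \<one> \<odot> Ide C \<one>"
    by (rule iso_cancel_right) simp_all
qed auto

end

section \<open>Coherence\<close>

text \<open>What it takes to bring b to the front past a while c stays behind.
  \<open>interchange\<close> is this arrow under a spectator object, between two
  associators.\<close>

definition swap :: "('o, 'm) smc \<Rightarrow> 'o \<Rightarrow> 'o \<Rightarrow> 'o \<Rightarrow> 'm" where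
  "swap C a b c = inv_arr C (ass C b a c) \<cdot>\<^bsub>C\<^esub> (braid C a b \<odot>\<^bsub>C\<^esub> Ide C c) \<cdot>\<^bsub>C\<^esub> ass C a b c"

context sm_category
begin

lemma swap_simps [simp]:
  assumes "a \<in> Obj C" "b \<in> Obj C" "c \<in> Obj C"
  shows "swap C a b c \<in> Arr C" "Dom C (swap C a b c) = a \<otimes> (b \<otimes> c)"
    "Cod C (swap C a b c) = b \<otimes> (a \<otimes> c)" "iso C (swap C a b c)"
  using assms by (simp_all add: swap_def)

lemma swap_nat:
  assumes [simp]: "f \<in> Arr C" "g \<in> Arr C" "h \<in> Arr C" and [simp]: "Cod C f = a'" "Cod C g = b'" "Cod C h = c'"
  shows "swap C a' b' c' \<cdot> (f \<odot> (g \<odot> h)) = (g \<odot> (f \<odot> h)) \<cdot> swap C (Dom C f) (Dom C g) (Dom C h)"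
proof -
  have [simp]: "a' \<in> Obj C" "b' \<in> Obj C" "c' \<in> Obj C" using assms Dom_Cod_in by blast+
  have "swap C a' b' c' \<cdot> (f \<odot> (g \<odot> h))
      = inv_arr C (ass C b' a' c') \<cdot> (braid C a' b' \<odot> Ide C c') \<cdot> ass C a' b' c' \<cdot> (f \<odot> (g \<odot> h))"
    by (simp add: swap_def)
  also have "\<dots> = inv_arr C (ass C b' a' c') \<cdot> (((braid C a' b' \<cdot> (f \<odot> g)) \<odot> h) \<cdot> ass C (Dom C f) (Dom C g) (Dom C h))"
    by (simp add: ass_nat TenA_merge')
  also have "\<dots> = (inv_arr C (ass C b' a' c') \<cdot> ((g \<odot> f) \<odot> h))
      \<cdot> (braid C (Dom C f) (Dom C g) \<odot> Ide C (Dom C h)) \<cdot> ass C (Dom C f) (Dom C g) (Dom C h)"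
    by (simp add: braid_nat TenA_merge')
  also have "\<dots> = (g \<odot> (f \<odot> h)) \<cdot> swap C (Dom C f) (Dom C g) (Dom C h)"
    by (simp add: ass_inv_nat swap_def)
  finally show ?thesis .
qed

section \<open>Bringing a letter x to the front, before or after a structural isomorphism\<close>

context
  fixes x a b c
  assumes x [simp]: "x \<in> Obj C" and a [simp]: "a \<in> Obj C" and b [simp]: "b \<in> Obj C" and c [simp]: "c \<in> Obj C"
begin

text \<open>The pentagon with three of its associators inverted: x leads the first of three factors
  that are being reassociated.\<close>

lemma pentagon_inv:
  "inv_arr C (ass C x (a \<otimes> b) c) \<cdot> (inv_arr C (ass C x a b) \<odot> Ide C c) \<cdot> ass C (x \<otimes> a) b c
    = (Ide C x \<odot> ass C a b c) \<cdot> inv_arr C (ass C x a (b \<otimes> c))"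
proof (rule iso_cancel_right)
  have "(inv_arr C (ass C x (a \<otimes> b) c) \<cdot> (inv_arr C (ass C x a b) \<odot> Ide C c) \<cdot> ass C (x \<otimes> a) b c) \<cdot> ass C x a (b \<otimes> c)
    = inv_arr C (ass C x (a \<otimes> b) c) \<cdot> (inv_arr C (ass C x a b) \<odot> Ide C c) \<cdot> (ass C (x \<otimes> a) b c \<cdot> ass C x a (b \<otimes> c))"
    by simp
  also have "\<dots> = inv_arr C (ass C x (a \<otimes> b) c) \<cdot> ((inv_arr C (ass C x a b) \<odot> Ide C c) \<cdot> (ass C x a b \<odot> Ide C c)) \<cdot> ass C x (a \<otimes> b) c \<cdot> (Ide C x \<odot> ass C a b c)"
    by (simp add: pentagon)
  also have "\<dots> = ((Ide C x \<odot> ass C a b c) \<cdot> inv_arr C (ass C x a (b \<otimes> c))) \<cdot> ass C x a (b \<otimes> c)"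
    by (simp add: TenA_merge TenA_merge')
  finally show "(inv_arr C (ass C x (a \<otimes> b) c) \<cdot> (inv_arr C (ass C x a b) \<odot> Ide C c) \<cdot> ass C (x \<otimes> a) b c) \<cdot> ass C x a (b \<otimes> c)
    = ((Ide C x \<odot> ass C a b c) \<cdot> inv_arr C (ass C x a (b \<otimes> c))) \<cdot> ass C x a (b \<otimes> c)" .
qed simp_all

text \<open>Here x leads the middle factor. Precomposing with the invertible
  \<open>Ide C a \<odot> ass C x b c\<close> makes the pentagon for a, x, b, c applicable;
  naturality of \<open>ass\<close> moves the braiding across, and \<open>pentagon_inv\<close> closes
  the diagram.\<close>

lemma swap_ass_middle:
  "inv_arr C (ass C x (a \<otimes> b) c) \<cdot> (swap C a x b \<odot> Ide C c) \<cdot> ass C a (x \<otimes> b) c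
    = (Ide C x \<odot> ass C a b c) \<cdot> swap C a x (b \<otimes> c) \<cdot> (Ide C a \<odot> inv_arr C (ass C x b c))"
proof -
  let ?ai = "inv_arr C (ass C x (a \<otimes> b) c)" and ?i = "inv_arr C (ass C x a b) \<odot> Ide C c"
  let ?j = "Ide C a \<odot> ass C x b c"
  have ass_nat1: "((braid C a x \<odot> Ide C b) \<odot> Ide C c) \<cdot> ass C (a \<otimes> x) b c
      = ass C (x \<otimes> a) b c \<cdot> (braid C a x \<odot> Ide C (b \<otimes> c))"
    using ass_nat[of "braid C a x" "Ide C b" "Ide C c" "x \<otimes> a" b c] by simp
  have "?ai \<cdot> (swap C a x b \<odot> Ide C c) \<cdot> ass C a (x \<otimes> b) c \<cdot> ?j
      = ?ai \<cdot> ?i \<cdot> ((braid C a x \<odot> Ide C b) \<odot> Ide C c) \<cdot> ((ass C a x b \<odot> Ide C c) \<cdot> ass C a (x \<otimes> b) c \<cdot> ?j)"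
    by (simp add: swap_def TenA_merge')
  also have "\<dots> = ?ai \<cdot> ?i \<cdot> (((braid C a x \<odot> Ide C b) \<odot> Ide C c) \<cdot> ass C (a \<otimes> x) b c) \<cdot> ass C a x (b \<otimes> c)"
    by (simp flip: pentagon)
  also have "\<dots> = (?ai \<cdot> ?i \<cdot> ass C (x \<otimes> a) b c) \<cdot> (braid C a x \<odot> Ide C (b \<otimes> c)) \<cdot> ass C a x (b \<otimes> c)"
    by (subst ass_nat1) simp
  also have "\<dots> = (Ide C x \<odot> ass C a b c) \<cdot> swap C a x (b \<otimes> c)"
    by (simp add: pentagon_inv swap_def)
  finally have *: "?ai \<cdot> (swap C a x b \<odot> Ide C c) \<cdot> ass C a (x \<otimes> b) c \<cdot> ?j
      = (Ide C x \<odot> ass C a b c) \<cdot> swap C a x (b \<otimes> c)" .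
  have "?ai \<cdot> (swap C a x b \<odot> Ide C c) \<cdot> ass C a (x \<otimes> b) c
      = (?ai \<cdot> (swap C a x b \<odot> Ide C c) \<cdot> ass C a (x \<otimes> b) c \<cdot> ?j) \<cdot> (Ide C a \<odot> inv_arr C (ass C x b c))"
    by (simp add: TenA_merge)
  then show ?thesis by (simp add: *)
qed

text \<open>Here x leads the last factor and must cross a compound object, so this associator case
  rests on the hexagon.\<close>

lemma swap_ass_right:
  "swap C (a \<otimes> b) x c \<cdot> ass C a b (x \<otimes> c)
    = (Ide C x \<odot> ass C a b c) \<cdot> swap C a x (b \<otimes> c) \<cdot> (Ide C a \<odot> swap C b x c)"
proof -
  let ?c = "Ide C c" and ?ai = "inv_arr C (ass C x (a \<otimes> b) c)"
  let ?h = "(braid C a x \<odot> Ide C b) \<cdot> ass C a x b \<cdot> (Ide C a \<odot> braid C b x)"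
  \<comment> \<open>The hexagon solved for the braiding: to cross a \<otimes> b, the letter x
    crosses b and then a.\<close>
  have "braid C (a \<otimes> b) x = (inv_arr C (ass C x a b) \<cdot> (ass C x a b \<cdot> braid C (a \<otimes> b) x \<cdot> ass C a b x)) \<cdot> inv_arr C (ass C a b x)"
    by simp
  also have "\<dots> = swap C a x b \<cdot> (Ide C a \<odot> braid C b x) \<cdot> inv_arr C (ass C a b x)"
    by (simp add: hexagon swap_def)
  finally have br: "braid C (a \<otimes> b) x = swap C a x b \<cdot> (Ide C a \<odot> braid C b x) \<cdot> inv_arr C (ass C a b x)" .
  have "(inv_arr C (ass C a b x) \<odot> ?c) \<cdot> (ass C (a \<otimes> b) x c \<cdot> ass C a b (x \<otimes> c))
      = ((inv_arr C (ass C a b x) \<odot> ?c) \<cdot> (ass C a b x \<odot> ?c)) \<cdot> ass C a (b \<otimes> x) c \<cdot> (Ide C a \<odot> ass C b x c)"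
    by (simp add: pentagon)
  then have p: "(inv_arr C (ass C a b x) \<odot> ?c) \<cdot> ass C (a \<otimes> b) x c \<cdot> ass C a b (x \<otimes> c)
      = ass C a (b \<otimes> x) c \<cdot> (Ide C a \<odot> ass C b x c)"
    by (simp add: TenA_merge)
  have ass_nat1: "((Ide C a \<odot> braid C b x) \<odot> ?c) \<cdot> ass C a (b \<otimes> x) c
      = ass C a (x \<otimes> b) c \<cdot> (Ide C a \<odot> (braid C b x \<odot> ?c))"
    using ass_nat[of "Ide C a" "braid C b x" ?c a "x \<otimes> b" c] by simp
  have "swap C (a \<otimes> b) x c \<cdot> ass C a b (x \<otimes> c)
      = ?ai \<cdot> (braid C (a \<otimes> b) x \<odot> ?c) \<cdot> ass C (a \<otimes> b) x c \<cdot> ass C a b (x \<otimes> c)"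
    by (simp add: swap_def)
  also have "\<dots> = ?ai \<cdot> (swap C a x b \<odot> ?c) \<cdot> ((Ide C a \<odot> braid C b x) \<odot> ?c) \<cdot> (inv_arr C (ass C a b x) \<odot> ?c)
      \<cdot> ass C (a \<otimes> b) x c \<cdot> ass C a b (x \<otimes> c)"
    unfolding br by (simp add: TenA_merge')
  also have "\<dots> = ?ai \<cdot> (swap C a x b \<odot> ?c) \<cdot> (((Ide C a \<odot> braid C b x) \<odot> ?c) \<cdot> ass C a (b \<otimes> x) c) \<cdot> (Ide C a \<odot> ass C b x c)"
    by (simp add: p)
  also have "\<dots> = (?ai \<cdot> (swap C a x b \<odot> ?c) \<cdot> ass C a (x \<otimes> b) c) \<cdot> (Ide C a \<odot> (braid C b x \<odot> ?c)) \<cdot> (Ide C a \<odot> ass C b x c)"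
    by (subst ass_nat1) simp
  also have "\<dots> = (Ide C x \<odot> ass C a b c) \<cdot> swap C a x (b \<otimes> c) \<cdot> (Ide C a \<odot> swap C b x c)"
    unfolding swap_ass_middle by (simp add: TenA_merge swap_def[of C b])
  finally show ?thesis .
qed

end

context
  fixes x a
  assumes x [simp]: "x \<in> Obj C" and a [simp]: "a \<in> Obj C"
begin

text \<open>After the braiding of x \<otimes> a with b, the letter x stands behind b and has to
  cross back. The hexagon splits off the braiding of x with b, which this crossing cancels.\<close>

lemma swap_braid_left:
  assumes [simp]: "b \<in> Obj C"
  shows "(Ide C x \<odot> braid C a b) \<cdot> inv_arr C (ass C x a b) = swap C b x a \<cdot> braid C (x \<otimes> a) b"
proof (rule iso_cancel_right)
  have "(swap C b x a \<cdot> braid C (x \<otimes> a) b) \<cdot> ass C x a b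
      = inv_arr C (ass C x b a) \<cdot> (braid C b x \<odot> Ide C a) \<cdot> (ass C b x a \<cdot> braid C (x \<otimes> a) b \<cdot> ass C x a b)"
    by (simp add: swap_def)
  also have "\<dots> = Ide C x \<odot> braid C a b"
    by (simp add: hexagon TenA_merge' sym_sym)
  finally show "((Ide C x \<odot> braid C a b) \<cdot> inv_arr C (ass C x a b)) \<cdot> ass C x a b
      = (swap C b x a \<cdot> braid C (x \<otimes> a) b) \<cdot> ass C x a b"
    by simp
qed simp_all

lemma run_ass_inv: "(Ide C x \<odot> run C a) \<cdot> inv_arr C (ass C x a \<one>) = run C (x \<otimes> a)"
  by (simp flip: run_TenO)

text \<open>By \<open>unit_sym\<close> and \<open>sym_sym\<close>, braiding with \<one> turns
  \<open>run\<close> into \<open>lun\<close>; the rest is the triangle and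
  \<open>lun_TenO\<close>.\<close>

lemma swap_lun: "(Ide C x \<odot> lun C a) \<cdot> swap C \<one> x a = lun C (x \<otimes> a)"
proof -
  have "run C x \<cdot> braid C \<one> x = lun C x"
    by (simp add: unit_sym sym_sym)
  moreover have "(Ide C x \<odot> lun C a) \<cdot> inv_arr C (ass C x \<one> a) = run C x \<odot> Ide C a"
    by (simp flip: triangle)
  then have "((Ide C x \<odot> lun C a) \<cdot> inv_arr C (ass C x \<one> a)) \<cdot> (braid C \<one> x \<odot> Ide C a) \<cdot> ass C \<one> x a
      = (run C x \<odot> Ide C a) \<cdot> (braid C \<one> x \<odot> Ide C a) \<cdot> ass C \<one> x a" by simp
  ultimately show ?thesis
    by (simp add: swap_def TenA_merge' lun_TenO)
qed

end

text \<open>Mirror image of \<open>swap_braid_left\<close>, deduced from it by inserting the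
  braiding of a with x \<otimes> b together with its inverse.\<close>

lemma swap_braid_right:
  assumes [simp]: "x \<in> Obj C" "a \<in> Obj C" "b \<in> Obj C"
  shows "(Ide C x \<odot> braid C a b) \<cdot> swap C a x b = inv_arr C (ass C x b a) \<cdot> braid C a (x \<otimes> b)"
proof -
  have "(Ide C x \<odot> braid C a b) \<cdot> swap C a x b
      = (Ide C x \<odot> braid C a b) \<cdot> (swap C a x b \<cdot> braid C (x \<otimes> b) a) \<cdot> braid C a (x \<otimes> b)"
    by (simp add: sym_sym)
  also have "\<dots> = ((Ide C x \<odot> braid C a b) \<cdot> (Ide C x \<odot> braid C b a)) \<cdot> inv_arr C (ass C x b a) \<cdot> braid C a (x \<otimes> b)"
    by (subst swap_braid_left[symmetric]) simp_all
  also have "\<dots> = inv_arr C (ass C x b a) \<cdot> braid C a (x \<otimes> b)"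
    by (simp add: TenA_merge sym_sym)
  finally show ?thesis .
qed

end

section \<open>Words in the objects of the category, and coherence\<close>

primrec word_obj :: "('o, 'm) smc \<Rightarrow> ('o, nat) tobj \<Rightarrow> 'o" where
  "word_obj C TUnit = \<one>\<^bsub>C\<^esub>"
| "word_obj C (TGen a n) = a"
| "word_obj C (X \<otimes>\<^sub>t Y) = word_obj C X \<otimes>\<^bsub>C\<^esub> word_obj C Y"

text \<open>The type of objects of a tensor product is reused for words, with a tag in the place of
  the second object; a letter is an object together with its tag.\<close>

primrec letters :: "('o, nat) tobj \<Rightarrow> ('o \<times> nat) list" where
  "letters TUnit = []"
| "letters (TGen a n) = [(a, n)]"
| "letters (X \<otimes>\<^sub>t Y) = letters X @ letters Y"

abbreviation word_in :: "('o, 'm) smc \<Rightarrow> ('o, nat) tobj \<Rightarrow> bool" where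
  "word_in C X \<equiv> fst ` set (letters X) \<subseteq> Obj C"

text \<open>The structural isomorphisms, together with the words in objects of the category that
  they are meant to connect. The number attached to a letter distinguishes its occurrences.\<close>

inductive canonical ::
  "('o, 'm) smc \<Rightarrow> ('o, nat) tobj \<Rightarrow> ('o, nat) tobj \<Rightarrow> 'm \<Rightarrow> bool" for C where
  Ide: "word_in C X \<Longrightarrow> canonical C X X (Ide C (word_obj C X))"
| Comp: "\<lbrakk>canonical C X Y f; canonical C Y Z g\<rbrakk> \<Longrightarrow> canonical C X Z (g \<cdot>\<^bsub>C\<^esub> f)"
| TenA: "\<lbrakk>canonical C X X' f; canonical C Y Y' g\<rbrakk> \<Longrightarrow> canonical C (X \<otimes>\<^sub>t Y) (X' \<otimes>\<^sub>t Y') (f \<odot>\<^bsub>C\<^esub> g)"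
| ass: "\<lbrakk>word_in C X; word_in C Y; word_in C Z\<rbrakk> \<Longrightarrow> canonical C (X \<otimes>\<^sub>t (Y \<otimes>\<^sub>t Z)) ((X \<otimes>\<^sub>t Y) \<otimes>\<^sub>t Z)
    (ass C (word_obj C X) (word_obj C Y) (word_obj C Z))"
| run: "word_in C X \<Longrightarrow> canonical C (X \<otimes>\<^sub>t TUnit) X (run C (word_obj C X))"
| lun: "word_in C X \<Longrightarrow> canonical C (TUnit \<otimes>\<^sub>t X) X (lun C (word_obj C X))"
| braid: "\<lbrakk>word_in C X; word_in C Y\<rbrakk> \<Longrightarrow> canonical C (X \<otimes>\<^sub>t Y) (Y \<otimes>\<^sub>t X) (braid C (word_obj C X) (word_obj C Y))"
| inv: "canonical C X Y f \<Longrightarrow> canonical C Y X (inv_arr C f)"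

text \<open>Collapses a word without letters to the unit object. The clause for a letter is a
  filler.\<close>

primrec unit_arr :: "('o, 'm) smc \<Rightarrow> ('o, nat) tobj \<Rightarrow> 'm" where
  "unit_arr C TUnit = Ide C \<one>\<^bsub>C\<^esub>"
| "unit_arr C (TGen a n) = Ide C a"
| "unit_arr C (X \<otimes>\<^sub>t Y) = lun C \<one>\<^bsub>C\<^esub> \<cdot>\<^bsub>C\<^esub> (unit_arr C X \<odot>\<^bsub>C\<^esub> unit_arr C Y)"

text \<open>The letter leaves a \<open>TUnit\<close> in its place, so the bracketing survives and a
  structural isomorphism between words becomes one of the same kind between the shortened words. The
  second clause does not inspect x: it is meant for the case that x is this letter.\<close>

primrec remove_letter :: "'o \<times> nat \<Rightarrow> ('o, nat) tobj \<Rightarrow> ('o, nat) tobj" where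
  "remove_letter x TUnit = TUnit"
| "remove_letter x (TGen a n) = TUnit"
| "remove_letter x (X \<otimes>\<^sub>t Y) =
    (if x \<in> set (letters X) then remove_letter x X \<otimes>\<^sub>t Y else X \<otimes>\<^sub>t remove_letter x Y)"

text \<open>The isomorphism from the word to x tensored with the shortened word. A letter in the
  left factor needs reassociation only; one in the right factor is carried across the left factor by
  \<open>swap\<close>. The inverse of \<open>run\<close> creates the unit that
  \<open>remove_letter\<close> leaves behind.\<close>

primrec pull :: "('o, 'm) smc \<Rightarrow> 'o \<times> nat \<Rightarrow> ('o, nat) tobj \<Rightarrow> 'm" where
  "pull C x TUnit = Ide C \<one>\<^bsub>C\<^esub>"
| "pull C x (TGen a n) = inv_arr C (run C a)"
| "pull C x (X \<otimes>\<^sub>t Y) =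
    (if x \<in> set (letters X)
     then inv_arr C (ass C (fst x) (word_obj C (remove_letter x X)) (word_obj C Y))
       \<cdot>\<^bsub>C\<^esub> (pull C x X \<odot>\<^bsub>C\<^esub> Ide C (word_obj C Y))
     else swap C (word_obj C X) (fst x) (word_obj C (remove_letter x Y))
       \<cdot>\<^bsub>C\<^esub> (Ide C (word_obj C X) \<odot>\<^bsub>C\<^esub> pull C x Y))"

context sm_category
begin

lemma word_obj_in [simp]: "word_in C X \<Longrightarrow> word_obj C X \<in> Obj C"
  by (induction X) (auto simp: image_Un)

text \<open>Braidings permute the letters, so it is their set that is preserved. Distinctness is
  carried along because \<open>pull_canonical\<close> uses its induction hypothesis at the middle
  word of a composite and, for an inverse, at the opposite end.\<close>

lemma canonical_props:
  assumes "canonical C X Y f"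
  shows "word_in C X \<and> word_in C Y \<and> iso C f \<and> f \<in> Arr C \<and> Dom C f = word_obj C X \<and> Cod C f = word_obj C Y"
    and "set (letters X) = set (letters Y) \<and> (distinct (letters X) \<longleftrightarrow> distinct (letters Y))"
  using assms by (induction) (auto simp: image_Un)

lemma unit_arr_simps [simp]:
  assumes "letters X = []"
  shows "iso C (unit_arr C X)" "Dom C (unit_arr C X) = word_obj C X" "Cod C (unit_arr C X) = \<one>"
    "unit_arr C X \<in> Arr C"
proof -
  have "iso C (unit_arr C X) \<and> unit_arr C X \<in> Arr C \<and> Dom C (unit_arr C X) = word_obj C X \<and> Cod C (unit_arr C X) = \<one>"
    using assms by (induction X) auto
  then show "iso C (unit_arr C X)" "Dom C (unit_arr C X) = word_obj C X" "Cod C (unit_arr C X) = \<one>"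
    "unit_arr C X \<in> Arr C" by auto
qed

text \<open>The base case of coherence: the collapse is invertible, so a canonical arrow between
  words without letters is determined by its ends. By naturality each structural case comes down to
  the unit object, where \<open>run_Unit\<close> with the triangle settles \<open>ass\<close>, and
  \<open>run_Unit\<close> with \<open>unit_sym\<close> settles \<open>braid\<close>.\<close>

lemma unit_arr_canonical:
  assumes "canonical C X Y f" "letters X = []"
  shows "unit_arr C Y \<cdot> f = unit_arr C X"
  using assms
proof (induction)
  case (Ide X)
  then show ?case by simp
next
  case (Comp X Y f Z g)
  note p = canonical_props[OF Comp(1)] canonical_props[OF Comp(2)]
  then have "letters Y = []" "letters Z = []" using Comp by auto
  with p have "unit_arr C Z \<cdot> (g \<cdot> f) = (unit_arr C Z \<cdot> g) \<cdot> f" by simp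
  also have "\<dots> = unit_arr C X" using Comp \<open>letters Y = []\<close> by simp
  finally show ?case .
next
  case (TenA X X' f Y Y' g)
  note p = canonical_props[OF TenA(1)] canonical_props[OF TenA(2)]
  then have "letters X' = []" "letters Y' = []" using TenA by auto
  with TenA p show ?case by (simp add: TenA_merge)
next
  case (ass X Y Z)
  let ?x = "unit_arr C X" and ?y = "unit_arr C Y" and ?z = "unit_arr C Z" and ?i = "Ide C \<one>"
  have e [simp]: "letters X = []" "letters Y = []" "letters Z = []" using ass by auto
  have "unit_arr C ((X \<otimes>\<^sub>t Y) \<otimes>\<^sub>t Z) \<cdot> ass C (word_obj C X) (word_obj C Y) (word_obj C Z)
    = lun C \<one> \<cdot> (lun C \<one> \<odot> ?i) \<cdot> (((?x \<odot> ?y) \<odot> ?z) \<cdot> ass C (word_obj C X) (word_obj C Y) (word_obj C Z))"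
    by (simp add: TenA_merge')
  also have "\<dots> = lun C \<one> \<cdot> ((lun C \<one> \<odot> ?i) \<cdot> ass C \<one> \<one> \<one>) \<cdot> (?x \<odot> (?y \<odot> ?z))"
    using ass_nat[of ?x ?y ?z \<one> \<one> \<one>] by simp
  also have "\<dots> = lun C \<one> \<cdot> (?i \<odot> lun C \<one>) \<cdot> (?x \<odot> (?y \<odot> ?z))"
    unfolding run_Unit[symmetric] triangle[OF Unit_in Unit_in] by simp
  also have "\<dots> = unit_arr C (X \<otimes>\<^sub>t (Y \<otimes>\<^sub>t Z))"
    by (simp add: TenA_merge)
  finally show ?case .
next
  case (run X)
  then show ?case using run_nat[of "unit_arr C X" \<one>] by (simp add: run_Unit)
next
  case (lun X)
  then show ?case using lun_nat[of "unit_arr C X" \<one>] by simp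
next
  case (braid X Y)
  let ?x = "unit_arr C X" and ?y = "unit_arr C Y"
  have e [simp]: "letters X = []" "letters Y = []" using braid by auto
  have "unit_arr C (Y \<otimes>\<^sub>t X) \<cdot> braid C (word_obj C X) (word_obj C Y)
    = (lun C \<one> \<cdot> braid C \<one> \<one>) \<cdot> (?x \<odot> ?y)"
    using braid_nat[of ?x ?y \<one> \<one>] by simp
  also have "\<dots> = unit_arr C (X \<otimes>\<^sub>t Y)"
    by (simp add: unit_sym[symmetric] run_Unit)
  finally show ?case .
next
  case (inv X Y f)
  note p = canonical_props[OF inv(1)]
  then have "letters X = []" using inv by auto
  then have "unit_arr C Y \<cdot> f = unit_arr C X" using inv by simp
  then have "unit_arr C X \<cdot> inv_arr C f = (unit_arr C Y \<cdot> f) \<cdot> inv_arr C f" by simp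
  also have "\<dots> = unit_arr C Y" using p(1) inv(3) by simp
  finally show ?case .
qed

lemma letters_remove_letter [simp]:
  "x \<in> set (letters X) \<Longrightarrow> distinct (letters X) \<Longrightarrow> letters (remove_letter x X) = removeAll x (letters X)"
  by (induction X) (auto simp: disjoint_iff intro!: removeAll_id[symmetric], (metis prod.collapse)+)

lemma word_in_remove_letter [simp]: "word_in C X \<Longrightarrow> word_in C (remove_letter x X)"
  by (induction X) (auto simp: image_Un)

lemma letter_in [simp]: "x \<in> set (letters X) \<Longrightarrow> word_in C X \<Longrightarrow> fst x \<in> Obj C"
  by auto

lemma pull_simps [simp]:
  assumes "x \<in> set (letters X)" "word_in C X"
  shows "pull C x X \<in> Arr C" "iso C (pull C x X)" "Dom C (pull C x X) = word_obj C X"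
    "Cod C (pull C x X) = fst x \<otimes> word_obj C (remove_letter x X)"
proof -
  have "pull C x X \<in> Arr C \<and> iso C (pull C x X) \<and> Dom C (pull C x X) = word_obj C X
    \<and> Cod C (pull C x X) = fst x \<otimes> word_obj C (remove_letter x X)"
    using assms
  proof (induction X)
    case (TTen X Y)
    then have "fst x \<in> Obj C" by auto
    with TTen show ?case by (auto simp: image_Un)
  qed auto
  then show "pull C x X \<in> Arr C" "iso C (pull C x X)" "Dom C (pull C x X) = word_obj C X"
    "Cod C (pull C x X) = fst x \<otimes> word_obj C (remove_letter x X)" by auto
qed

text \<open>The induction step of coherence: extracting a letter commutes with a canonical arrow, up
  to a canonical arrow between the shortened words. Composites, tensors and inverses are formal;
  each structural isomorphism, split according to the factor that contains x, is one of the lemmas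
  on bringing x to the front.\<close>

lemma pull_canonical:
  assumes "canonical C X Y f" "x \<in> set (letters X)" "distinct (letters X)"
  shows "\<exists>f'. canonical C (remove_letter x X) (remove_letter x Y) f'
    \<and> pull C x Y \<cdot> f = (Ide C (fst x) \<odot> f') \<cdot> pull C x X"
  using assms
proof (induction)
  case (Ide X)
  then have "canonical C (remove_letter x X) (remove_letter x X) (Ide C (word_obj C (remove_letter x X)))"
    by (intro canonical.Ide) auto
  moreover have "fst x \<in> Obj C" "word_in C (remove_letter x X)" using Ide by auto
  ultimately show ?case using Ide by (intro exI conjI) auto
next
  case (Comp X Y f Z g)
  note p = canonical_props[OF Comp(1)] canonical_props[OF Comp(2)]
  obtain f' where f': "canonical C (remove_letter x X) (remove_letter x Y) f'"
      "pull C x Y \<cdot> f = (Ide C (fst x) \<odot> f') \<cdot> pull C x X"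
    using Comp by auto
  obtain g' where g': "canonical C (remove_letter x Y) (remove_letter x Z) g'"
      "pull C x Z \<cdot> g = (Ide C (fst x) \<odot> g') \<cdot> pull C x Y"
    using Comp p by auto
  have x: "x \<in> set (letters X)" "x \<in> set (letters Y)" "x \<in> set (letters Z)" "fst x \<in> Obj C"
    using Comp p by auto
  note q = canonical_props[OF f'(1)] canonical_props[OF g'(1)]
  have "pull C x Z \<cdot> (g \<cdot> f) = (pull C x Z \<cdot> g) \<cdot> f" using p x by simp
  also have "\<dots> = (Ide C (fst x) \<odot> g') \<cdot> (pull C x Y \<cdot> f)" unfolding g'(2) using p x q by simp
  also have "\<dots> = (Ide C (fst x) \<odot> (g' \<cdot> f')) \<cdot> pull C x X" unfolding f'(2) using p x q by (simp add: TenA_merge')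
  finally show ?case using canonical.Comp[OF f'(1) g'(1)] by auto
next
  case (TenA X X' f Y Y' g)
  note p = canonical_props[OF TenA(1)] canonical_props[OF TenA(2)]
  have x: "fst x \<in> Obj C" using TenA p by auto
  show ?case
  proof (cases "x \<in> set (letters X)")
    case True
    then obtain f' where f': "canonical C (remove_letter x X) (remove_letter x X') f'"
        "pull C x X' \<cdot> f = (Ide C (fst x) \<odot> f') \<cdot> pull C x X"
      using TenA by auto
    have t: "x \<in> set (letters X')" using True p by auto
    note q = canonical_props[OF f'(1)]
    let ?ai = "inv_arr C (ass C (fst x) (word_obj C (remove_letter x X')) (word_obj C Y'))"
    have "pull C x (X' \<otimes>\<^sub>t Y') \<cdot> (f \<odot> g) = ?ai \<cdot> ((pull C x X' \<cdot> f) \<odot> g)"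
      using p x t by (simp add: TenA_merge)
    also have "\<dots> = (?ai \<cdot> ((Ide C (fst x) \<odot> f') \<odot> g)) \<cdot> (pull C x X \<odot> Ide C (word_obj C Y))"
      unfolding f'(2) using p q x True by (simp add: TenA_merge)
    also have "\<dots> = (Ide C (fst x) \<odot> (f' \<odot> g)) \<cdot> pull C x (X \<otimes>\<^sub>t Y)"
      using p q x True by (simp add: ass_inv_nat)
    finally show ?thesis using canonical.TenA[OF f'(1) TenA(2)] True t by auto
  next
    case False
    then have y: "x \<in> set (letters Y)" "x \<in> set (letters Y')" "x \<notin> set (letters X')" using TenA p by auto
    then obtain g' where g': "canonical C (remove_letter x Y) (remove_letter x Y') g'"
        "pull C x Y' \<cdot> g = (Ide C (fst x) \<odot> g') \<cdot> pull C x Y"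
      using TenA by auto
    note q = canonical_props[OF g'(1)]
    let ?s = "swap C (word_obj C X') (fst x) (word_obj C (remove_letter x Y'))"
    have "pull C x (X' \<otimes>\<^sub>t Y') \<cdot> (f \<odot> g) = ?s \<cdot> (f \<odot> (pull C x Y' \<cdot> g))"
      using p x y by (simp add: TenA_merge)
    also have "\<dots> = (?s \<cdot> (f \<odot> (Ide C (fst x) \<odot> g'))) \<cdot> (Ide C (word_obj C X) \<odot> pull C x Y)"
      unfolding g'(2) using p q x y by (simp add: TenA_merge)
    also have "\<dots> = (Ide C (fst x) \<odot> (f \<odot> g')) \<cdot> pull C x (X \<otimes>\<^sub>t Y)"
      using p q x y False by (simp add: swap_nat)
    finally show ?thesis using canonical.TenA[OF TenA(1) g'(1)] False y by auto
  qed
next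
  case (ass X Y Z)
  have x [simp]: "fst x \<in> Obj C" and [simp]: "word_obj C X \<in> Obj C" "word_obj C Y \<in> Obj C" "word_obj C Z \<in> Obj C"
    using ass by auto
  let ?a = "ass C (word_obj C X) (word_obj C Y) (word_obj C Z)" and ?z = "Ide C (word_obj C Z)"
  consider (X) "x \<in> set (letters X)" | (Y) "x \<notin> set (letters X)" "x \<in> set (letters Y)"
    | (Z) "x \<notin> set (letters X)" "x \<notin> set (letters Y)" "x \<in> set (letters Z)" using ass by auto
  then show ?case
  proof cases
    case X
    let ?X = "word_obj C (remove_letter x X)"
    have [simp]: "?X \<in> Obj C" using ass by simp
    have "pull C x ((X \<otimes>\<^sub>t Y) \<otimes>\<^sub>t Z) \<cdot> ?a = inv_arr C (ass C (fst x) (?X \<otimes> word_obj C Y) (word_obj C Z))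
       \<cdot> (inv_arr C (ass C (fst x) ?X (word_obj C Y)) \<odot> ?z)
       \<cdot> (((pull C x X \<odot> Ide C (word_obj C Y)) \<odot> ?z) \<cdot> ?a)"
      using ass X by (simp add: TenA_merge')
    also have "\<dots> = (inv_arr C (ass C (fst x) (?X \<otimes> word_obj C Y) (word_obj C Z))
       \<cdot> (inv_arr C (ass C (fst x) ?X (word_obj C Y)) \<odot> ?z)
       \<cdot> ass C (fst x \<otimes> ?X) (word_obj C Y) (word_obj C Z)) \<cdot> (pull C x X \<odot> Ide C (word_obj C Y \<otimes> word_obj C Z))"
      using ass X ass_nat[of "pull C x X" "Ide C (word_obj C Y)" ?z "fst x \<otimes> ?X" "word_obj C Y" "word_obj C Z"] by simp
    also have "\<dots> = (Ide C (fst x) \<odot> ass C ?X (word_obj C Y) (word_obj C Z)) \<cdot> pull C x (X \<otimes>\<^sub>t (Y \<otimes>\<^sub>t Z))"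
      using ass X by (simp add: pentagon_inv)
    finally show ?thesis
      using X ass canonical.ass[OF word_in_remove_letter[OF ass(1), of x] ass(2) ass(3)] by auto
  next
    case Y
    let ?Y = "word_obj C (remove_letter x Y)"
    have [simp]: "?Y \<in> Obj C" using ass by simp
    have "pull C x ((X \<otimes>\<^sub>t Y) \<otimes>\<^sub>t Z) \<cdot> ?a = inv_arr C (ass C (fst x) (word_obj C X \<otimes> ?Y) (word_obj C Z))
       \<cdot> (swap C (word_obj C X) (fst x) ?Y \<odot> ?z)
       \<cdot> (((Ide C (word_obj C X) \<odot> pull C x Y) \<odot> ?z) \<cdot> ?a)"
      using ass Y by (simp add: TenA_merge')
    also have "\<dots> = (inv_arr C (ass C (fst x) (word_obj C X \<otimes> ?Y) (word_obj C Z))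
       \<cdot> (swap C (word_obj C X) (fst x) ?Y \<odot> ?z) \<cdot> ass C (word_obj C X) (fst x \<otimes> ?Y) (word_obj C Z))
       \<cdot> (Ide C (word_obj C X) \<odot> (pull C x Y \<odot> ?z))"
      using ass Y ass_nat[of "Ide C (word_obj C X)" "pull C x Y" ?z "word_obj C X" "fst x \<otimes> ?Y" "word_obj C Z"] by simp
    also have "\<dots> = (Ide C (fst x) \<odot> ass C (word_obj C X) ?Y (word_obj C Z)) \<cdot> pull C x (X \<otimes>\<^sub>t (Y \<otimes>\<^sub>t Z))"
      using ass Y by (simp add: swap_ass_middle TenA_merge)
    finally show ?thesis
      using Y canonical.ass[OF ass(1) word_in_remove_letter[OF ass(2), of x] ass(3)] by auto
  next
    case Z
    let ?Z = "word_obj C (remove_letter x Z)"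
    have [simp]: "?Z \<in> Obj C" using ass by simp
    have "pull C x ((X \<otimes>\<^sub>t Y) \<otimes>\<^sub>t Z) \<cdot> ?a = swap C (word_obj C X \<otimes> word_obj C Y) (fst x) ?Z
       \<cdot> (((Ide C (word_obj C X) \<odot> Ide C (word_obj C Y)) \<odot> pull C x Z) \<cdot> ?a)"
      using ass Z by simp
    also have "\<dots> = (swap C (word_obj C X \<otimes> word_obj C Y) (fst x) ?Z \<cdot> ass C (word_obj C X) (word_obj C Y) (fst x \<otimes> ?Z))
        \<cdot> (Ide C (word_obj C X) \<odot> (Ide C (word_obj C Y) \<odot> pull C x Z))"
      using ass Z ass_nat[of "Ide C (word_obj C X)" "Ide C (word_obj C Y)" "pull C x Z" "word_obj C X" "word_obj C Y" "fst x \<otimes> ?Z"]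
      by simp
    also have "\<dots> = (Ide C (fst x) \<odot> ass C (word_obj C X) (word_obj C Y) ?Z) \<cdot> pull C x (X \<otimes>\<^sub>t (Y \<otimes>\<^sub>t Z))"
      using ass Z by (simp add: swap_ass_right TenA_merge)
    finally show ?thesis
      using Z ass canonical.ass[OF ass(1) ass(2) word_in_remove_letter[OF ass(3), of x]] by auto
  qed
next
  case (run X)
  let ?X = "word_obj C (remove_letter x X)"
  have x [simp]: "x \<in> set (letters X)" "fst x \<in> Obj C" "?X \<in> Obj C"
    using run word_obj_in[OF word_in_remove_letter[OF run(1), of x]] by auto
  have "pull C x X \<cdot> run C (word_obj C X) = run C (fst x \<otimes> ?X) \<cdot> (pull C x X \<odot> Ide C \<one>)"
    using run by (simp add: run_nat)
  also have "\<dots> = (Ide C (fst x) \<odot> run C ?X) \<cdot> pull C x (X \<otimes>\<^sub>t TUnit)"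
    using run by (simp flip: run_ass_inv)
  finally show ?case using run canonical.run[OF word_in_remove_letter[OF run(1), of x]] by auto
next
  case (lun X)
  let ?X = "word_obj C (remove_letter x X)"
  have x [simp]: "x \<in> set (letters X)" "fst x \<in> Obj C" "?X \<in> Obj C"
    using lun word_obj_in[OF word_in_remove_letter[OF lun(1), of x]] by auto
  have "pull C x X \<cdot> lun C (word_obj C X) = lun C (fst x \<otimes> ?X) \<cdot> (Ide C \<one> \<odot> pull C x X)"
    using lun by (simp add: lun_nat)
  also have "\<dots> = (Ide C (fst x) \<odot> lun C ?X) \<cdot> pull C x (TUnit \<otimes>\<^sub>t X)"
    using lun by (simp flip: swap_lun)
  finally show ?case using lun canonical.lun[OF word_in_remove_letter[OF lun(1), of x]] by auto
next
  case (braid X Y)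
  let ?b = "braid C (word_obj C X) (word_obj C Y)"
  have x [simp]: "fst x \<in> Obj C" and [simp]: "word_obj C X \<in> Obj C" "word_obj C Y \<in> Obj C"
    using braid by auto
  show ?case
  proof (cases "x \<in> set (letters X)")
    case True
    let ?X = "word_obj C (remove_letter x X)"
    have [simp]: "?X \<in> Obj C" using braid by simp
    have t: "x \<notin> set (letters Y)" using True braid by auto
    have "pull C x (Y \<otimes>\<^sub>t X) \<cdot> ?b = (swap C (word_obj C Y) (fst x) ?X \<cdot> braid C (fst x \<otimes> ?X) (word_obj C Y))
        \<cdot> (pull C x X \<odot> Ide C (word_obj C Y))"
      using braid True t braid_nat[of "pull C x X" "Ide C (word_obj C Y)"] by simp
    also have "\<dots> = (Ide C (fst x) \<odot> braid C ?X (word_obj C Y)) \<cdot> pull C x (X \<otimes>\<^sub>t Y)"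
      using braid True by (simp flip: swap_braid_left)
    finally show ?thesis
      using True t braid canonical.braid[OF word_in_remove_letter[OF braid(1), of x] braid(2)] by auto
  next
    case False
    let ?Y = "word_obj C (remove_letter x Y)"
    have [simp]: "?Y \<in> Obj C" using braid by simp
    have t: "x \<in> set (letters Y)" using False braid by auto
    have "pull C x (Y \<otimes>\<^sub>t X) \<cdot> ?b = (inv_arr C (ass C (fst x) ?Y (word_obj C X)) \<cdot> braid C (word_obj C X) (fst x \<otimes> ?Y))
        \<cdot> (Ide C (word_obj C X) \<odot> pull C x Y)"
      using braid False t braid_nat[of "Ide C (word_obj C X)" "pull C x Y"] by simp
    also have "\<dots> = (Ide C (fst x) \<odot> braid C (word_obj C X) ?Y) \<cdot> pull C x (X \<otimes>\<^sub>t Y)"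
      using braid False t by (simp flip: swap_braid_right)
    finally show ?thesis
      using False t braid canonical.braid[OF braid(1) word_in_remove_letter[OF braid(2), of x]] by auto
  qed
next
  case (inv X Y f)
  note p = canonical_props[OF inv(1)]
  then have x: "x \<in> set (letters X)" "x \<in> set (letters Y)" "fst x \<in> Obj C" using inv by auto
  obtain f' where f': "canonical C (remove_letter x X) (remove_letter x Y) f'"
      "pull C x Y \<cdot> f = (Ide C (fst x) \<odot> f') \<cdot> pull C x X"
    using inv p by auto
  note q = canonical_props[OF f'(1)]
  \<comment> \<open>The square of f is turned around by cancelling the invertible
    \<open>Ide C (fst x) \<odot> f'\<close> on the left.\<close>
  have "(Ide C (fst x) \<odot> f') \<cdot> (pull C x X \<cdot> inv_arr C f) = ((Ide C (fst x) \<odot> f') \<cdot> pull C x X) \<cdot> inv_arr C f"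
    using p q x by simp
  also have "\<dots> = (Ide C (fst x) \<odot> f') \<cdot> ((Ide C (fst x) \<odot> inv_arr C f') \<cdot> pull C x Y)"
    unfolding f'(2)[symmetric] using p q x by (simp add: TenA_merge')
  finally have "pull C x X \<cdot> inv_arr C f = (Ide C (fst x) \<odot> inv_arr C f') \<cdot> pull C x Y"
    by (rule iso_cancel_left) (use p q x in simp_all)
  then show ?case using canonical.inv[OF f'(1)] by auto
qed

text \<open>Induction on the number of letters: \<open>pull_canonical\<close> expresses both arrows
  through canonical arrows between shorter words, and \<open>pull\<close> is invertible.
  Distinctness is essential: on a word a \<otimes> a with equal tags, the identity and the braiding
  are both canonical.\<close>

theorem coherence:
  assumes "canonical C X Y f" "canonical C X Y g" "distinct (letters X)"
  shows "f = g"
  using assms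
proof (induction "length (letters X)" arbitrary: X Y f g)
  case 0
  then have "unit_arr C Y \<cdot> f = unit_arr C X" "unit_arr C Y \<cdot> g = unit_arr C X"
    by (auto intro: unit_arr_canonical)
  then have "unit_arr C Y \<cdot> f = unit_arr C Y \<cdot> g" by simp
  then show ?case
    by (rule iso_cancel_left) (use 0 canonical_props[of X Y f] canonical_props[of X Y g] in auto)
next
  case (Suc n)
  note p = canonical_props[OF Suc(3)] canonical_props[OF Suc(4)]
  obtain x where x: "x \<in> set (letters X)" using Suc(2) by (cases "letters X") auto
  with p have y: "x \<in> set (letters Y)" "fst x \<in> Obj C" by auto
  obtain f' where f': "canonical C (remove_letter x X) (remove_letter x Y) f'"
      "pull C x Y \<cdot> f = (Ide C (fst x) \<odot> f') \<cdot> pull C x X"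
    using pull_canonical[OF Suc(3) x] Suc by auto
  obtain g' where g': "canonical C (remove_letter x X) (remove_letter x Y) g'"
      "pull C x Y \<cdot> g = (Ide C (fst x) \<odot> g') \<cdot> pull C x X"
    using pull_canonical[OF Suc(4) x] Suc by auto
  have "length (letters (remove_letter x X)) = n"
    using Suc(2) x Suc(5) by (simp add: distinct_remove1_removeAll[symmetric] length_remove1)
  moreover have "distinct (letters (remove_letter x X))"
    using Suc(5) x by (simp add: distinct_removeAll)
  ultimately have "f' = g'" using Suc(1) f'(1) g'(1) by blast
  then have "pull C x Y \<cdot> f = pull C x Y \<cdot> g" using f'(2) g'(2) by simp
  then show ?case by (rule iso_cancel_left) (use p x y in simp_all)
qed

end

text \<open>The introduction rules with the objects as free variables, equated to values of words
  afterwards. A concrete arrow then matches syntactically, and since the first arrow of a composite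
  is treated first, the intermediate words are found from the given source by unification.\<close>

lemma canonical_intros:
  "\<lbrakk>canonical C X Y f; canonical C Y Z g\<rbrakk> \<Longrightarrow> canonical C X Z (g \<cdot>\<^bsub>C\<^esub> f)"
  "\<lbrakk>canonical C X X' f; canonical C Y Y' g\<rbrakk> \<Longrightarrow> canonical C (X \<otimes>\<^sub>t Y) (X' \<otimes>\<^sub>t Y') (f \<odot>\<^bsub>C\<^esub> g)"
  "\<lbrakk>word_in C X; a = word_obj C X\<rbrakk> \<Longrightarrow> canonical C X X (Ide C a)"
  "\<lbrakk>word_in C X; word_in C Y; word_in C Z; a = word_obj C X; b = word_obj C Y; c = word_obj C Z\<rbrakk>
    \<Longrightarrow> canonical C (X \<otimes>\<^sub>t (Y \<otimes>\<^sub>t Z)) ((X \<otimes>\<^sub>t Y) \<otimes>\<^sub>t Z) (ass C a b c)"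
  "\<lbrakk>word_in C X; a = word_obj C X\<rbrakk> \<Longrightarrow> canonical C (X \<otimes>\<^sub>t TUnit) X (run C a)"
  "\<lbrakk>word_in C X; a = word_obj C X\<rbrakk> \<Longrightarrow> canonical C (TUnit \<otimes>\<^sub>t X) X (lun C a)"
  "\<lbrakk>word_in C X; word_in C Y; a = word_obj C X; b = word_obj C Y\<rbrakk>
    \<Longrightarrow> canonical C (X \<otimes>\<^sub>t Y) (Y \<otimes>\<^sub>t X) (braid C a b)"
  "canonical C X Y f \<Longrightarrow> canonical C Y X (inv_arr C f)"
  by (auto intro: canonical.intros)

lemma canonical_interchange:
  assumes "word_in C X" "word_in C Y" "word_in C Z" "word_in C W"
    "a = word_obj C X" "b = word_obj C Y" "c = word_obj C Z" "d = word_obj C W"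
  shows "canonical C ((X \<otimes>\<^sub>t Y) \<otimes>\<^sub>t (Z \<otimes>\<^sub>t W)) ((X \<otimes>\<^sub>t Z) \<otimes>\<^sub>t (Y \<otimes>\<^sub>t W)) (interchange C a b c d)"
  unfolding interchange_def
  by (insert assms, (rule canonical_intros | (simp add: image_Un; fail))+)

section \<open>Coherence diagrams for the interchange isomorphism\<close>

context sm_category
begin

lemma interchange_alt:
  "interchange C a b c d = ass C a c (b \<otimes> d) \<cdot> (Ide C a \<odot> swap C b c d) \<cdot> inv_arr C (ass C a b (c \<otimes> d))"
  by (simp add: interchange_def swap_def)

lemma interchange_simps [simp]:
  assumes "a \<in> Obj C" "b \<in> Obj C" "c \<in> Obj C" "d \<in> Obj C"
  shows "interchange C a b c d \<in> Arr C" "Dom C (interchange C a b c d) = (a \<otimes> b) \<otimes> (c \<otimes> d)"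
    "Cod C (interchange C a b c d) = (a \<otimes> c) \<otimes> (b \<otimes> d)" "iso C (interchange C a b c d)"
  using assms by (simp_all add: interchange_alt)

lemma interchange_nat:
  assumes [simp]: "f \<in> Arr C" "g \<in> Arr C" "h \<in> Arr C" "k \<in> Arr C"
    and c [simp]: "Cod C f = a'" "Cod C g = b'" "Cod C h = c'" "Cod C k = d'"
  shows "interchange C a' b' c' d' \<cdot> ((f \<odot> g) \<odot> (h \<odot> k))
    = ((f \<odot> h) \<odot> (g \<odot> k)) \<cdot> interchange C (Dom C f) (Dom C g) (Dom C h) (Dom C k)"
proof -
  have [simp]: "a' \<in> Obj C" "b' \<in> Obj C" "c' \<in> Obj C" "d' \<in> Obj C" using assms Dom_Cod_in by blast+
  have "interchange C a' b' c' d' \<cdot> ((f \<odot> g) \<odot> (h \<odot> k))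
    = ass C a' c' (b' \<otimes> d') \<cdot> (Ide C a' \<odot> swap C b' c' d') \<cdot> (inv_arr C (ass C a' b' (c' \<otimes> d')) \<cdot> ((f \<odot> g) \<odot> (h \<odot> k)))"
    by (simp add: interchange_alt)
  also have "\<dots> = ass C a' c' (b' \<otimes> d') \<cdot> (f \<odot> (swap C b' c' d' \<cdot> (g \<odot> (h \<odot> k))))
      \<cdot> inv_arr C (ass C (Dom C f) (Dom C g) (Dom C h \<otimes> Dom C k))"
    by (simp add: ass_inv_nat TenA_merge')
  also have "\<dots> = (ass C a' c' (b' \<otimes> d') \<cdot> (f \<odot> (h \<odot> (g \<odot> k))))
      \<cdot> (Ide C (Dom C f) \<odot> swap C (Dom C g) (Dom C h) (Dom C k)) \<cdot> inv_arr C (ass C (Dom C f) (Dom C g) (Dom C h \<otimes> Dom C k))"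
    by (simp add: swap_nat TenA_merge')
  also have "\<dots> = ((f \<odot> h) \<odot> (g \<odot> k)) \<cdot> interchange C (Dom C f) (Dom C g) (Dom C h) (Dom C k)"
    by (simp add: ass_nat interchange_alt)
  finally show ?thesis .
qed

text \<open>Together with \<open>interchange_lun\<close>, \<open>interchange_sym\<close> and
  \<open>interchange_ass\<close> this is what remains of the axioms for the pointwise tensor of two
  functors once the functors have been moved out by naturality.\<close>

lemma interchange_run:
  assumes "a \<in> Obj C" "b \<in> Obj C"
  shows "(run C a \<odot> run C b) \<cdot> interchange C a b \<one> \<one> \<cdot> (Ide C (a \<otimes> b) \<odot> inv_arr C (run C \<one>)) = run C (a \<otimes> b)"
  by (rule coherence[where X = "(TGen a 0 \<otimes>\<^sub>t TGen b 1) \<otimes>\<^sub>t TUnit" and Y = "TGen a 0 \<otimes>\<^sub>t TGen b 1"])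
    (insert assms, (rule canonical_intros canonical_interchange | (simp add: image_Un; fail))+)

lemma interchange_lun:
  assumes "a \<in> Obj C" "b \<in> Obj C"
  shows "(lun C a \<odot> lun C b) \<cdot> interchange C \<one> \<one> a b \<cdot> (inv_arr C (run C \<one>) \<odot> Ide C (a \<otimes> b)) = lun C (a \<otimes> b)"
  by (rule coherence[where X = "TUnit \<otimes>\<^sub>t (TGen a 0 \<otimes>\<^sub>t TGen b 1)" and Y = "TGen a 0 \<otimes>\<^sub>t TGen b 1"])
    (insert assms, (rule canonical_intros canonical_interchange | (simp add: image_Un; fail))+)

lemma interchange_sym:
  assumes "a \<in> Obj C" "b \<in> Obj C" "c \<in> Obj C" "d \<in> Obj C"
  shows "(braid C a c \<odot> braid C b d) \<cdot> interchange C a b c d = interchange C c d a b \<cdot> braid C (a \<otimes> b) (c \<otimes> d)"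
  by (rule coherence[where X = "(TGen a 0 \<otimes>\<^sub>t TGen b 1) \<otimes>\<^sub>t (TGen c 2 \<otimes>\<^sub>t TGen d 3)"
        and Y = "(TGen c 2 \<otimes>\<^sub>t TGen a 0) \<otimes>\<^sub>t (TGen d 3 \<otimes>\<^sub>t TGen b 1)"])
    (insert assms, (rule canonical_intros canonical_interchange | (simp add: image_Un; fail))+)

text \<open>The relation \<open>gamma_delta\<close> of the tensor product and the comparison in
  \<open>box_smf\<close> carry the interchange on opposite sides of the equation; this converts one
  form into the other.\<close>

lemma interchange_involution:
  assumes "a \<in> Obj C" "b \<in> Obj C" "c \<in> Obj C" "d \<in> Obj C"
  shows "interchange C a c b d \<cdot> interchange C a b c d = Ide C ((a \<otimes> b) \<otimes> (c \<otimes> d))"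
  by (rule coherence[where X = "(TGen a 0 \<otimes>\<^sub>t TGen b 1) \<otimes>\<^sub>t (TGen c 2 \<otimes>\<^sub>t TGen d 3)"
        and Y = "(TGen a 0 \<otimes>\<^sub>t TGen b 1) \<otimes>\<^sub>t (TGen c 2 \<otimes>\<^sub>t TGen d 3)"])
    (insert assms, (rule canonical_intros canonical_interchange | (simp add: image_Un; fail))+)

lemma interchange_ass:
  assumes "a \<in> Obj C" "b \<in> Obj C" "c \<in> Obj C" "d \<in> Obj C" "e \<in> Obj C" "f \<in> Obj C"
  shows "interchange C (a \<otimes> c) (b \<otimes> d) e f \<cdot> (interchange C a b c d \<odot> Ide C (e \<otimes> f))
      \<cdot> ass C (a \<otimes> b) (c \<otimes> d) (e \<otimes> f)
    = (ass C a c e \<odot> ass C b d f) \<cdot> interchange C a b (c \<otimes> e) (d \<otimes> f)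
      \<cdot> (Ide C (a \<otimes> b) \<odot> interchange C c d e f)"
  by (rule coherence[where
        X = "(TGen a 0 \<otimes>\<^sub>t TGen b 1) \<otimes>\<^sub>t ((TGen c 2 \<otimes>\<^sub>t TGen d 3) \<otimes>\<^sub>t (TGen e 4 \<otimes>\<^sub>t TGen f 5))"
        and Y = "((TGen a 0 \<otimes>\<^sub>t TGen c 2) \<otimes>\<^sub>t TGen e 4) \<otimes>\<^sub>t ((TGen b 1 \<otimes>\<^sub>t TGen d 3) \<otimes>\<^sub>t TGen f 5)"])
    (insert assms, (rule canonical_intros canonical_interchange | (simp add: image_Un; fail))+)

text \<open>This and the next three lemmas are the tensor axioms of the associator, unit and
  symmetry transformations of the internal hom, with the functors stripped off.\<close>

lemma ass_interchange:
  assumes "a \<in> Obj C" "b \<in> Obj C" "c \<in> Obj C" "d \<in> Obj C" "e \<in> Obj C" "f \<in> Obj C"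
  shows "ass C (a \<otimes> d) (b \<otimes> e) (c \<otimes> f) \<cdot> (Ide C (a \<otimes> d) \<odot> interchange C b c e f)
      \<cdot> interchange C a (b \<otimes> c) d (e \<otimes> f)
    = (interchange C a b d e \<odot> Ide C (c \<otimes> f)) \<cdot> interchange C (a \<otimes> b) c (d \<otimes> e) f
      \<cdot> (ass C a b c \<odot> ass C d e f)"
  by (rule coherence[where
        X = "(TGen a 0 \<otimes>\<^sub>t (TGen b 1 \<otimes>\<^sub>t TGen c 2)) \<otimes>\<^sub>t (TGen d 3 \<otimes>\<^sub>t (TGen e 4 \<otimes>\<^sub>t TGen f 5))"
        and Y = "((TGen a 0 \<otimes>\<^sub>t TGen d 3) \<otimes>\<^sub>t (TGen b 1 \<otimes>\<^sub>t TGen e 4)) \<otimes>\<^sub>t (TGen c 2 \<otimes>\<^sub>t TGen f 5)"])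
    (insert assms, (rule canonical_intros canonical_interchange | (simp add: image_Un; fail))+)

lemma run_interchange:
  assumes "a \<in> Obj C" "b \<in> Obj C"
  shows "run C (a \<otimes> b) \<cdot> (Ide C (a \<otimes> b) \<odot> run C \<one>) \<cdot> interchange C a \<one> b \<one> = run C a \<odot> run C b"
  by (rule coherence[where X = "(TGen a 0 \<otimes>\<^sub>t TUnit) \<otimes>\<^sub>t (TGen b 1 \<otimes>\<^sub>t TUnit)" and Y = "TGen a 0 \<otimes>\<^sub>t TGen b 1"])
    (insert assms, (rule canonical_intros canonical_interchange | (simp add: image_Un; fail))+)

lemma lun_interchange:
  assumes "a \<in> Obj C" "b \<in> Obj C"
  shows "lun C (a \<otimes> b) \<cdot> (run C \<one> \<odot> Ide C (a \<otimes> b)) \<cdot> interchange C \<one> a \<one> b = lun C a \<odot> lun C b"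
  by (rule coherence[where X = "(TUnit \<otimes>\<^sub>t TGen a 0) \<otimes>\<^sub>t (TUnit \<otimes>\<^sub>t TGen b 1)" and Y = "TGen a 0 \<otimes>\<^sub>t TGen b 1"])
    (insert assms, (rule canonical_intros canonical_interchange | (simp add: image_Un; fail))+)

lemma braid_interchange:
  assumes "a \<in> Obj C" "b \<in> Obj C" "c \<in> Obj C" "d \<in> Obj C"
  shows "braid C (a \<otimes> c) (b \<otimes> d) \<cdot> interchange C a b c d = interchange C b a d c \<cdot> (braid C a b \<odot> braid C c d)"
  by (rule coherence[where X = "(TGen a 0 \<otimes>\<^sub>t TGen b 1) \<otimes>\<^sub>t (TGen c 2 \<otimes>\<^sub>t TGen d 3)"
        and Y = "(TGen b 1 \<otimes>\<^sub>t TGen d 3) \<otimes>\<^sub>t (TGen a 0 \<otimes>\<^sub>t TGen c 2)"])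
    (insert assms, (rule canonical_intros canonical_interchange | (simp add: image_Un; fail))+)

text \<open>The first identity is the unit axiom of the associator of the internal hom; the other
  two serve the constant functor at \<one>, and the last one also the unit axiom of the
  symmetry.\<close>

lemma unit_coherence:
  "ass C \<one> \<one> \<one> \<cdot> (Ide C \<one> \<odot> inv_arr C (run C \<one>)) \<cdot> inv_arr C (run C \<one>)
    = (inv_arr C (run C \<one>) \<odot> Ide C \<one>) \<cdot> inv_arr C (run C \<one>)"
  "run C \<one> \<cdot> (run C \<one> \<odot> Ide C \<one>) \<cdot> ass C \<one> \<one> \<one> = run C \<one> \<cdot> (Ide C \<one> \<odot> run C \<one>)"
  "braid C \<one> \<one> = Ide C (\<one> \<otimes> \<one>)"
proof -
  show "ass C \<one> \<one> \<one> \<cdot> (Ide C \<one> \<odot> inv_arr C (run C \<one>)) \<cdot> inv_arr C (run C \<one>)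
    = (inv_arr C (run C \<one>) \<odot> Ide C \<one>) \<cdot> inv_arr C (run C \<one>)"
    by (rule coherence[where X = TUnit and Y = "(TUnit \<otimes>\<^sub>t TUnit) \<otimes>\<^sub>t TUnit"])
      (rule canonical_intros | (simp; fail))+
  show "run C \<one> \<cdot> (run C \<one> \<odot> Ide C \<one>) \<cdot> ass C \<one> \<one> \<one> = run C \<one> \<cdot> (Ide C \<one> \<odot> run C \<one>)"
    by (rule coherence[where X = "TUnit \<otimes>\<^sub>t (TUnit \<otimes>\<^sub>t TUnit)" and Y = TUnit])
      (rule canonical_intros | (simp; fail))+
  have "lun C \<one> \<cdot> braid C \<one> \<one> = lun C \<one> \<cdot> Ide C (\<one> \<otimes> \<one>)"
    by (simp add: unit_sym[symmetric] run_Unit)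
  then show "braid C \<one> \<one> = Ide C (\<one> \<otimes> \<one>)"
    by (rule iso_cancel_left) simp_all
qed

end

section \<open>Functors, transformations and the internal hom\<close>

context sm_functor
begin

lemma FO_simp [simp]: "x \<in> Obj A \<Longrightarrow> FO F x \<in> Obj B"
  by (rule FO_in)

lemma FA_simps [simp]:
  assumes "f \<in> Arr A"
  shows "FA F f \<in> Arr B" "Dom B (FA F f) = FO F (Dom A f)" "Cod B (FA F f) = FO F (Cod A f)"
  using FA_hom[of f "Dom A f" "Cod A f"] assms by (simp_all add: in_hom_iff)

lemma FA_Ide_simp [simp]: "x \<in> Obj A \<Longrightarrow> FA F (Ide A x) = Ide B (FO F x)"
  by (rule FA_Ide)

lemma FA_Comp_simp [simp]:
  "\<lbrakk>f \<in> Arr A; g \<in> Arr A; Dom A g = Cod A f\<rbrakk> \<Longrightarrow> FA F (g \<cdot>\<^bsub>A\<^esub> f) = FA F g \<cdot>\<^bsub>B\<^esub> FA F f"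
  using FA_Comp by (simp add: in_hom_iff)

lemma F0_simps [simp]:
  "F0 F \<in> Arr B" "Dom B (F0 F) = \<one>\<^bsub>B\<^esub>" "Cod B (F0 F) = FO F \<one>\<^bsub>A\<^esub>"
  using F0_hom by (simp_all add: in_hom_iff)

lemma F2_simps [simp]:
  assumes "x \<in> Obj A" "y \<in> Obj A"
  shows "F2 F x y \<in> Arr B" "Dom B (F2 F x y) = FO F x \<otimes>\<^bsub>B\<^esub> FO F y" "Cod B (F2 F x y) = FO F (x \<otimes>\<^bsub>A\<^esub> y)"
  using F2_hom[OF assms] by (simp_all add: in_hom_iff)

lemma F2_nat:
  "\<lbrakk>f \<in> Arr A; g \<in> Arr A; Cod A f = x'; Cod A g = y'\<rbrakk>
    \<Longrightarrow> F2 F x' y' \<cdot>\<^bsub>B\<^esub> (FA F f \<odot>\<^bsub>B\<^esub> FA F g) = FA F (f \<odot>\<^bsub>A\<^esub> g) \<cdot>\<^bsub>B\<^esub> F2 F (Dom A f) (Dom A g)"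
  using F2_natural[of f "Dom A f" x' g "Dom A g" y'] by (simp add: in_hom_iff)

lemma inverses_FA: "inverses A f g \<Longrightarrow> inverses B (FA F f) (FA F g)"
  unfolding inverses_def in_hom_iff by (auto simp flip: FA_Comp_simp)

lemma iso_FA [simp]: "iso A f \<Longrightarrow> iso B (FA F f)"
  unfolding iso_def using inverses_FA by blast

lemma FA_inv_arr: "iso A f \<Longrightarrow> FA F (inv_arr A f) = inv_arr B (FA F f)"
  by (rule B.inv_arr_eqI[symmetric], rule inverses_FA, rule A.inverses_inv_arr)

text \<open>The iterated comparison from the word of images to the image of the word, assembled from
  \<open>F0\<close> and \<open>F2\<close> along the bracketing.\<close>

primrec F2_word :: "('oa, nat) tobj \<Rightarrow> 'mb" where
  "F2_word TUnit = F0 F"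
| "F2_word (TGen a n) = Ide B (FO F a)"
| "F2_word (X \<otimes>\<^sub>t Y) = F2 F (word_obj A X) (word_obj A Y) \<cdot>\<^bsub>B\<^esub> (F2_word X \<odot>\<^bsub>B\<^esub> F2_word Y)"

text \<open>The tags are kept, so letters with different tags stay different even where F identifies
  their objects.\<close>

abbreviation FO_word :: "('oa, nat) tobj \<Rightarrow> ('ob, nat) tobj" where
  "FO_word \<equiv> map_tobj (FO F) (\<lambda>n. n)"

lemma word_in_FO_word [simp]: "word_in A X \<Longrightarrow> word_in B (FO_word X)"
  by (induction X) (auto simp: image_Un)

lemma F2_word_simps [simp]:
  assumes "word_in A X"
  shows "F2_word X \<in> Arr B" "Dom B (F2_word X) = word_obj B (FO_word X)"
    "Cod B (F2_word X) = FO F (word_obj A X)"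
proof -
  have "F2_word X \<in> Arr B \<and> Dom B (F2_word X) = word_obj B (FO_word X) \<and> Cod B (F2_word X) = FO F (word_obj A X)"
    using assms by (induction X) (auto simp: image_Un)
  then show "F2_word X \<in> Arr B" "Dom B (F2_word X) = word_obj B (FO_word X)"
    "Cod B (F2_word X) = FO F (word_obj A X)" by auto
qed

text \<open>The comparisons of a lax functor need not be invertible, so the image of a canonical
  arrow is related to a canonical arrow of B only through \<open>F2_word\<close>. The axioms
  \<open>F2_ass\<close>, \<open>F2_run\<close>, \<open>F2_lun\<close> and \<open>F2_sym\<close> are
  the structural cases, naturality of \<open>F2\<close> is the case of a tensor. Which arrow g is
  matters little: coherence in B identifies it afterwards.\<close>

lemma FA_canonical:
  assumes "canonical A X Y f"
  shows "\<exists>g. canonical B (FO_word X) (FO_word Y) g \<and> FA F f \<cdot>\<^bsub>B\<^esub> F2_word X = F2_word Y \<cdot>\<^bsub>B\<^esub> g"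
  using assms
proof (induction)
  case (Ide X)
  then have "canonical B (FO_word X) (FO_word X) (Ide B (word_obj B (FO_word X)))"
    by (intro canonical.Ide) simp
  with Ide show ?case by (intro exI conjI) auto
next
  case (Comp X Y f Z g)
  note p = A.canonical_props[OF Comp(1)] A.canonical_props[OF Comp(2)]
  obtain f' g' where f': "canonical B (FO_word X) (FO_word Y) f'" "FA F f \<cdot>\<^bsub>B\<^esub> F2_word X = F2_word Y \<cdot>\<^bsub>B\<^esub> f'"
    and g': "canonical B (FO_word Y) (FO_word Z) g'" "FA F g \<cdot>\<^bsub>B\<^esub> F2_word Y = F2_word Z \<cdot>\<^bsub>B\<^esub> g'"
    using Comp by auto
  note q = B.canonical_props[OF f'(1)] B.canonical_props[OF g'(1)]
  have "FA F (g \<cdot>\<^bsub>A\<^esub> f) \<cdot>\<^bsub>B\<^esub> F2_word X = FA F g \<cdot>\<^bsub>B\<^esub> (FA F f \<cdot>\<^bsub>B\<^esub> F2_word X)"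
    using p by simp
  also have "\<dots> = (FA F g \<cdot>\<^bsub>B\<^esub> F2_word Y) \<cdot>\<^bsub>B\<^esub> f'"
    unfolding f'(2) using p q by simp
  also have "\<dots> = F2_word Z \<cdot>\<^bsub>B\<^esub> (g' \<cdot>\<^bsub>B\<^esub> f')"
    unfolding g'(2) using p q by simp
  finally show ?case using canonical.Comp[OF f'(1) g'(1)] by auto
next
  case (TenA X X' f Y Y' g)
  note p = A.canonical_props[OF TenA(1)] A.canonical_props[OF TenA(2)]
  obtain f' g' where f': "canonical B (FO_word X) (FO_word X') f'" "FA F f \<cdot>\<^bsub>B\<^esub> F2_word X = F2_word X' \<cdot>\<^bsub>B\<^esub> f'"
    and g': "canonical B (FO_word Y) (FO_word Y') g'" "FA F g \<cdot>\<^bsub>B\<^esub> F2_word Y = F2_word Y' \<cdot>\<^bsub>B\<^esub> g'"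
    using TenA by auto
  note q = B.canonical_props[OF f'(1)] B.canonical_props[OF g'(1)]
  have nat: "FA F (f \<odot>\<^bsub>A\<^esub> g) \<cdot>\<^bsub>B\<^esub> F2 F (word_obj A X) (word_obj A Y)
      = F2 F (word_obj A X') (word_obj A Y') \<cdot>\<^bsub>B\<^esub> (FA F f \<odot>\<^bsub>B\<^esub> FA F g)"
    using F2_nat[of f g "word_obj A X'" "word_obj A Y'"] p by simp
  have "FA F (f \<odot>\<^bsub>A\<^esub> g) \<cdot>\<^bsub>B\<^esub> F2_word (X \<otimes>\<^sub>t Y)
      = (FA F (f \<odot>\<^bsub>A\<^esub> g) \<cdot>\<^bsub>B\<^esub> F2 F (word_obj A X) (word_obj A Y)) \<cdot>\<^bsub>B\<^esub> (F2_word X \<odot>\<^bsub>B\<^esub> F2_word Y)"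
    using p by simp
  also have "\<dots> = F2 F (word_obj A X') (word_obj A Y') \<cdot>\<^bsub>B\<^esub> ((FA F f \<cdot>\<^bsub>B\<^esub> F2_word X) \<odot>\<^bsub>B\<^esub> (FA F g \<cdot>\<^bsub>B\<^esub> F2_word Y))"
    unfolding nat using p by (simp add: B.TenA_merge)
  also have "\<dots> = F2_word (X' \<otimes>\<^sub>t Y') \<cdot>\<^bsub>B\<^esub> (f' \<odot>\<^bsub>B\<^esub> g')"
    unfolding f'(2) g'(2) using p q by (simp add: B.TenA_merge)
  finally show ?case using canonical.TenA[OF f'(1) g'(1)] by auto
next
  case (ass X Y Z)
  let ?x = "word_obj A X" and ?y = "word_obj A Y" and ?z = "word_obj A Z"
  let ?fx = "F2_word X" and ?fy = "F2_word Y" and ?fz = "F2_word Z"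
  let ?a = "ass B (word_obj B (FO_word X)) (word_obj B (FO_word Y)) (word_obj B (FO_word Z))"
  have [simp]: "?x \<in> Obj A" "?y \<in> Obj A" "?z \<in> Obj A" using ass by auto
  have "FA F (ass A ?x ?y ?z) \<cdot>\<^bsub>B\<^esub> F2_word (X \<otimes>\<^sub>t (Y \<otimes>\<^sub>t Z))
      = (FA F (ass A ?x ?y ?z) \<cdot>\<^bsub>B\<^esub> F2 F ?x (?y \<otimes>\<^bsub>A\<^esub> ?z) \<cdot>\<^bsub>B\<^esub> (Ide B (FO F ?x) \<odot>\<^bsub>B\<^esub> F2 F ?y ?z))
        \<cdot>\<^bsub>B\<^esub> (?fx \<odot>\<^bsub>B\<^esub> (?fy \<odot>\<^bsub>B\<^esub> ?fz))"
    using ass by (simp add: B.TenA_merge)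
  also have "\<dots> = F2 F (?x \<otimes>\<^bsub>A\<^esub> ?y) ?z \<cdot>\<^bsub>B\<^esub> (F2 F ?x ?y \<odot>\<^bsub>B\<^esub> Ide B (FO F ?z))
      \<cdot>\<^bsub>B\<^esub> (ass B (FO F ?x) (FO F ?y) (FO F ?z) \<cdot>\<^bsub>B\<^esub> (?fx \<odot>\<^bsub>B\<^esub> (?fy \<odot>\<^bsub>B\<^esub> ?fz)))"
    unfolding F2_ass[of ?x ?y ?z, symmetric, simplified] using ass by simp
  also have "\<dots> = F2_word ((X \<otimes>\<^sub>t Y) \<otimes>\<^sub>t Z) \<cdot>\<^bsub>B\<^esub> ?a"
    using ass by (simp add: B.ass_nat B.TenA_merge')
  finally show ?case
    using ass canonical.ass[OF word_in_FO_word[OF ass(1)] word_in_FO_word[OF ass(2)] word_in_FO_word[OF ass(3)]] by auto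
next
  case (run X)
  let ?x = "word_obj A X" and ?fx = "F2_word X"
  have [simp]: "?x \<in> Obj A" using run by auto
  have "FA F (run A ?x) \<cdot>\<^bsub>B\<^esub> F2_word (X \<otimes>\<^sub>t TUnit)
      = (FA F (run A ?x) \<cdot>\<^bsub>B\<^esub> F2 F ?x \<one>\<^bsub>A\<^esub> \<cdot>\<^bsub>B\<^esub> (Ide B (FO F ?x) \<odot>\<^bsub>B\<^esub> F0 F)) \<cdot>\<^bsub>B\<^esub> (?fx \<odot>\<^bsub>B\<^esub> Ide B \<one>\<^bsub>B\<^esub>)"
    using run by (simp add: B.TenA_merge)
  also have "\<dots> = ?fx \<cdot>\<^bsub>B\<^esub> run B (word_obj B (FO_word X))"
    unfolding F2_run[OF \<open>?x \<in> Obj A\<close>] using run by (simp add: B.run_nat)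
  finally show ?case using run canonical.run[OF word_in_FO_word[OF run(1)]] by auto
next
  case (lun X)
  let ?x = "word_obj A X" and ?fx = "F2_word X"
  have [simp]: "?x \<in> Obj A" using lun by auto
  have "FA F (lun A ?x) \<cdot>\<^bsub>B\<^esub> F2_word (TUnit \<otimes>\<^sub>t X)
      = (FA F (lun A ?x) \<cdot>\<^bsub>B\<^esub> F2 F \<one>\<^bsub>A\<^esub> ?x \<cdot>\<^bsub>B\<^esub> (F0 F \<odot>\<^bsub>B\<^esub> Ide B (FO F ?x))) \<cdot>\<^bsub>B\<^esub> (Ide B \<one>\<^bsub>B\<^esub> \<odot>\<^bsub>B\<^esub> ?fx)"
    using lun by (simp add: B.TenA_merge)
  also have "\<dots> = ?fx \<cdot>\<^bsub>B\<^esub> lun B (word_obj B (FO_word X))"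
    unfolding F2_lun[OF \<open>?x \<in> Obj A\<close>] using lun by (simp add: B.lun_nat)
  finally show ?case using lun canonical.lun[OF word_in_FO_word[OF lun(1)]] by auto
next
  case (braid X Y)
  let ?x = "word_obj A X" and ?y = "word_obj A Y" and ?fx = "F2_word X" and ?fy = "F2_word Y"
  have [simp]: "?x \<in> Obj A" "?y \<in> Obj A" using braid by auto
  have "FA F (braid A ?x ?y) \<cdot>\<^bsub>B\<^esub> F2_word (X \<otimes>\<^sub>t Y)
      = (FA F (braid A ?x ?y) \<cdot>\<^bsub>B\<^esub> F2 F ?x ?y) \<cdot>\<^bsub>B\<^esub> (?fx \<odot>\<^bsub>B\<^esub> ?fy)"
    using braid by simp
  also have "\<dots> = F2_word (Y \<otimes>\<^sub>t X) \<cdot>\<^bsub>B\<^esub> braid B (word_obj B (FO_word X)) (word_obj B (FO_word Y))"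
    unfolding F2_sym[OF \<open>?x \<in> Obj A\<close> \<open>?y \<in> Obj A\<close>] using braid by (simp add: B.braid_nat)
  finally show ?case using braid canonical.braid[OF word_in_FO_word[OF braid(1)] word_in_FO_word[OF braid(2)]] by auto
next
  case (inv X Y f)
  note p = A.canonical_props[OF inv(1)]
  obtain f' where f': "canonical B (FO_word X) (FO_word Y) f'" "FA F f \<cdot>\<^bsub>B\<^esub> F2_word X = F2_word Y \<cdot>\<^bsub>B\<^esub> f'"
    using inv by auto
  note q = B.canonical_props[OF f'(1)]
  have "FA F (inv_arr A f) \<cdot>\<^bsub>B\<^esub> F2_word Y = F2_word X \<cdot>\<^bsub>B\<^esub> inv_arr B f'"
    unfolding FA_inv_arr[OF p(1)[THEN conjunct2, THEN conjunct2, THEN conjunct1]]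
    by (rule B.naturality_inv) (use p q f'(2) in simp_all)
  then show ?case using canonical.inv[OF f'(1)] by auto
qed

text \<open>\<open>FA_canonical\<close> supplies some canonical arrow with the right ends. Four
  different tags keep the letters distinct, so coherence in B identifies it with the interchange.
  The result is the tensor axiom for the comparison of [A, F].\<close>

lemma FA_interchange:
  assumes [simp]: "a \<in> Obj A" "b \<in> Obj A" "c \<in> Obj A" "d \<in> Obj A"
  shows "FA F (interchange A a b c d) \<cdot>\<^bsub>B\<^esub> F2 F (a \<otimes>\<^bsub>A\<^esub> b) (c \<otimes>\<^bsub>A\<^esub> d) \<cdot>\<^bsub>B\<^esub> (F2 F a b \<odot>\<^bsub>B\<^esub> F2 F c d)
    = F2 F (a \<otimes>\<^bsub>A\<^esub> c) (b \<otimes>\<^bsub>A\<^esub> d) \<cdot>\<^bsub>B\<^esub> (F2 F a c \<odot>\<^bsub>B\<^esub> F2 F b d)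
      \<cdot>\<^bsub>B\<^esub> interchange B (FO F a) (FO F b) (FO F c) (FO F d)"
proof -
  let ?X = "\<lambda>a b c d. (TGen a (0::nat) \<otimes>\<^sub>t TGen b 1) \<otimes>\<^sub>t (TGen c 2 \<otimes>\<^sub>t TGen d 3)"
  let ?Y = "\<lambda>a b c d. (TGen a (0::nat) \<otimes>\<^sub>t TGen c 2) \<otimes>\<^sub>t (TGen b 1 \<otimes>\<^sub>t TGen d 3)"
  have c: "canonical A (?X a b c d) (?Y a b c d) (interchange A a b c d)"
    by (rule canonical_interchange) auto
  then obtain g where g: "canonical B (FO_word (?X a b c d)) (FO_word (?Y a b c d)) g"
      "FA F (interchange A a b c d) \<cdot>\<^bsub>B\<^esub> F2_word (?X a b c d) = F2_word (?Y a b c d) \<cdot>\<^bsub>B\<^esub> g"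
    using FA_canonical by blast
  have "canonical B (FO_word (?X a b c d)) (FO_word (?Y a b c d)) (interchange B (FO F a) (FO F b) (FO F c) (FO F d))"
    unfolding tobj.map by (rule canonical_interchange) auto
  then have "g = interchange B (FO F a) (FO F b) (FO F c) (FO F d)"
    by (rule B.coherence[OF g(1)]) simp
  with g(2) show ?thesis by simp
qed

end

lemma sm_functorI:
  assumes "sm_category A" "sm_category B"
    and "FO F \<in> extensional (Obj A)" "FA F \<in> extensional (Arr A)" "F2 F \<in> extensional (Obj A)"
      "\<And>x. x \<in> Obj A \<Longrightarrow> F2 F x \<in> extensional (Obj A)"
    and "\<And>x. x \<in> Obj A \<Longrightarrow> FO F x \<in> Obj B"
    and "\<And>f. f \<in> Arr A \<Longrightarrow> FA F f \<in> Arr B \<and> Dom B (FA F f) = FO F (Dom A f) \<and> Cod B (FA F f) = FO F (Cod A f)"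
    and "\<And>x. x \<in> Obj A \<Longrightarrow> FA F (Ide A x) = Ide B (FO F x)"
    and "\<And>f g. \<lbrakk>f \<in> Arr A; g \<in> Arr A; Dom A g = Cod A f\<rbrakk> \<Longrightarrow> FA F (g \<cdot>\<^bsub>A\<^esub> f) = FA F g \<cdot>\<^bsub>B\<^esub> FA F f"
    and "F0 F \<in> Arr B" "Dom B (F0 F) = \<one>\<^bsub>B\<^esub>" "Cod B (F0 F) = FO F \<one>\<^bsub>A\<^esub>"
    and "\<And>x y. \<lbrakk>x \<in> Obj A; y \<in> Obj A\<rbrakk> \<Longrightarrow> F2 F x y \<in> Arr B \<and> Dom B (F2 F x y) = FO F x \<otimes>\<^bsub>B\<^esub> FO F y
        \<and> Cod B (F2 F x y) = FO F (x \<otimes>\<^bsub>A\<^esub> y)"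
    and "\<And>f g. \<lbrakk>f \<in> Arr A; g \<in> Arr A\<rbrakk> \<Longrightarrow> F2 F (Cod A f) (Cod A g) \<cdot>\<^bsub>B\<^esub> (FA F f \<odot>\<^bsub>B\<^esub> FA F g)
        = FA F (f \<odot>\<^bsub>A\<^esub> g) \<cdot>\<^bsub>B\<^esub> F2 F (Dom A f) (Dom A g)"
    and "\<And>x y z. \<lbrakk>x \<in> Obj A; y \<in> Obj A; z \<in> Obj A\<rbrakk>
        \<Longrightarrow> F2 F (x \<otimes>\<^bsub>A\<^esub> y) z \<cdot>\<^bsub>B\<^esub> (F2 F x y \<odot>\<^bsub>B\<^esub> Ide B (FO F z)) \<cdot>\<^bsub>B\<^esub> ass B (FO F x) (FO F y) (FO F z)
          = FA F (ass A x y z) \<cdot>\<^bsub>B\<^esub> F2 F x (y \<otimes>\<^bsub>A\<^esub> z) \<cdot>\<^bsub>B\<^esub> (Ide B (FO F x) \<odot>\<^bsub>B\<^esub> F2 F y z)"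
    and "\<And>x. x \<in> Obj A
        \<Longrightarrow> FA F (run A x) \<cdot>\<^bsub>B\<^esub> F2 F x \<one>\<^bsub>A\<^esub> \<cdot>\<^bsub>B\<^esub> (Ide B (FO F x) \<odot>\<^bsub>B\<^esub> F0 F) = run B (FO F x)"
    and "\<And>x. x \<in> Obj A
        \<Longrightarrow> FA F (lun A x) \<cdot>\<^bsub>B\<^esub> F2 F \<one>\<^bsub>A\<^esub> x \<cdot>\<^bsub>B\<^esub> (F0 F \<odot>\<^bsub>B\<^esub> Ide B (FO F x)) = lun B (FO F x)"
    and "\<And>x y. \<lbrakk>x \<in> Obj A; y \<in> Obj A\<rbrakk>
        \<Longrightarrow> FA F (braid A x y) \<cdot>\<^bsub>B\<^esub> F2 F x y = F2 F y x \<cdot>\<^bsub>B\<^esub> braid B (FO F x) (FO F y)"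
  shows "sm_functor A B F"
  using assms unfolding sm_functor_def sm_functor_axioms_def by (auto simp: in_hom_iff)

lemma smf_eqI:
  fixes F G :: "('oa, 'ma, 'ob, 'mb) smf"
  assumes "FO F \<in> extensional (Obj A)" "FA F \<in> extensional (Arr A)" "F2 F \<in> extensional (Obj A)"
      "\<And>x. x \<in> Obj A \<Longrightarrow> F2 F x \<in> extensional (Obj A)"
    and "FO G \<in> extensional (Obj A)" "FA G \<in> extensional (Arr A)" "F2 G \<in> extensional (Obj A)"
      "\<And>x. x \<in> Obj A \<Longrightarrow> F2 G x \<in> extensional (Obj A)"
    and "\<And>x. x \<in> Obj A \<Longrightarrow> FO F x = FO G x" "\<And>f. f \<in> Arr A \<Longrightarrow> FA F f = FA G f" "F0 F = F0 G"
      "\<And>x y. x \<in> Obj A \<Longrightarrow> y \<in> Obj A \<Longrightarrow> F2 F x y = F2 G x y"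
  shows "F = G"
proof (rule smf.equality)
  show "FO F = FO G" "FA F = FA G" "F2 F = F2 G"
    using assms by (auto intro!: extensionalityI[of _ "Obj A"] extensionalityI[of _ "Arr A"])
qed (use assms in auto)

lemma smt_eqI:
  fixes \<sigma> \<tau> :: "('oa, 'ma, 'ob, 'mb) smt"
  assumes "Src \<sigma> = Src \<tau>" "Tgt \<sigma> = Tgt \<tau>" "Cpt \<sigma> \<in> extensional (Obj A)" "Cpt \<tau> \<in> extensional (Obj A)"
    and "\<And>x. x \<in> Obj A \<Longrightarrow> Cpt \<sigma> x = Cpt \<tau> x"
  shows "\<sigma> = \<tau>"
  using assms by (auto intro!: smt.equality extensionalityI[of _ "Obj A"])

lemma sm_transformationI:
  assumes "sm_functor A B (Src \<sigma>)" "sm_functor A B (Tgt \<sigma>)" "Cpt \<sigma> \<in> extensional (Obj A)"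
    and "\<And>x. x \<in> Obj A \<Longrightarrow> Cpt \<sigma> x \<in> Arr B \<and> Dom B (Cpt \<sigma> x) = FO (Src \<sigma>) x \<and> Cod B (Cpt \<sigma> x) = FO (Tgt \<sigma>) x"
    and "\<And>f. f \<in> Arr A \<Longrightarrow> Cpt \<sigma> (Cod A f) \<cdot>\<^bsub>B\<^esub> FA (Src \<sigma>) f = FA (Tgt \<sigma>) f \<cdot>\<^bsub>B\<^esub> Cpt \<sigma> (Dom A f)"
    and "Cpt \<sigma> \<one>\<^bsub>A\<^esub> \<cdot>\<^bsub>B\<^esub> F0 (Src \<sigma>) = F0 (Tgt \<sigma>)"
    and "\<And>x y. \<lbrakk>x \<in> Obj A; y \<in> Obj A\<rbrakk>
        \<Longrightarrow> Cpt \<sigma> (x \<otimes>\<^bsub>A\<^esub> y) \<cdot>\<^bsub>B\<^esub> F2 (Src \<sigma>) x y = F2 (Tgt \<sigma>) x y \<cdot>\<^bsub>B\<^esub> (Cpt \<sigma> x \<odot>\<^bsub>B\<^esub> Cpt \<sigma> y)"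
  shows "sm_transformation A B \<sigma>"
  using assms unfolding sm_transformation_def sm_transformation_axioms_def by (auto simp: in_hom_iff)

context sm_transformation
begin

lemma Cpt_simps [simp]:
  assumes "x \<in> Obj A"
  shows "Cpt \<sigma> x \<in> Arr B" "Dom B (Cpt \<sigma> x) = FO (Src \<sigma>) x" "Cod B (Cpt \<sigma> x) = FO (Tgt \<sigma>) x"
  using Cpt_hom[OF assms] by (simp_all add: in_hom_iff)

lemma Cpt_nat:
  "f \<in> Arr A \<Longrightarrow> Cpt \<sigma> (Cod A f) \<cdot>\<^bsub>B\<^esub> FA (Src \<sigma>) f = FA (Tgt \<sigma>) f \<cdot>\<^bsub>B\<^esub> Cpt \<sigma> (Dom A f)"
  using Cpt_natural by (simp add: in_hom_iff)

end

lemma sm_functor_Src_Tgt: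
  "sm_transformation A B \<sigma> \<Longrightarrow> sm_functor A B (Src \<sigma>)" "sm_transformation A B \<sigma> \<Longrightarrow> sm_functor A B (Tgt \<sigma>)"
  by (auto simp: sm_transformation_def)

section \<open>The pointwise tensor product and the symmetric monoidal structure of [A, B]\<close>

lemma box_simps [simp]:
  "x \<in> Obj A \<Longrightarrow> FO (box_smf A B F G) x = FO F x \<otimes>\<^bsub>B\<^esub> FO G x"
  "f \<in> Arr A \<Longrightarrow> FA (box_smf A B F G) f = FA F f \<odot>\<^bsub>B\<^esub> FA G f"
  "F0 (box_smf A B F G) = (F0 F \<odot>\<^bsub>B\<^esub> F0 G) \<cdot>\<^bsub>B\<^esub> inv_arr B (run B \<one>\<^bsub>B\<^esub>)"
  "\<lbrakk>x \<in> Obj A; y \<in> Obj A\<rbrakk> \<Longrightarrow> F2 (box_smf A B F G) x y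
    = (F2 F x y \<odot>\<^bsub>B\<^esub> F2 G x y) \<cdot>\<^bsub>B\<^esub> interchange B (FO F x) (FO G x) (FO F y) (FO G y)"
  "FO (box_smf A B F G) \<in> extensional (Obj A)" "FA (box_smf A B F G) \<in> extensional (Arr A)"
  "F2 (box_smf A B F G) \<in> extensional (Obj A)"
  "x \<in> Obj A \<Longrightarrow> F2 (box_smf A B F G) x \<in> extensional (Obj A)"
  by (simp_all add: box_smf_def)

lemma unit_smf_simps [simp]:
  "x \<in> Obj A \<Longrightarrow> FO (unit_smf A B) x = \<one>\<^bsub>B\<^esub>"
  "f \<in> Arr A \<Longrightarrow> FA (unit_smf A B) f = Ide B \<one>\<^bsub>B\<^esub>"
  "F0 (unit_smf A B) = Ide B \<one>\<^bsub>B\<^esub>"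
  "\<lbrakk>x \<in> Obj A; y \<in> Obj A\<rbrakk> \<Longrightarrow> F2 (unit_smf A B) x y = run B \<one>\<^bsub>B\<^esub>"
  "FO (unit_smf A B) \<in> extensional (Obj A)" "FA (unit_smf A B) \<in> extensional (Arr A)"
  "F2 (unit_smf A B) \<in> extensional (Obj A)"
  "x \<in> Obj A \<Longrightarrow> F2 (unit_smf A B) x \<in> extensional (Obj A)"
  by (simp_all add: unit_smf_def)

lemma sm_functor_unit_smf:
  assumes "sm_category A" "sm_category B"
  shows "sm_functor A B (unit_smf A B)"
proof -
  interpret A: sm_category A by fact
  interpret B: sm_category B by fact
  show ?thesis
  proof (rule sm_functorI)
    fix x y assume [simp]: "x \<in> Obj A" "y \<in> Obj A"
    show "FA (unit_smf A B) (braid A x y) \<cdot>\<^bsub>B\<^esub> F2 (unit_smf A B) x y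
      = F2 (unit_smf A B) y x \<cdot>\<^bsub>B\<^esub> braid B (FO (unit_smf A B) x) (FO (unit_smf A B) y)"
      by (simp add: B.unit_coherence)
  qed (simp_all add: assms B.unit_coherence(3) B.unit_coherence(2)[unfolded B.run_Unit] B.run_Unit)
qed

text \<open>In each axiom \<open>interchange_nat\<close> gathers the data of F on one side of
  \<open>\<odot>\<close> and those of G on the other. The axioms of F and G then apply separately,
  and the remaining diagram of interchanges is an instance of coherence.\<close>

lemma sm_functor_box_smf:
  assumes "sm_functor A B F" "sm_functor A B G"
  shows "sm_functor A B (box_smf A B F G)"
proof -
  interpret F: sm_functor A B F by fact
  interpret G: sm_functor A B G by fact
  let ?H = "box_smf A B F G" and ?I = "interchange B"
  show ?thesis
  proof (rule sm_functorI)
    show "sm_category A" "sm_category B" by unfold_locales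
  next
    fix f g assume [simp]: "f \<in> Arr A" "g \<in> Arr A"
    show "F2 ?H (Cod A f) (Cod A g) \<cdot>\<^bsub>B\<^esub> (FA ?H f \<odot>\<^bsub>B\<^esub> FA ?H g) = FA ?H (f \<odot>\<^bsub>A\<^esub> g) \<cdot>\<^bsub>B\<^esub> F2 ?H (Dom A f) (Dom A g)"
      by (simp add: F.B.interchange_nat F.B.TenA_merge' F.F2_nat G.F2_nat)
  next
    fix x y z assume [simp]: "x \<in> Obj A" "y \<in> Obj A" "z \<in> Obj A"
    let ?i = "?I (FO F (x \<otimes>\<^bsub>A\<^esub> y)) (FO G (x \<otimes>\<^bsub>A\<^esub> y)) (FO F z) (FO G z)"
    have "F2 ?H (x \<otimes>\<^bsub>A\<^esub> y) z \<cdot>\<^bsub>B\<^esub> (F2 ?H x y \<odot>\<^bsub>B\<^esub> Ide B (FO ?H z)) \<cdot>\<^bsub>B\<^esub> ass B (FO ?H x) (FO ?H y) (FO ?H z)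
      = (F2 F (x \<otimes>\<^bsub>A\<^esub> y) z \<odot>\<^bsub>B\<^esub> F2 G (x \<otimes>\<^bsub>A\<^esub> y) z) \<cdot>\<^bsub>B\<^esub> (?i \<cdot>\<^bsub>B\<^esub> ((F2 F x y \<odot>\<^bsub>B\<^esub> F2 G x y) \<odot>\<^bsub>B\<^esub> (Ide B (FO F z) \<odot>\<^bsub>B\<^esub> Ide B (FO G z))))
       \<cdot>\<^bsub>B\<^esub> (?I (FO F x) (FO G x) (FO F y) (FO G y) \<odot>\<^bsub>B\<^esub> Ide B (FO F z \<otimes>\<^bsub>B\<^esub> FO G z)) \<cdot>\<^bsub>B\<^esub> ass B (FO ?H x) (FO ?H y) (FO ?H z)"
      by (simp add: F.B.TenA_merge')
    also have "\<dots> = (F2 F (x \<otimes>\<^bsub>A\<^esub> y) z \<odot>\<^bsub>B\<^esub> F2 G (x \<otimes>\<^bsub>A\<^esub> y) z)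
       \<cdot>\<^bsub>B\<^esub> ((F2 F x y \<odot>\<^bsub>B\<^esub> Ide B (FO F z)) \<odot>\<^bsub>B\<^esub> (F2 G x y \<odot>\<^bsub>B\<^esub> Ide B (FO G z)))
       \<cdot>\<^bsub>B\<^esub> (?I (FO F x \<otimes>\<^bsub>B\<^esub> FO F y) (FO G x \<otimes>\<^bsub>B\<^esub> FO G y) (FO F z) (FO G z)
       \<cdot>\<^bsub>B\<^esub> (?I (FO F x) (FO G x) (FO F y) (FO G y) \<odot>\<^bsub>B\<^esub> Ide B (FO F z \<otimes>\<^bsub>B\<^esub> FO G z)) \<cdot>\<^bsub>B\<^esub> ass B (FO ?H x) (FO ?H y) (FO ?H z))"
      by (subst F.B.interchange_nat) simp_all
    also have "\<dots> = ((F2 F (x \<otimes>\<^bsub>A\<^esub> y) z \<cdot>\<^bsub>B\<^esub> (F2 F x y \<odot>\<^bsub>B\<^esub> Ide B (FO F z)) \<cdot>\<^bsub>B\<^esub> ass B (FO F x) (FO F y) (FO F z))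
         \<odot>\<^bsub>B\<^esub> (F2 G (x \<otimes>\<^bsub>A\<^esub> y) z \<cdot>\<^bsub>B\<^esub> (F2 G x y \<odot>\<^bsub>B\<^esub> Ide B (FO G z)) \<cdot>\<^bsub>B\<^esub> ass B (FO G x) (FO G y) (FO G z)))
       \<cdot>\<^bsub>B\<^esub> ?I (FO F x) (FO G x) (FO F y \<otimes>\<^bsub>B\<^esub> FO F z) (FO G y \<otimes>\<^bsub>B\<^esub> FO G z)
       \<cdot>\<^bsub>B\<^esub> (Ide B (FO F x \<otimes>\<^bsub>B\<^esub> FO G x) \<odot>\<^bsub>B\<^esub> ?I (FO F y) (FO G y) (FO F z) (FO G z))"
      by (simp add: F.B.interchange_ass F.B.TenA_merge')
    also have "\<dots> = (FA F (ass A x y z) \<odot>\<^bsub>B\<^esub> FA G (ass A x y z)) \<cdot>\<^bsub>B\<^esub> (F2 F x (y \<otimes>\<^bsub>A\<^esub> z) \<odot>\<^bsub>B\<^esub> F2 G x (y \<otimes>\<^bsub>A\<^esub> z))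
       \<cdot>\<^bsub>B\<^esub> (((Ide B (FO F x) \<odot>\<^bsub>B\<^esub> F2 F y z) \<odot>\<^bsub>B\<^esub> (Ide B (FO G x) \<odot>\<^bsub>B\<^esub> F2 G y z))
       \<cdot>\<^bsub>B\<^esub> ?I (FO F x) (FO G x) (FO F y \<otimes>\<^bsub>B\<^esub> FO F z) (FO G y \<otimes>\<^bsub>B\<^esub> FO G z))
       \<cdot>\<^bsub>B\<^esub> (Ide B (FO F x \<otimes>\<^bsub>B\<^esub> FO G x) \<odot>\<^bsub>B\<^esub> ?I (FO F y) (FO G y) (FO F z) (FO G z))"
      by (simp add: F.F2_ass G.F2_ass F.B.TenA_merge')
    also have "\<dots> = FA ?H (ass A x y z) \<cdot>\<^bsub>B\<^esub> F2 ?H x (y \<otimes>\<^bsub>A\<^esub> z) \<cdot>\<^bsub>B\<^esub> (Ide B (FO ?H x) \<odot>\<^bsub>B\<^esub> F2 ?H y z)"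
      using F.B.interchange_nat[of "Ide B (FO F x)" "Ide B (FO G x)" "F2 F y z" "F2 G y z" "FO F x" "FO G x"
          "FO F (y \<otimes>\<^bsub>A\<^esub> z)" "FO G (y \<otimes>\<^bsub>A\<^esub> z)", symmetric]
      by (simp add: F.B.TenA_merge)
    finally show "F2 ?H (x \<otimes>\<^bsub>A\<^esub> y) z \<cdot>\<^bsub>B\<^esub> (F2 ?H x y \<odot>\<^bsub>B\<^esub> Ide B (FO ?H z)) \<cdot>\<^bsub>B\<^esub> ass B (FO ?H x) (FO ?H y) (FO ?H z)
      = FA ?H (ass A x y z) \<cdot>\<^bsub>B\<^esub> F2 ?H x (y \<otimes>\<^bsub>A\<^esub> z) \<cdot>\<^bsub>B\<^esub> (Ide B (FO ?H x) \<odot>\<^bsub>B\<^esub> F2 ?H y z)" .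
  next
    fix x assume [simp]: "x \<in> Obj A"
    let ?r = "inv_arr B (run B \<one>\<^bsub>B\<^esub>)"
    have "FA ?H (run A x) \<cdot>\<^bsub>B\<^esub> F2 ?H x \<one>\<^bsub>A\<^esub> \<cdot>\<^bsub>B\<^esub> (Ide B (FO ?H x) \<odot>\<^bsub>B\<^esub> F0 ?H)
      = (FA F (run A x) \<odot>\<^bsub>B\<^esub> FA G (run A x)) \<cdot>\<^bsub>B\<^esub> (F2 F x \<one>\<^bsub>A\<^esub> \<odot>\<^bsub>B\<^esub> F2 G x \<one>\<^bsub>A\<^esub>)
       \<cdot>\<^bsub>B\<^esub> (?I (FO F x) (FO G x) (FO F \<one>\<^bsub>A\<^esub>) (FO G \<one>\<^bsub>A\<^esub>) \<cdot>\<^bsub>B\<^esub> ((Ide B (FO F x) \<odot>\<^bsub>B\<^esub> Ide B (FO G x)) \<odot>\<^bsub>B\<^esub> (F0 F \<odot>\<^bsub>B\<^esub> F0 G)))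
       \<cdot>\<^bsub>B\<^esub> (Ide B (FO F x \<otimes>\<^bsub>B\<^esub> FO G x) \<odot>\<^bsub>B\<^esub> ?r)"
      by (simp add: F.B.TenA_merge)
    also have "\<dots> = ((FA F (run A x) \<cdot>\<^bsub>B\<^esub> F2 F x \<one>\<^bsub>A\<^esub> \<cdot>\<^bsub>B\<^esub> (Ide B (FO F x) \<odot>\<^bsub>B\<^esub> F0 F))
         \<odot>\<^bsub>B\<^esub> (FA G (run A x) \<cdot>\<^bsub>B\<^esub> F2 G x \<one>\<^bsub>A\<^esub> \<cdot>\<^bsub>B\<^esub> (Ide B (FO G x) \<odot>\<^bsub>B\<^esub> F0 G)))
       \<cdot>\<^bsub>B\<^esub> ?I (FO F x) (FO G x) \<one>\<^bsub>B\<^esub> \<one>\<^bsub>B\<^esub> \<cdot>\<^bsub>B\<^esub> (Ide B (FO F x \<otimes>\<^bsub>B\<^esub> FO G x) \<odot>\<^bsub>B\<^esub> ?r)"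
      by (subst F.B.interchange_nat) (simp_all add: F.B.TenA_merge')
    also have "\<dots> = run B (FO ?H x)"
      by (simp only: F.F2_run G.F2_run \<open>x \<in> Obj A\<close>) (simp add: F.B.interchange_run)
    finally show "FA ?H (run A x) \<cdot>\<^bsub>B\<^esub> F2 ?H x \<one>\<^bsub>A\<^esub> \<cdot>\<^bsub>B\<^esub> (Ide B (FO ?H x) \<odot>\<^bsub>B\<^esub> F0 ?H) = run B (FO ?H x)" .
    have "FA ?H (lun A x) \<cdot>\<^bsub>B\<^esub> F2 ?H \<one>\<^bsub>A\<^esub> x \<cdot>\<^bsub>B\<^esub> (F0 ?H \<odot>\<^bsub>B\<^esub> Ide B (FO ?H x))
      = (FA F (lun A x) \<odot>\<^bsub>B\<^esub> FA G (lun A x)) \<cdot>\<^bsub>B\<^esub> (F2 F \<one>\<^bsub>A\<^esub> x \<odot>\<^bsub>B\<^esub> F2 G \<one>\<^bsub>A\<^esub> x)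
       \<cdot>\<^bsub>B\<^esub> (?I (FO F \<one>\<^bsub>A\<^esub>) (FO G \<one>\<^bsub>A\<^esub>) (FO F x) (FO G x) \<cdot>\<^bsub>B\<^esub> ((F0 F \<odot>\<^bsub>B\<^esub> F0 G) \<odot>\<^bsub>B\<^esub> (Ide B (FO F x) \<odot>\<^bsub>B\<^esub> Ide B (FO G x))))
       \<cdot>\<^bsub>B\<^esub> (?r \<odot>\<^bsub>B\<^esub> Ide B (FO F x \<otimes>\<^bsub>B\<^esub> FO G x))"
      by (simp add: F.B.TenA_merge)
    also have "\<dots> = ((FA F (lun A x) \<cdot>\<^bsub>B\<^esub> F2 F \<one>\<^bsub>A\<^esub> x \<cdot>\<^bsub>B\<^esub> (F0 F \<odot>\<^bsub>B\<^esub> Ide B (FO F x)))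
         \<odot>\<^bsub>B\<^esub> (FA G (lun A x) \<cdot>\<^bsub>B\<^esub> F2 G \<one>\<^bsub>A\<^esub> x \<cdot>\<^bsub>B\<^esub> (F0 G \<odot>\<^bsub>B\<^esub> Ide B (FO G x))))
       \<cdot>\<^bsub>B\<^esub> ?I \<one>\<^bsub>B\<^esub> \<one>\<^bsub>B\<^esub> (FO F x) (FO G x) \<cdot>\<^bsub>B\<^esub> (?r \<odot>\<^bsub>B\<^esub> Ide B (FO F x \<otimes>\<^bsub>B\<^esub> FO G x))"
      by (subst F.B.interchange_nat) (simp_all add: F.B.TenA_merge')
    also have "\<dots> = lun B (FO ?H x)"
      by (simp only: F.F2_lun G.F2_lun \<open>x \<in> Obj A\<close>) (simp add: F.B.interchange_lun)
    finally show "FA ?H (lun A x) \<cdot>\<^bsub>B\<^esub> F2 ?H \<one>\<^bsub>A\<^esub> x \<cdot>\<^bsub>B\<^esub> (F0 ?H \<odot>\<^bsub>B\<^esub> Ide B (FO ?H x)) = lun B (FO ?H x)" .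
  next
    fix x y assume [simp]: "x \<in> Obj A" "y \<in> Obj A"
    have "FA ?H (braid A x y) \<cdot>\<^bsub>B\<^esub> F2 ?H x y = (F2 F y x \<odot>\<^bsub>B\<^esub> F2 G y x)
       \<cdot>\<^bsub>B\<^esub> ((braid B (FO F x) (FO F y) \<odot>\<^bsub>B\<^esub> braid B (FO G x) (FO G y)) \<cdot>\<^bsub>B\<^esub> ?I (FO F x) (FO G x) (FO F y) (FO G y))"
      by (simp add: F.B.TenA_merge' F.F2_sym G.F2_sym)
    also have "\<dots> = F2 ?H y x \<cdot>\<^bsub>B\<^esub> braid B (FO ?H x) (FO ?H y)"
      by (subst F.B.interchange_sym) simp_all
    finally show "FA ?H (braid A x y) \<cdot>\<^bsub>B\<^esub> F2 ?H x y = F2 ?H y x \<cdot>\<^bsub>B\<^esub> braid B (FO ?H x) (FO ?H y)" .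
  qed (simp_all add: F.B.TenA_merge)
qed

lemma ihom_sel [simp]:
  "Obj (ihom A B) = {F. sm_functor A B F}" "Arr (ihom A B) = {\<sigma>. sm_transformation A B \<sigma>}"
  "Dom (ihom A B) = Src" "Cod (ihom A B) = Tgt" "Unit (ihom A B) = unit_smf A B" "TenO (ihom A B) = box_smf A B"
  by (simp_all add: ihom_def Let_def)

lemma ihom_Src_Tgt [simp]:
  "Src (Ide (ihom A B) F) = F" "Tgt (Ide (ihom A B) F) = F"
  "Src (\<tau> \<cdot>\<^bsub>ihom A B\<^esub> \<sigma>) = Src \<sigma>" "Tgt (\<tau> \<cdot>\<^bsub>ihom A B\<^esub> \<sigma>) = Tgt \<tau>"
  "Src (\<sigma> \<odot>\<^bsub>ihom A B\<^esub> \<tau>) = box_smf A B (Src \<sigma>) (Src \<tau>)" "Tgt (\<sigma> \<odot>\<^bsub>ihom A B\<^esub> \<tau>) = box_smf A B (Tgt \<sigma>) (Tgt \<tau>)"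
  "Src (ass (ihom A B) F G H) = box_smf A B F (box_smf A B G H)"
  "Tgt (ass (ihom A B) F G H) = box_smf A B (box_smf A B F G) H"
  "Src (run (ihom A B) F) = box_smf A B F (unit_smf A B)" "Tgt (run (ihom A B) F) = F"
  "Src (lun (ihom A B) F) = box_smf A B (unit_smf A B) F" "Tgt (lun (ihom A B) F) = F"
  "Src (braid (ihom A B) F G) = box_smf A B F G" "Tgt (braid (ihom A B) F G) = box_smf A B G F"
  by (simp_all add: ihom_def Let_def)

lemma ihom_Cpt [simp]:
  assumes "x \<in> Obj A"
  shows "Cpt (Ide (ihom A B) F) x = Ide B (FO F x)"
    "Cpt (\<tau> \<cdot>\<^bsub>ihom A B\<^esub> \<sigma>) x = Cpt \<tau> x \<cdot>\<^bsub>B\<^esub> Cpt \<sigma> x"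
    "Cpt (\<sigma> \<odot>\<^bsub>ihom A B\<^esub> \<tau>) x = Cpt \<sigma> x \<odot>\<^bsub>B\<^esub> Cpt \<tau> x"
    "Cpt (ass (ihom A B) F G H) x = ass B (FO F x) (FO G x) (FO H x)"
    "Cpt (run (ihom A B) F) x = run B (FO F x)"
    "Cpt (lun (ihom A B) F) x = lun B (FO F x)"
    "Cpt (braid (ihom A B) F G) x = braid B (FO F x) (FO G x)"
  using assms by (simp_all add: ihom_def Let_def)

lemma ihom_Cpt_ext [simp]:
  "Cpt (Ide (ihom A B) F) \<in> extensional (Obj A)" "Cpt (\<tau> \<cdot>\<^bsub>ihom A B\<^esub> \<sigma>) \<in> extensional (Obj A)"
  "Cpt (\<sigma> \<odot>\<^bsub>ihom A B\<^esub> \<tau>) \<in> extensional (Obj A)" "Cpt (ass (ihom A B) F G H) \<in> extensional (Obj A)"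
  "Cpt (run (ihom A B) F) \<in> extensional (Obj A)" "Cpt (lun (ihom A B) F) \<in> extensional (Obj A)"
  "Cpt (braid (ihom A B) F G) \<in> extensional (Obj A)"
  by (simp_all add: ihom_def Let_def)

lemma sm_transformation_Ide:
  assumes "sm_functor A B F"
  shows "sm_transformation A B (Ide (ihom A B) F)"
proof -
  interpret F: sm_functor A B F by fact
  show ?thesis by (rule sm_transformationI) (simp_all add: assms)
qed

lemma sm_transformation_Comp:
  assumes "sm_transformation A B \<sigma>" "sm_transformation A B \<tau>" "Src \<tau> = Tgt \<sigma>"
  shows "sm_transformation A B (\<tau> \<cdot>\<^bsub>ihom A B\<^esub> \<sigma>)"
proof -
  interpret s: sm_transformation A B \<sigma> by fact
  interpret t: sm_transformation A B \<tau> by fact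
  note [simp] = assms(3)
  show ?thesis
  proof (rule sm_transformationI)
    fix f assume [simp]: "f \<in> Arr A"
    show "Cpt (\<tau> \<cdot>\<^bsub>ihom A B\<^esub> \<sigma>) (Cod A f) \<cdot>\<^bsub>B\<^esub> FA (Src (\<tau> \<cdot>\<^bsub>ihom A B\<^esub> \<sigma>)) f
      = FA (Tgt (\<tau> \<cdot>\<^bsub>ihom A B\<^esub> \<sigma>)) f \<cdot>\<^bsub>B\<^esub> Cpt (\<tau> \<cdot>\<^bsub>ihom A B\<^esub> \<sigma>) (Dom A f)"
      using s.S.B.Comp_extend[OF t.Cpt_nat[of f], of "Cpt \<sigma> (Dom A f)"] by (simp add: s.Cpt_nat)
  next
    show "Cpt (\<tau> \<cdot>\<^bsub>ihom A B\<^esub> \<sigma>) \<one>\<^bsub>A\<^esub> \<cdot>\<^bsub>B\<^esub> F0 (Src (\<tau> \<cdot>\<^bsub>ihom A B\<^esub> \<sigma>)) = F0 (Tgt (\<tau> \<cdot>\<^bsub>ihom A B\<^esub> \<sigma>))"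
      using t.Cpt_unit by (simp add: s.Cpt_unit)
  next
    fix x y assume [simp]: "x \<in> Obj A" "y \<in> Obj A"
    show "Cpt (\<tau> \<cdot>\<^bsub>ihom A B\<^esub> \<sigma>) (x \<otimes>\<^bsub>A\<^esub> y) \<cdot>\<^bsub>B\<^esub> F2 (Src (\<tau> \<cdot>\<^bsub>ihom A B\<^esub> \<sigma>)) x y
      = F2 (Tgt (\<tau> \<cdot>\<^bsub>ihom A B\<^esub> \<sigma>)) x y \<cdot>\<^bsub>B\<^esub> (Cpt (\<tau> \<cdot>\<^bsub>ihom A B\<^esub> \<sigma>) x \<odot>\<^bsub>B\<^esub> Cpt (\<tau> \<cdot>\<^bsub>ihom A B\<^esub> \<sigma>) y)"
      using s.S.B.Comp_extend[OF t.Cpt_tensor[of x y], of "Cpt \<sigma> x \<odot>\<^bsub>B\<^esub> Cpt \<sigma> y"]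
      by (simp add: s.Cpt_tensor s.S.B.TenA_merge)
  qed (simp_all add: s.S.sm_functor_axioms t.T.sm_functor_axioms)
qed

lemma sm_transformation_TenA:
  assumes "sm_transformation A B \<sigma>" "sm_transformation A B \<tau>"
  shows "sm_transformation A B (\<sigma> \<odot>\<^bsub>ihom A B\<^esub> \<tau>)"
proof -
  interpret s: sm_transformation A B \<sigma> by fact
  interpret t: sm_transformation A B \<tau> by fact
  show ?thesis
  proof (rule sm_transformationI)
    show "Cpt (\<sigma> \<odot>\<^bsub>ihom A B\<^esub> \<tau>) \<one>\<^bsub>A\<^esub> \<cdot>\<^bsub>B\<^esub> F0 (Src (\<sigma> \<odot>\<^bsub>ihom A B\<^esub> \<tau>)) = F0 (Tgt (\<sigma> \<odot>\<^bsub>ihom A B\<^esub> \<tau>))"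
      by (simp add: s.S.B.TenA_merge' s.Cpt_unit t.Cpt_unit)
  next
    fix x y assume [simp]: "x \<in> Obj A" "y \<in> Obj A"
    show "Cpt (\<sigma> \<odot>\<^bsub>ihom A B\<^esub> \<tau>) (x \<otimes>\<^bsub>A\<^esub> y) \<cdot>\<^bsub>B\<^esub> F2 (Src (\<sigma> \<odot>\<^bsub>ihom A B\<^esub> \<tau>)) x y
      = F2 (Tgt (\<sigma> \<odot>\<^bsub>ihom A B\<^esub> \<tau>)) x y \<cdot>\<^bsub>B\<^esub> (Cpt (\<sigma> \<odot>\<^bsub>ihom A B\<^esub> \<tau>) x \<odot>\<^bsub>B\<^esub> Cpt (\<sigma> \<odot>\<^bsub>ihom A B\<^esub> \<tau>) y)"
      by (simp add: s.S.B.TenA_merge' s.S.B.interchange_nat s.Cpt_tensor t.Cpt_tensor)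
  qed (simp_all add: sm_functor_box_smf s.S.sm_functor_axioms s.T.sm_functor_axioms t.S.sm_functor_axioms
      t.T.sm_functor_axioms s.S.B.TenA_merge s.Cpt_nat t.Cpt_nat)
qed

text \<open>Naturality of \<open>ass\<close> in B moves the comparisons of the three functors out;
  what is left is \<open>unit_coherence(1)\<close> for the unit axiom and
  \<open>ass_interchange\<close> for the tensor axiom. The other structural transformations are
  treated in the same way.\<close>

lemma sm_transformation_ass:
  assumes "sm_functor A B F" "sm_functor A B G" "sm_functor A B H"
  shows "sm_transformation A B (ass (ihom A B) F G H)"
proof -
  interpret F: sm_functor A B F by fact
  interpret G: sm_functor A B G by fact
  interpret H: sm_functor A B H by fact
  let ?a = "ass (ihom A B) F G H" and ?I = "interchange B" and ?r = "inv_arr B (run B \<one>\<^bsub>B\<^esub>)"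
  show ?thesis
  proof (rule sm_transformationI)
    have "Cpt ?a \<one>\<^bsub>A\<^esub> \<cdot>\<^bsub>B\<^esub> F0 (Src ?a) = (ass B (FO F \<one>\<^bsub>A\<^esub>) (FO G \<one>\<^bsub>A\<^esub>) (FO H \<one>\<^bsub>A\<^esub>)
        \<cdot>\<^bsub>B\<^esub> (F0 F \<odot>\<^bsub>B\<^esub> (F0 G \<odot>\<^bsub>B\<^esub> F0 H))) \<cdot>\<^bsub>B\<^esub> (Ide B \<one>\<^bsub>B\<^esub> \<odot>\<^bsub>B\<^esub> ?r) \<cdot>\<^bsub>B\<^esub> ?r"
      by (simp add: F.B.TenA_merge')
    also have "\<dots> = ((F0 F \<odot>\<^bsub>B\<^esub> F0 G) \<odot>\<^bsub>B\<^esub> F0 H) \<cdot>\<^bsub>B\<^esub> (ass B \<one>\<^bsub>B\<^esub> \<one>\<^bsub>B\<^esub> \<one>\<^bsub>B\<^esub> \<cdot>\<^bsub>B\<^esub> (Ide B \<one>\<^bsub>B\<^esub> \<odot>\<^bsub>B\<^esub> ?r) \<cdot>\<^bsub>B\<^esub> ?r)"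
      by (subst F.B.ass_nat) simp_all
    also have "\<dots> = F0 (Tgt ?a)"
      unfolding F.B.unit_coherence(1) by (simp add: F.B.TenA_merge')
    finally show "Cpt ?a \<one>\<^bsub>A\<^esub> \<cdot>\<^bsub>B\<^esub> F0 (Src ?a) = F0 (Tgt ?a)" .
  next
    fix x y assume [simp]: "x \<in> Obj A" "y \<in> Obj A"
    let ?xy = "x \<otimes>\<^bsub>A\<^esub> y"
    have "Cpt ?a ?xy \<cdot>\<^bsub>B\<^esub> F2 (Src ?a) x y
      = (ass B (FO F ?xy) (FO G ?xy) (FO H ?xy) \<cdot>\<^bsub>B\<^esub> (F2 F x y \<odot>\<^bsub>B\<^esub> (F2 G x y \<odot>\<^bsub>B\<^esub> F2 H x y)))
        \<cdot>\<^bsub>B\<^esub> (Ide B (FO F x \<otimes>\<^bsub>B\<^esub> FO F y) \<odot>\<^bsub>B\<^esub> ?I (FO G x) (FO H x) (FO G y) (FO H y))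
        \<cdot>\<^bsub>B\<^esub> ?I (FO F x) (FO G x \<otimes>\<^bsub>B\<^esub> FO H x) (FO F y) (FO G y \<otimes>\<^bsub>B\<^esub> FO H y)"
      by (simp add: F.B.TenA_merge')
    also have "\<dots> = ((F2 F x y \<odot>\<^bsub>B\<^esub> F2 G x y) \<odot>\<^bsub>B\<^esub> F2 H x y)
        \<cdot>\<^bsub>B\<^esub> (ass B (FO F x \<otimes>\<^bsub>B\<^esub> FO F y) (FO G x \<otimes>\<^bsub>B\<^esub> FO G y) (FO H x \<otimes>\<^bsub>B\<^esub> FO H y)
        \<cdot>\<^bsub>B\<^esub> (Ide B (FO F x \<otimes>\<^bsub>B\<^esub> FO F y) \<odot>\<^bsub>B\<^esub> ?I (FO G x) (FO H x) (FO G y) (FO H y))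
        \<cdot>\<^bsub>B\<^esub> ?I (FO F x) (FO G x \<otimes>\<^bsub>B\<^esub> FO H x) (FO F y) (FO G y \<otimes>\<^bsub>B\<^esub> FO H y))"
      by (subst F.B.ass_nat) simp_all
    also have "\<dots> = F2 (Tgt ?a) x y \<cdot>\<^bsub>B\<^esub> (Cpt ?a x \<odot>\<^bsub>B\<^esub> Cpt ?a y)"
      by (subst F.B.ass_interchange) (simp_all add: F.B.TenA_merge')
    finally show "Cpt ?a ?xy \<cdot>\<^bsub>B\<^esub> F2 (Src ?a) x y = F2 (Tgt ?a) x y \<cdot>\<^bsub>B\<^esub> (Cpt ?a x \<odot>\<^bsub>B\<^esub> Cpt ?a y)" .
  qed (simp_all add: assms sm_functor_box_smf F.B.ass_nat)
qed

lemma sm_transformation_run: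
  assumes "sm_functor A B F"
  shows "sm_transformation A B (run (ihom A B) F)"
proof -
  interpret F: sm_functor A B F by fact
  let ?a = "run (ihom A B) F"
  show ?thesis
  proof (rule sm_transformationI)
    show "Cpt ?a \<one>\<^bsub>A\<^esub> \<cdot>\<^bsub>B\<^esub> F0 (Src ?a) = F0 (Tgt ?a)"
      using F.B.Comp_extend[OF F.B.run_nat[of "F0 F" "FO F \<one>\<^bsub>A\<^esub>"], of "inv_arr B (run B \<one>\<^bsub>B\<^esub>)"] by simp
  next
    fix x y assume [simp]: "x \<in> Obj A" "y \<in> Obj A"
    let ?r = "Ide B (FO F x \<otimes>\<^bsub>B\<^esub> FO F y) \<odot>\<^bsub>B\<^esub> run B \<one>\<^bsub>B\<^esub>" and ?I = "interchange B (FO F x) \<one>\<^bsub>B\<^esub> (FO F y) \<one>\<^bsub>B\<^esub>"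
    have "Cpt ?a (x \<otimes>\<^bsub>A\<^esub> y) \<cdot>\<^bsub>B\<^esub> F2 (Src ?a) x y
      = (run B (FO F (x \<otimes>\<^bsub>A\<^esub> y)) \<cdot>\<^bsub>B\<^esub> (F2 F x y \<odot>\<^bsub>B\<^esub> Ide B \<one>\<^bsub>B\<^esub>)) \<cdot>\<^bsub>B\<^esub> ?r \<cdot>\<^bsub>B\<^esub> ?I"
      by (simp add: F.B.TenA_merge')
    also have "\<dots> = F2 F x y \<cdot>\<^bsub>B\<^esub> (run B (FO F x \<otimes>\<^bsub>B\<^esub> FO F y) \<cdot>\<^bsub>B\<^esub> ?r \<cdot>\<^bsub>B\<^esub> ?I)"
      by (subst F.B.run_nat) simp_all
    also have "\<dots> = F2 (Tgt ?a) x y \<cdot>\<^bsub>B\<^esub> (Cpt ?a x \<odot>\<^bsub>B\<^esub> Cpt ?a y)"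
      by (subst F.B.run_interchange) simp_all
    finally show "Cpt ?a (x \<otimes>\<^bsub>A\<^esub> y) \<cdot>\<^bsub>B\<^esub> F2 (Src ?a) x y = F2 (Tgt ?a) x y \<cdot>\<^bsub>B\<^esub> (Cpt ?a x \<odot>\<^bsub>B\<^esub> Cpt ?a y)" .
  qed (simp_all add: assms sm_functor_box_smf sm_functor_unit_smf F.A.sm_category_axioms F.B.sm_category_axioms F.B.run_nat)
qed

lemma sm_transformation_lun:
  assumes "sm_functor A B F"
  shows "sm_transformation A B (lun (ihom A B) F)"
proof -
  interpret F: sm_functor A B F by fact
  let ?a = "lun (ihom A B) F"
  show ?thesis
  proof (rule sm_transformationI)
    show "Cpt ?a \<one>\<^bsub>A\<^esub> \<cdot>\<^bsub>B\<^esub> F0 (Src ?a) = F0 (Tgt ?a)"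
      using F.B.Comp_extend[OF F.B.lun_nat[of "F0 F" "FO F \<one>\<^bsub>A\<^esub>"], of "inv_arr B (run B \<one>\<^bsub>B\<^esub>)"]
      by (simp add: F.B.run_Unit)
  next
    fix x y assume [simp]: "x \<in> Obj A" "y \<in> Obj A"
    let ?r = "run B \<one>\<^bsub>B\<^esub> \<odot>\<^bsub>B\<^esub> Ide B (FO F x \<otimes>\<^bsub>B\<^esub> FO F y)" and ?I = "interchange B \<one>\<^bsub>B\<^esub> (FO F x) \<one>\<^bsub>B\<^esub> (FO F y)"
    have "Cpt ?a (x \<otimes>\<^bsub>A\<^esub> y) \<cdot>\<^bsub>B\<^esub> F2 (Src ?a) x y
      = (lun B (FO F (x \<otimes>\<^bsub>A\<^esub> y)) \<cdot>\<^bsub>B\<^esub> (Ide B \<one>\<^bsub>B\<^esub> \<odot>\<^bsub>B\<^esub> F2 F x y)) \<cdot>\<^bsub>B\<^esub> ?r \<cdot>\<^bsub>B\<^esub> ?I"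
      by (simp add: F.B.TenA_merge')
    also have "\<dots> = F2 F x y \<cdot>\<^bsub>B\<^esub> (lun B (FO F x \<otimes>\<^bsub>B\<^esub> FO F y) \<cdot>\<^bsub>B\<^esub> ?r \<cdot>\<^bsub>B\<^esub> ?I)"
      by (subst F.B.lun_nat) simp_all
    also have "\<dots> = F2 (Tgt ?a) x y \<cdot>\<^bsub>B\<^esub> (Cpt ?a x \<odot>\<^bsub>B\<^esub> Cpt ?a y)"
      by (subst F.B.lun_interchange) simp_all
    finally show "Cpt ?a (x \<otimes>\<^bsub>A\<^esub> y) \<cdot>\<^bsub>B\<^esub> F2 (Src ?a) x y = F2 (Tgt ?a) x y \<cdot>\<^bsub>B\<^esub> (Cpt ?a x \<odot>\<^bsub>B\<^esub> Cpt ?a y)" .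
  qed (simp_all add: assms sm_functor_box_smf sm_functor_unit_smf F.A.sm_category_axioms F.B.sm_category_axioms F.B.lun_nat)
qed

lemma sm_transformation_braid:
  assumes "sm_functor A B F" "sm_functor A B G"
  shows "sm_transformation A B (braid (ihom A B) F G)"
proof -
  interpret F: sm_functor A B F by fact
  interpret G: sm_functor A B G by fact
  let ?a = "braid (ihom A B) F G"
  show ?thesis
  proof (rule sm_transformationI)
    show "Cpt ?a \<one>\<^bsub>A\<^esub> \<cdot>\<^bsub>B\<^esub> F0 (Src ?a) = F0 (Tgt ?a)"
      using F.B.Comp_extend[OF F.B.braid_nat[of "F0 F" "F0 G" "FO F \<one>\<^bsub>A\<^esub>" "FO G \<one>\<^bsub>A\<^esub>"], of "inv_arr B (run B \<one>\<^bsub>B\<^esub>)"]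
      by (simp add: F.B.unit_coherence(3))
  next
    fix x y assume [simp]: "x \<in> Obj A" "y \<in> Obj A"
    let ?I = "interchange B (FO F x) (FO G x) (FO F y) (FO G y)"
    have "Cpt ?a (x \<otimes>\<^bsub>A\<^esub> y) \<cdot>\<^bsub>B\<^esub> F2 (Src ?a) x y
      = (braid B (FO F (x \<otimes>\<^bsub>A\<^esub> y)) (FO G (x \<otimes>\<^bsub>A\<^esub> y)) \<cdot>\<^bsub>B\<^esub> (F2 F x y \<odot>\<^bsub>B\<^esub> F2 G x y)) \<cdot>\<^bsub>B\<^esub> ?I"
      by simp
    also have "\<dots> = (F2 G x y \<odot>\<^bsub>B\<^esub> F2 F x y) \<cdot>\<^bsub>B\<^esub> (braid B (FO F x \<otimes>\<^bsub>B\<^esub> FO F y) (FO G x \<otimes>\<^bsub>B\<^esub> FO G y) \<cdot>\<^bsub>B\<^esub> ?I)"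
      by (subst F.B.braid_nat) simp_all
    also have "\<dots> = F2 (Tgt ?a) x y \<cdot>\<^bsub>B\<^esub> (Cpt ?a x \<odot>\<^bsub>B\<^esub> Cpt ?a y)"
      by (subst F.B.braid_interchange) simp_all
    finally show "Cpt ?a (x \<otimes>\<^bsub>A\<^esub> y) \<cdot>\<^bsub>B\<^esub> F2 (Src ?a) x y = F2 (Tgt ?a) x y \<cdot>\<^bsub>B\<^esub> (Cpt ?a x \<odot>\<^bsub>B\<^esub> Cpt ?a y)" .
  qed (simp_all add: assms sm_functor_box_smf F.B.braid_nat)
qed

text \<open>Inverting the components keeps a transformation monoidal: the squares for naturality and
  for the tensor axiom have invertible parallel sides and are turned around.\<close>

lemma inverses_ihom:
  assumes "sm_transformation A B \<sigma>" "\<And>x. x \<in> Obj A \<Longrightarrow> iso B (Cpt \<sigma> x)"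
  shows "inverses (ihom A B) \<sigma> \<lparr>Src = Tgt \<sigma>, Tgt = Src \<sigma>, Cpt = (\<lambda>x\<in>Obj A. inv_arr B (Cpt \<sigma> x))\<rparr>"
    (is "inverses _ _ ?\<tau>")
proof -
  interpret s: sm_transformation A B \<sigma> by fact
  note [simp] = assms(2)
  have "sm_transformation A B ?\<tau>"
  proof (rule sm_transformationI)
    fix f assume [simp]: "f \<in> Arr A"
    show "Cpt ?\<tau> (Cod A f) \<cdot>\<^bsub>B\<^esub> FA (Src ?\<tau>) f = FA (Tgt ?\<tau>) f \<cdot>\<^bsub>B\<^esub> Cpt ?\<tau> (Dom A f)"
      using s.S.B.naturality_inv[OF _ _ s.Cpt_nat[of f]] by simp
  next
    have "inv_arr B (Cpt \<sigma> \<one>\<^bsub>A\<^esub>) \<cdot>\<^bsub>B\<^esub> Cpt \<sigma> \<one>\<^bsub>A\<^esub> \<cdot>\<^bsub>B\<^esub> F0 (Src \<sigma>) = F0 (Src \<sigma>)" by simp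
    then show "Cpt ?\<tau> \<one>\<^bsub>A\<^esub> \<cdot>\<^bsub>B\<^esub> F0 (Src ?\<tau>) = F0 (Tgt ?\<tau>)" by (simp add: s.Cpt_unit)
  next
    fix x y assume [simp]: "x \<in> Obj A" "y \<in> Obj A"
    show "Cpt ?\<tau> (x \<otimes>\<^bsub>A\<^esub> y) \<cdot>\<^bsub>B\<^esub> F2 (Src ?\<tau>) x y = F2 (Tgt ?\<tau>) x y \<cdot>\<^bsub>B\<^esub> (Cpt ?\<tau> x \<odot>\<^bsub>B\<^esub> Cpt ?\<tau> y)"
      using s.S.B.naturality_inv[OF _ _ s.Cpt_tensor[of x y]] by (simp add: s.S.B.inv_arr_TenA)
  qed (simp_all add: s.S.sm_functor_axioms s.T.sm_functor_axioms)
  then show ?thesis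
    unfolding inverses_def in_hom_iff by (auto simp: assms intro!: smt_eqI[where A=A])
qed

text \<open>Transformations are equal when their components are, so each axiom is the axiom of B at
  every object. The substance lies in the lemmas collected as \<open>T\<close>: the structural data
  are monoidal transformations.\<close>

theorem sm_category_ihom:
  assumes "sm_category A" "sm_category B"
  shows "sm_category (ihom A B)"
proof -
  interpret A: sm_category A by fact
  interpret B: sm_category B by fact
  note T = sm_transformation_Ide sm_transformation_Comp sm_transformation_TenA sm_transformation_ass
    sm_transformation_run sm_transformation_lun sm_transformation_braid
  have E: "Cpt \<sigma> \<in> extensional (Obj A)" "\<And>x. x \<in> Obj A \<Longrightarrow> Cpt \<sigma> x \<in> Arr B"
     "\<And>x. x \<in> Obj A \<Longrightarrow> Dom B (Cpt \<sigma> x) = FO (Src \<sigma>) x" "\<And>x. x \<in> Obj A \<Longrightarrow> Cod B (Cpt \<sigma> x) = FO (Tgt \<sigma>) x"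
    if "sm_transformation A B \<sigma>" for \<sigma>
    by (auto intro: sm_transformation.Cpt_ext[OF that] sm_transformation.Cpt_simps[OF that])
  have F: "\<And>x. x \<in> Obj A \<Longrightarrow> FO F x \<in> Obj B" if "sm_functor A B F" for F
    using that by (rule sm_functor.FO_in)
  have I: "iso (ihom A B) \<sigma>" if "sm_transformation A B \<sigma>" "\<And>x. x \<in> Obj A \<Longrightarrow> iso B (Cpt \<sigma> x)" for \<sigma>
    unfolding iso_def using inverses_ihom[OF that] by blast
  show ?thesis
    by unfold_locales
      (auto simp: in_hom_iff T sm_functor_Src_Tgt E F sm_functor_box_smf sm_functor_unit_smf assms B.TenA_merge B.sym_sym B.ass_nat
        B.run_nat B.lun_nat B.braid_nat B.pentagon B.triangle B.hexagon B.unit_sym[symmetric] intro!: I smt_eqI[where A=A])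
qed

section \<open>Composition and whiskering\<close>

lemma comp_smf_simps [simp]:
  "x \<in> Obj A \<Longrightarrow> FO (comp_smf A C G F) x = FO G (FO F x)"
  "f \<in> Arr A \<Longrightarrow> FA (comp_smf A C G F) f = FA G (FA F f)"
  "F0 (comp_smf A C G F) = FA G (F0 F) \<cdot>\<^bsub>C\<^esub> F0 G"
  "\<lbrakk>x \<in> Obj A; y \<in> Obj A\<rbrakk> \<Longrightarrow> F2 (comp_smf A C G F) x y = FA G (F2 F x y) \<cdot>\<^bsub>C\<^esub> F2 G (FO F x) (FO F y)"
  "FO (comp_smf A C G F) \<in> extensional (Obj A)" "FA (comp_smf A C G F) \<in> extensional (Arr A)"
  "F2 (comp_smf A C G F) \<in> extensional (Obj A)"
  "x \<in> Obj A \<Longrightarrow> F2 (comp_smf A C G F) x \<in> extensional (Obj A)"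
  by (simp_all add: comp_smf_def)

context sm_functor
begin

lemma F2_nat':
  assumes "f \<in> Arr A" "g \<in> Arr A" "Cod A f = x'" "Cod A g = y'"
    and "h \<in> Arr B" "Cod B h = FO F (Dom A f) \<otimes>\<^bsub>B\<^esub> FO F (Dom A g)"
  shows "F2 F x' y' \<cdot>\<^bsub>B\<^esub> (FA F f \<odot>\<^bsub>B\<^esub> FA F g) \<cdot>\<^bsub>B\<^esub> h = FA F (f \<odot>\<^bsub>A\<^esub> g) \<cdot>\<^bsub>B\<^esub> F2 F (Dom A f) (Dom A g) \<cdot>\<^bsub>B\<^esub> h"
proof -
  have "x' \<in> Obj A" "y' \<in> Obj A" using assms A.Dom_Cod_in by blast+
  then show ?thesis using B.Comp_extend[OF F2_nat[OF assms(1-4)], of h] assms by simp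
qed

text \<open>The axiom \<open>F2_run\<close> at the unit object, precomposed with \<open>F0\<close>
  in the first factor and solved for the comparison. It governs how [A, F] treats the constant
  functors.\<close>

lemma F2_F0_F0: "F2 F \<one>\<^bsub>A\<^esub> \<one>\<^bsub>A\<^esub> \<cdot>\<^bsub>B\<^esub> (F0 F \<odot>\<^bsub>B\<^esub> F0 F) = FA F (inv_arr A (run A \<one>\<^bsub>A\<^esub>)) \<cdot>\<^bsub>B\<^esub> F0 F \<cdot>\<^bsub>B\<^esub> run B \<one>\<^bsub>B\<^esub>"
proof (rule B.iso_cancel_left)
  have "FA F (run A \<one>\<^bsub>A\<^esub>) \<cdot>\<^bsub>B\<^esub> F2 F \<one>\<^bsub>A\<^esub> \<one>\<^bsub>A\<^esub> \<cdot>\<^bsub>B\<^esub> (F0 F \<odot>\<^bsub>B\<^esub> F0 F)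
    = (FA F (run A \<one>\<^bsub>A\<^esub>) \<cdot>\<^bsub>B\<^esub> F2 F \<one>\<^bsub>A\<^esub> \<one>\<^bsub>A\<^esub> \<cdot>\<^bsub>B\<^esub> (Ide B (FO F \<one>\<^bsub>A\<^esub>) \<odot>\<^bsub>B\<^esub> F0 F)) \<cdot>\<^bsub>B\<^esub> (F0 F \<odot>\<^bsub>B\<^esub> Ide B \<one>\<^bsub>B\<^esub>)"
    by (simp add: B.TenA_merge)
  also have "\<dots> = F0 F \<cdot>\<^bsub>B\<^esub> run B \<one>\<^bsub>B\<^esub>"
    unfolding F2_run[OF A.Unit_in] by (simp add: B.run_nat)
  finally show "FA F (run A \<one>\<^bsub>A\<^esub>) \<cdot>\<^bsub>B\<^esub> F2 F \<one>\<^bsub>A\<^esub> \<one>\<^bsub>A\<^esub> \<cdot>\<^bsub>B\<^esub> (F0 F \<odot>\<^bsub>B\<^esub> F0 F)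
    = FA F (run A \<one>\<^bsub>A\<^esub>) \<cdot>\<^bsub>B\<^esub> FA F (inv_arr A (run A \<one>\<^bsub>A\<^esub>)) \<cdot>\<^bsub>B\<^esub> F0 F \<cdot>\<^bsub>B\<^esub> run B \<one>\<^bsub>B\<^esub>"
    by (simp add: FA_inv_arr)
qed simp_all

end

lemma sm_functor_comp_smf:
  assumes "sm_functor A B F" "sm_functor B C G"
  shows "sm_functor A C (comp_smf A C G F)"
proof -
  interpret F: sm_functor A B F by fact
  interpret G: sm_functor B C G by fact
  let ?H = "comp_smf A C G F"
  show ?thesis
  proof (rule sm_functorI)
    show "sm_category A" "sm_category C" by unfold_locales
  next
    fix f g assume [simp]: "f \<in> Arr A" "g \<in> Arr A"
    have "F2 ?H (Cod A f) (Cod A g) \<cdot>\<^bsub>C\<^esub> (FA ?H f \<odot>\<^bsub>C\<^esub> FA ?H g)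
      = FA G (F2 F (Cod A f) (Cod A g) \<cdot>\<^bsub>B\<^esub> (FA F f \<odot>\<^bsub>B\<^esub> FA F g)) \<cdot>\<^bsub>C\<^esub> F2 G (FO F (Dom A f)) (FO F (Dom A g))"
      by (simp add: G.F2_nat)
    then show "F2 ?H (Cod A f) (Cod A g) \<cdot>\<^bsub>C\<^esub> (FA ?H f \<odot>\<^bsub>C\<^esub> FA ?H g) = FA ?H (f \<odot>\<^bsub>A\<^esub> g) \<cdot>\<^bsub>C\<^esub> F2 ?H (Dom A f) (Dom A g)"
      by (simp add: F.F2_nat)
  next
    fix x y z assume [simp]: "x \<in> Obj A" "y \<in> Obj A" "z \<in> Obj A"
    let ?x = "FO F x" and ?y = "FO F y" and ?z = "FO F z"
    have "F2 ?H (x \<otimes>\<^bsub>A\<^esub> y) z \<cdot>\<^bsub>C\<^esub> (F2 ?H x y \<odot>\<^bsub>C\<^esub> Ide C (FO ?H z)) \<cdot>\<^bsub>C\<^esub> ass C (FO ?H x) (FO ?H y) (FO ?H z)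
      = FA G (F2 F (x \<otimes>\<^bsub>A\<^esub> y) z) \<cdot>\<^bsub>C\<^esub> F2 G (FO F (x \<otimes>\<^bsub>A\<^esub> y)) ?z \<cdot>\<^bsub>C\<^esub> (FA G (F2 F x y) \<odot>\<^bsub>C\<^esub> FA G (Ide B ?z))
       \<cdot>\<^bsub>C\<^esub> (F2 G ?x ?y \<odot>\<^bsub>C\<^esub> Ide C (FO G ?z)) \<cdot>\<^bsub>C\<^esub> ass C (FO G ?x) (FO G ?y) (FO G ?z)"
      by (simp add: G.B.TenA_merge')
    also have "\<dots> = FA G (F2 F (x \<otimes>\<^bsub>A\<^esub> y) z) \<cdot>\<^bsub>C\<^esub> FA G (F2 F x y \<odot>\<^bsub>B\<^esub> Ide B ?z) \<cdot>\<^bsub>C\<^esub> F2 G (?x \<otimes>\<^bsub>B\<^esub> ?y) ?z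
       \<cdot>\<^bsub>C\<^esub> (F2 G ?x ?y \<odot>\<^bsub>C\<^esub> Ide C (FO G ?z)) \<cdot>\<^bsub>C\<^esub> ass C (FO G ?x) (FO G ?y) (FO G ?z)"
      by (subst G.F2_nat') simp_all
    also have "\<dots> = FA G (F2 F (x \<otimes>\<^bsub>A\<^esub> y) z \<cdot>\<^bsub>B\<^esub> (F2 F x y \<odot>\<^bsub>B\<^esub> Ide B ?z) \<cdot>\<^bsub>B\<^esub> ass B ?x ?y ?z)
       \<cdot>\<^bsub>C\<^esub> F2 G ?x (?y \<otimes>\<^bsub>B\<^esub> ?z) \<cdot>\<^bsub>C\<^esub> (Ide C (FO G ?x) \<odot>\<^bsub>C\<^esub> F2 G ?y ?z)"
      by (simp add: G.F2_ass)
    also have "\<dots> = FA G (FA F (ass A x y z)) \<cdot>\<^bsub>C\<^esub> FA G (F2 F x (y \<otimes>\<^bsub>A\<^esub> z))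
       \<cdot>\<^bsub>C\<^esub> (FA G (Ide B ?x \<odot>\<^bsub>B\<^esub> F2 F y z) \<cdot>\<^bsub>C\<^esub> F2 G ?x (?y \<otimes>\<^bsub>B\<^esub> ?z)) \<cdot>\<^bsub>C\<^esub> (Ide C (FO G ?x) \<odot>\<^bsub>C\<^esub> F2 G ?y ?z)"
      by (simp add: F.F2_ass)
    also have "\<dots> = FA ?H (ass A x y z) \<cdot>\<^bsub>C\<^esub> F2 ?H x (y \<otimes>\<^bsub>A\<^esub> z) \<cdot>\<^bsub>C\<^esub> (Ide C (FO ?H x) \<odot>\<^bsub>C\<^esub> F2 ?H y z)"
      using G.F2_nat[of "Ide B ?x" "F2 F y z" ?x "FO F (y \<otimes>\<^bsub>A\<^esub> z)", symmetric] by (simp add: G.B.TenA_merge)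
    finally show "F2 ?H (x \<otimes>\<^bsub>A\<^esub> y) z \<cdot>\<^bsub>C\<^esub> (F2 ?H x y \<odot>\<^bsub>C\<^esub> Ide C (FO ?H z)) \<cdot>\<^bsub>C\<^esub> ass C (FO ?H x) (FO ?H y) (FO ?H z)
      = FA ?H (ass A x y z) \<cdot>\<^bsub>C\<^esub> F2 ?H x (y \<otimes>\<^bsub>A\<^esub> z) \<cdot>\<^bsub>C\<^esub> (Ide C (FO ?H x) \<odot>\<^bsub>C\<^esub> F2 ?H y z)" .
  next
    fix x assume [simp]: "x \<in> Obj A"
    let ?x = "FO F x" and ?i = "FO F \<one>\<^bsub>A\<^esub>"
    have "FA ?H (run A x) \<cdot>\<^bsub>C\<^esub> F2 ?H x \<one>\<^bsub>A\<^esub> \<cdot>\<^bsub>C\<^esub> (Ide C (FO ?H x) \<odot>\<^bsub>C\<^esub> F0 ?H)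
      = FA G (FA F (run A x)) \<cdot>\<^bsub>C\<^esub> FA G (F2 F x \<one>\<^bsub>A\<^esub>) \<cdot>\<^bsub>C\<^esub> F2 G ?x ?i \<cdot>\<^bsub>C\<^esub> (FA G (Ide B ?x) \<odot>\<^bsub>C\<^esub> FA G (F0 F))
        \<cdot>\<^bsub>C\<^esub> (Ide C (FO G ?x) \<odot>\<^bsub>C\<^esub> F0 G)"
      by (simp add: G.B.TenA_merge)
    also have "\<dots> = FA G (FA F (run A x) \<cdot>\<^bsub>B\<^esub> F2 F x \<one>\<^bsub>A\<^esub> \<cdot>\<^bsub>B\<^esub> (Ide B ?x \<odot>\<^bsub>B\<^esub> F0 F))
        \<cdot>\<^bsub>C\<^esub> F2 G ?x \<one>\<^bsub>B\<^esub> \<cdot>\<^bsub>C\<^esub> (Ide C (FO G ?x) \<odot>\<^bsub>C\<^esub> F0 G)"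
      by (subst G.F2_nat') simp_all
    also have "\<dots> = run C (FO ?H x)"
      by (simp only: F.F2_run \<open>x \<in> Obj A\<close>) (simp add: G.F2_run)
    finally show "FA ?H (run A x) \<cdot>\<^bsub>C\<^esub> F2 ?H x \<one>\<^bsub>A\<^esub> \<cdot>\<^bsub>C\<^esub> (Ide C (FO ?H x) \<odot>\<^bsub>C\<^esub> F0 ?H) = run C (FO ?H x)" .
    have "FA ?H (lun A x) \<cdot>\<^bsub>C\<^esub> F2 ?H \<one>\<^bsub>A\<^esub> x \<cdot>\<^bsub>C\<^esub> (F0 ?H \<odot>\<^bsub>C\<^esub> Ide C (FO ?H x))
      = FA G (FA F (lun A x)) \<cdot>\<^bsub>C\<^esub> FA G (F2 F \<one>\<^bsub>A\<^esub> x) \<cdot>\<^bsub>C\<^esub> F2 G ?i ?x \<cdot>\<^bsub>C\<^esub> (FA G (F0 F) \<odot>\<^bsub>C\<^esub> FA G (Ide B ?x))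
        \<cdot>\<^bsub>C\<^esub> (F0 G \<odot>\<^bsub>C\<^esub> Ide C (FO G ?x))"
      by (simp add: G.B.TenA_merge)
    also have "\<dots> = FA G (FA F (lun A x) \<cdot>\<^bsub>B\<^esub> F2 F \<one>\<^bsub>A\<^esub> x \<cdot>\<^bsub>B\<^esub> (F0 F \<odot>\<^bsub>B\<^esub> Ide B ?x))
        \<cdot>\<^bsub>C\<^esub> F2 G \<one>\<^bsub>B\<^esub> ?x \<cdot>\<^bsub>C\<^esub> (F0 G \<odot>\<^bsub>C\<^esub> Ide C (FO G ?x))"
      by (subst G.F2_nat') simp_all
    also have "\<dots> = lun C (FO ?H x)"
      by (simp only: F.F2_lun \<open>x \<in> Obj A\<close>) (simp add: G.F2_lun)
    finally show "FA ?H (lun A x) \<cdot>\<^bsub>C\<^esub> F2 ?H \<one>\<^bsub>A\<^esub> x \<cdot>\<^bsub>C\<^esub> (F0 ?H \<odot>\<^bsub>C\<^esub> Ide C (FO ?H x)) = lun C (FO ?H x)" .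
  next
    fix x y assume [simp]: "x \<in> Obj A" "y \<in> Obj A"
    have "FA ?H (braid A x y) \<cdot>\<^bsub>C\<^esub> F2 ?H x y = FA G (FA F (braid A x y) \<cdot>\<^bsub>B\<^esub> F2 F x y) \<cdot>\<^bsub>C\<^esub> F2 G (FO F x) (FO F y)"
      by simp
    also have "\<dots> = F2 ?H y x \<cdot>\<^bsub>C\<^esub> braid C (FO ?H x) (FO ?H y)"
      unfolding F.F2_sym[OF \<open>x \<in> Obj A\<close> \<open>y \<in> Obj A\<close>] by (simp add: G.F2_sym)
    finally show "FA ?H (braid A x y) \<cdot>\<^bsub>C\<^esub> F2 ?H x y = F2 ?H y x \<cdot>\<^bsub>C\<^esub> braid C (FO ?H x) (FO ?H y)" .
  qed simp_all
qed

lemma whisker_simps [simp]: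
  "Src (whisker_left A C G \<theta>) = comp_smf A C G (Src \<theta>)" "Tgt (whisker_left A C G \<theta>) = comp_smf A C G (Tgt \<theta>)"
  "x \<in> Obj A \<Longrightarrow> Cpt (whisker_left A C G \<theta>) x = FA G (Cpt \<theta> x)"
  "Cpt (whisker_left A C G \<theta>) \<in> extensional (Obj A)"
  "Src (whisker_right A C \<sigma> H) = comp_smf A C (Src \<sigma>) H" "Tgt (whisker_right A C \<sigma> H) = comp_smf A C (Tgt \<sigma>) H"
  "x \<in> Obj A \<Longrightarrow> Cpt (whisker_right A C \<sigma> H) x = Cpt \<sigma> (FO H x)"
  "Cpt (whisker_right A C \<sigma> H) \<in> extensional (Obj A)"
  by (simp_all add: whisker_left_def whisker_right_def)

lemma sm_transformation_whisker_left:
  assumes "sm_transformation A B \<theta>" "sm_functor B C G"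
  shows "sm_transformation A C (whisker_left A C G \<theta>)"
proof -
  interpret t: sm_transformation A B \<theta> by fact
  interpret G: sm_functor B C G by fact
  let ?w = "whisker_left A C G \<theta>"
  show ?thesis
  proof (rule sm_transformationI)
    show "sm_functor A C (Src ?w)" "sm_functor A C (Tgt ?w)"
      by (simp_all add: sm_functor_comp_smf[OF _ assms(2)] t.S.sm_functor_axioms t.T.sm_functor_axioms)
  next
    fix f assume [simp]: "f \<in> Arr A"
    show "Cpt ?w (Cod A f) \<cdot>\<^bsub>C\<^esub> FA (Src ?w) f = FA (Tgt ?w) f \<cdot>\<^bsub>C\<^esub> Cpt ?w (Dom A f)"
      by (simp add: t.Cpt_nat flip: G.FA_Comp_simp)
  next
    have "FA G (Cpt \<theta> \<one>\<^bsub>A\<^esub>) \<cdot>\<^bsub>C\<^esub> FA G (F0 (Src \<theta>)) = FA G (F0 (Tgt \<theta>))"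
      by (simp add: t.Cpt_unit flip: G.FA_Comp_simp)
    then show "Cpt ?w \<one>\<^bsub>A\<^esub> \<cdot>\<^bsub>C\<^esub> F0 (Src ?w) = F0 (Tgt ?w)"
      using G.B.Comp_extend[of "FA G (Cpt \<theta> \<one>\<^bsub>A\<^esub>)" "FA G (F0 (Src \<theta>))" _ "F0 G"] by simp
  next
    fix x y assume [simp]: "x \<in> Obj A" "y \<in> Obj A"
    have "Cpt ?w (x \<otimes>\<^bsub>A\<^esub> y) \<cdot>\<^bsub>C\<^esub> F2 (Src ?w) x y
      = FA G (Cpt \<theta> (x \<otimes>\<^bsub>A\<^esub> y) \<cdot>\<^bsub>B\<^esub> F2 (Src \<theta>) x y) \<cdot>\<^bsub>C\<^esub> F2 G (FO (Src \<theta>) x) (FO (Src \<theta>) y)"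
      by simp
    also have "\<dots> = F2 (Tgt ?w) x y \<cdot>\<^bsub>C\<^esub> (Cpt ?w x \<odot>\<^bsub>C\<^esub> Cpt ?w y)"
      unfolding t.Cpt_tensor[OF \<open>x \<in> Obj A\<close> \<open>y \<in> Obj A\<close>] by (simp add: G.F2_nat)
    finally show "Cpt ?w (x \<otimes>\<^bsub>A\<^esub> y) \<cdot>\<^bsub>C\<^esub> F2 (Src ?w) x y = F2 (Tgt ?w) x y \<cdot>\<^bsub>C\<^esub> (Cpt ?w x \<odot>\<^bsub>C\<^esub> Cpt ?w y)" .
  qed simp_all
qed

lemma sm_transformation_whisker_right:
  assumes "sm_transformation B C \<sigma>" "sm_functor A B H"
  shows "sm_transformation A C (whisker_right A C \<sigma> H)"
proof -
  interpret t: sm_transformation B C \<sigma> by fact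
  interpret H: sm_functor A B H by fact
  let ?w = "whisker_right A C \<sigma> H"
  show ?thesis
  proof (rule sm_transformationI)
    show "sm_functor A C (Src ?w)" "sm_functor A C (Tgt ?w)"
      by (simp_all add: sm_functor_comp_smf[OF assms(2)] t.S.sm_functor_axioms t.T.sm_functor_axioms)
  next
    fix f assume [simp]: "f \<in> Arr A"
    show "Cpt ?w (Cod A f) \<cdot>\<^bsub>C\<^esub> FA (Src ?w) f = FA (Tgt ?w) f \<cdot>\<^bsub>C\<^esub> Cpt ?w (Dom A f)"
      using t.Cpt_nat[of "FA H f"] by simp
  next
    have "Cpt ?w \<one>\<^bsub>A\<^esub> \<cdot>\<^bsub>C\<^esub> F0 (Src ?w) = (Cpt \<sigma> (FO H \<one>\<^bsub>A\<^esub>) \<cdot>\<^bsub>C\<^esub> FA (Src \<sigma>) (F0 H)) \<cdot>\<^bsub>C\<^esub> F0 (Src \<sigma>)"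
      by simp
    also have "\<dots> = F0 (Tgt ?w)"
      using t.Cpt_nat[of "F0 H"] by (simp add: t.Cpt_unit)
    finally show "Cpt ?w \<one>\<^bsub>A\<^esub> \<cdot>\<^bsub>C\<^esub> F0 (Src ?w) = F0 (Tgt ?w)" .
  next
    fix x y assume [simp]: "x \<in> Obj A" "y \<in> Obj A"
    have "Cpt ?w (x \<otimes>\<^bsub>A\<^esub> y) \<cdot>\<^bsub>C\<^esub> F2 (Src ?w) x y
      = (Cpt \<sigma> (FO H (x \<otimes>\<^bsub>A\<^esub> y)) \<cdot>\<^bsub>C\<^esub> FA (Src \<sigma>) (F2 H x y)) \<cdot>\<^bsub>C\<^esub> F2 (Src \<sigma>) (FO H x) (FO H y)"
      by simp
    also have "\<dots> = F2 (Tgt ?w) x y \<cdot>\<^bsub>C\<^esub> (Cpt ?w x \<odot>\<^bsub>C\<^esub> Cpt ?w y)"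
      using t.Cpt_nat[of "F2 H x y"] by (simp add: t.Cpt_tensor)
    finally show "Cpt ?w (x \<otimes>\<^bsub>A\<^esub> y) \<cdot>\<^bsub>C\<^esub> F2 (Src ?w) x y = F2 (Tgt ?w) x y \<cdot>\<^bsub>C\<^esub> (Cpt ?w x \<odot>\<^bsub>C\<^esub> Cpt ?w y)" .
  qed simp_all
qed

section \<open>The functors [A, F] between internal homs\<close>

lemma ihom_map_simps [simp]:
  "sm_functor A B H \<Longrightarrow> FO (ihom_map A B C F) H = comp_smf A C F H"
  "sm_transformation A B \<theta> \<Longrightarrow> FA (ihom_map A B C F) \<theta> = whisker_left A C F \<theta>"
  "Src (F0 (ihom_map A B C F)) = unit_smf A C"
  "Tgt (F0 (ihom_map A B C F)) = comp_smf A C F (unit_smf A B)"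
  "x \<in> Obj A \<Longrightarrow> Cpt (F0 (ihom_map A B C F)) x = F0 F"
  "Cpt (F0 (ihom_map A B C F)) \<in> extensional (Obj A)"
  "\<lbrakk>sm_functor A B H; sm_functor A B K\<rbrakk>
    \<Longrightarrow> Src (F2 (ihom_map A B C F) H K) = box_smf A C (comp_smf A C F H) (comp_smf A C F K)"
  "\<lbrakk>sm_functor A B H; sm_functor A B K\<rbrakk>
    \<Longrightarrow> Tgt (F2 (ihom_map A B C F) H K) = comp_smf A C F (box_smf A B H K)"
  "\<lbrakk>sm_functor A B H; sm_functor A B K; x \<in> Obj A\<rbrakk> \<Longrightarrow> Cpt (F2 (ihom_map A B C F) H K) x = F2 F (FO H x) (FO K x)"
  "\<lbrakk>sm_functor A B H; sm_functor A B K\<rbrakk> \<Longrightarrow> Cpt (F2 (ihom_map A B C F) H K) \<in> extensional (Obj A)"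
  by (simp_all add: ihom_map_def)

lemma ihom_map_ext:
  "FO (ihom_map A B C F) \<in> extensional (Obj (ihom A B))" "FA (ihom_map A B C F) \<in> extensional (Arr (ihom A B))"
  "F2 (ihom_map A B C F) \<in> extensional (Obj (ihom A B))"
  "H \<in> Obj (ihom A B) \<Longrightarrow> F2 (ihom_map A B C F) H \<in> extensional (Obj (ihom A B))"
  by (simp_all add: ihom_map_def del: ihom_sel)

text \<open>The work is to see that the comparisons are 2-cells. \<open>F2_F0_F0\<close> gives the
  tensor axiom of the unit comparison and the unit axiom of the binary one,
  \<open>FA_interchange\<close> the tensor axiom of the latter. The functor axioms are then those of
  F, component by component.\<close>

lemma sm_functor_ihom_map:
  assumes "sm_category A" "sm_functor B C F"
  shows "sm_functor (ihom A B) (ihom A C) (ihom_map A B C F)"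
proof -
  interpret A: sm_category A by fact
  interpret F: sm_functor B C F by fact
  have AB: "sm_category (ihom A B)" and AC: "sm_category (ihom A C)"
    by (auto intro: sm_category_ihom assms F.A.sm_category_axioms F.B.sm_category_axioms)
  let ?M = "ihom_map A B C F"
  have u: "sm_functor A B (unit_smf A B)" "sm_functor A C (unit_smf A C)"
    by (auto intro: sm_functor_unit_smf assms F.A.sm_category_axioms F.B.sm_category_axioms)
  note comp = sm_functor_comp_smf[OF _ assms(2), of A]
  have t0: "sm_transformation A C (F0 ?M)"
  proof (rule sm_transformationI)
    fix x y assume [simp]: "x \<in> Obj A" "y \<in> Obj A"
    show "Cpt (F0 ?M) (x \<otimes>\<^bsub>A\<^esub> y) \<cdot>\<^bsub>C\<^esub> F2 (Src (F0 ?M)) x y = F2 (Tgt (F0 ?M)) x y \<cdot>\<^bsub>C\<^esub> (Cpt (F0 ?M) x \<odot>\<^bsub>C\<^esub> Cpt (F0 ?M) y)"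
      by (simp add: F.F2_F0_F0 F.FA_inv_arr)
  qed (simp_all add: u comp)
  have t2: "sm_transformation A C (F2 ?M H K)" if h: "sm_functor A B H" "sm_functor A B K" for H K
  proof -
    interpret H: sm_functor A B H by fact
    interpret K: sm_functor A B K by fact
    let ?m = "F2 ?M H K"
    show ?thesis
    proof (rule sm_transformationI)
      have "Cpt ?m \<one>\<^bsub>A\<^esub> \<cdot>\<^bsub>C\<^esub> F0 (Src ?m) = F2 F (FO H \<one>\<^bsub>A\<^esub>) (FO K \<one>\<^bsub>A\<^esub>) \<cdot>\<^bsub>C\<^esub> (FA F (F0 H) \<odot>\<^bsub>C\<^esub> FA F (F0 K))
          \<cdot>\<^bsub>C\<^esub> (F0 F \<odot>\<^bsub>C\<^esub> F0 F) \<cdot>\<^bsub>C\<^esub> inv_arr C (run C \<one>\<^bsub>C\<^esub>)"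
        by (simp add: h F.B.TenA_merge')
      also have "\<dots> = FA F (F0 H \<odot>\<^bsub>B\<^esub> F0 K) \<cdot>\<^bsub>C\<^esub> (F2 F \<one>\<^bsub>B\<^esub> \<one>\<^bsub>B\<^esub> \<cdot>\<^bsub>C\<^esub> (F0 F \<odot>\<^bsub>C\<^esub> F0 F)) \<cdot>\<^bsub>C\<^esub> inv_arr C (run C \<one>\<^bsub>C\<^esub>)"
        by (subst F.F2_nat') simp_all
      also have "\<dots> = F0 (Tgt ?m)"
        unfolding F.F2_F0_F0 by (simp add: h)
      finally show "Cpt ?m \<one>\<^bsub>A\<^esub> \<cdot>\<^bsub>C\<^esub> F0 (Src ?m) = F0 (Tgt ?m)" .
    next
      fix x y assume [simp]: "x \<in> Obj A" "y \<in> Obj A"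
      have "Cpt ?m (x \<otimes>\<^bsub>A\<^esub> y) \<cdot>\<^bsub>C\<^esub> F2 (Src ?m) x y
        = F2 F (FO H (x \<otimes>\<^bsub>A\<^esub> y)) (FO K (x \<otimes>\<^bsub>A\<^esub> y)) \<cdot>\<^bsub>C\<^esub> (FA F (F2 H x y) \<odot>\<^bsub>C\<^esub> FA F (F2 K x y))
          \<cdot>\<^bsub>C\<^esub> (F2 F (FO H x) (FO H y) \<odot>\<^bsub>C\<^esub> F2 F (FO K x) (FO K y))
          \<cdot>\<^bsub>C\<^esub> interchange C (FO F (FO H x)) (FO F (FO K x)) (FO F (FO H y)) (FO F (FO K y))"
        by (simp add: h F.B.TenA_merge')
      also have "\<dots> = FA F (F2 H x y \<odot>\<^bsub>B\<^esub> F2 K x y) \<cdot>\<^bsub>C\<^esub> (F2 F (FO H x \<otimes>\<^bsub>B\<^esub> FO H y) (FO K x \<otimes>\<^bsub>B\<^esub> FO K y)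
          \<cdot>\<^bsub>C\<^esub> (F2 F (FO H x) (FO H y) \<odot>\<^bsub>C\<^esub> F2 F (FO K x) (FO K y))
          \<cdot>\<^bsub>C\<^esub> interchange C (FO F (FO H x)) (FO F (FO K x)) (FO F (FO H y)) (FO F (FO K y)))"
        by (subst F.F2_nat') simp_all
      also have "\<dots> = F2 (Tgt ?m) x y \<cdot>\<^bsub>C\<^esub> (Cpt ?m x \<odot>\<^bsub>C\<^esub> Cpt ?m y)"
        by (subst F.FA_interchange[symmetric]) (simp_all add: h)
      finally show "Cpt ?m (x \<otimes>\<^bsub>A\<^esub> y) \<cdot>\<^bsub>C\<^esub> F2 (Src ?m) x y = F2 (Tgt ?m) x y \<cdot>\<^bsub>C\<^esub> (Cpt ?m x \<odot>\<^bsub>C\<^esub> Cpt ?m y)" .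
    qed (simp_all add: h comp sm_functor_box_smf F.F2_nat)
  qed
  have obj: "FO G x \<in> Obj B" if "sm_functor A B G" "x \<in> Obj A" for G x
    using that by (rule sm_functor.FO_in)
  have cpt: "Cpt \<sigma> x \<in> Arr B" "Dom B (Cpt \<sigma> x) = FO (Src \<sigma>) x" "Cod B (Cpt \<sigma> x) = FO (Tgt \<sigma>) x"
    if "sm_transformation A B \<sigma>" "x \<in> Obj A" for \<sigma> x
    using that by (simp_all add: sm_transformation.Cpt_simps)
  note T = sm_transformation_Ide sm_transformation_Comp sm_transformation_TenA sm_transformation_ass
    sm_transformation_run sm_transformation_lun sm_transformation_braid sm_transformation_whisker_left
  show ?thesis
    by (rule sm_functorI[OF AB AC ihom_map_ext])
      (auto simp: u t0 t2 comp sm_functor_Src_Tgt obj cpt T assms(2) sm_functor_box_smf F.F2_nat F.F2_ass F.F2_run F.F2_lun F.F2_sym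
       intro!: smt_eqI[where A = A])
qed

section \<open>The tensor product\<close>

lemma tensor_sel [simp]:
  "Obj (tensor A B) = {X. wf_obj A B X}" "Unit (tensor A B) = TUnit" "TenO (tensor A B) = TTen"
  by (simp_all add: tensor_def)

lemma tensor_structure:
  "Ide (tensor A B) X = tclass A B (TIde X)" "ass (tensor A B) X Y Z = tclass A B (TAss X Y Z)"
  "run (tensor A B) X = tclass A B (TRun X)" "lun (tensor A B) X = tclass A B (TLun X)"
  "braid (tensor A B) X Y = tclass A B (TSym X Y)"
  by (simp_all add: tensor_def)

lemma tten_simps [simp]:
  "tdom A B (tten A B p q) = tdom A B p \<otimes>\<^sub>t tdom A B q" "tcod A B (tten A B p q) = tcod A B p \<otimes>\<^sub>t tcod A B q"
  by (simp_all add: tten_def)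

locale sm_category_pair = A: sm_category A + B: sm_category B
  for A :: "('oa, 'ma) smc" and B :: "('ob, 'mb) smc"
begin

abbreviation T :: "(('oa, 'ob) tobj, ('oa, 'ma, 'ob, 'mb) tarr set) smc" where
  "T \<equiv> tensor A B"

lemma wf_tdom_tcod [simp]: "wf_arr A B p \<Longrightarrow> wf_obj A B (tdom A B p)" "wf_arr A B p \<Longrightarrow> wf_obj A B (tcod A B p)"
  by (induction p) auto

lemma wf_tten [simp]: "wf_arr A B (tten A B p q) \<longleftrightarrow> wf_arr A B p \<and> wf_arr A B q"
  by (auto simp: tten_def)

lemma teq_parallel: "teq A B p q \<Longrightarrow> parallel A B p q"
  by (induction rule: teq.induct) (auto simp: parallel_def)

lemma tclass_eqI: "teq A B p q \<Longrightarrow> tclass A B p = tclass A B q"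
  unfolding tclass_def by (blast intro: teq.trans teq.symm)

lemma tclass_gen: "\<lbrakk>tgen A B p q; parallel A B p q\<rbrakk> \<Longrightarrow> tclass A B p = tclass A B q"
  by (intro tclass_eqI teq.gen)

text \<open>Composition and tensor of classes act on chosen representatives; since these are
  congruent to the given terms, the choice drops out in \<open>tclass_Comp\<close> and
  \<open>tclass_TenA\<close>. Well-formedness matters: the class of an ill-formed term is
  empty.\<close>

lemma teq_trep: "wf_arr A B p \<Longrightarrow> teq A B p (trep (tclass A B p))"
  unfolding trep_def tclass_def by (rule someI2[of _ p]) (auto intro: teq.refl)

lemma trep_simps [simp]:
  assumes "wf_arr A B p"
  shows "wf_arr A B (trep (tclass A B p))" "tdom A B (trep (tclass A B p)) = tdom A B p"
    "tcod A B (trep (tclass A B p)) = tcod A B p"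
  using teq_parallel[OF teq_trep[OF assms]] by (auto simp: parallel_def)

lemma Arr_tensor: "Arr T = tclass A B ` {p. wf_arr A B p}"
  by (simp add: tensor_def)

lemma tclass_simps [simp]:
  assumes "wf_arr A B p"
  shows "tclass A B p \<in> Arr T" "Dom T (tclass A B p) = tdom A B p" "Cod T (tclass A B p) = tcod A B p"
  using assms by (auto simp: tensor_def)

lemma Arr_tensorE:
  assumes "c \<in> Arr T"
  obtains p where "wf_arr A B p" "c = tclass A B p"
  using assms by (auto simp: Arr_tensor)

lemma tclass_Comp:
  assumes "wf_arr A B p" "wf_arr A B q" "tdom A B q = tcod A B p"
  shows "tclass A B q \<cdot>\<^bsub>T\<^esub> tclass A B p = tclass A B (q \<cdot>\<^sub>t p)"
  using assms by (auto simp: tensor_def intro!: tclass_eqI teq.comp teq.symm[OF teq_trep])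

lemma tclass_TenA:
  assumes "wf_arr A B p" "wf_arr A B q"
  shows "tclass A B p \<odot>\<^bsub>T\<^esub> tclass A B q = tclass A B (tten A B p q)"
  using assms
  by (auto simp: tensor_def tten_def intro!: tclass_eqI teq.comp teq.left teq.right teq.symm[OF teq_trep])

lemma tensor_homE:
  assumes "f \<in> hom T X Y"
  obtains p where "wf_arr A B p" "f = tclass A B p" "tdom A B p = X" "tcod A B p = Y"
  using assms by (auto simp: in_hom_iff elim!: Arr_tensorE)

lemma tensor_homI: "\<lbrakk>wf_arr A B p; tdom A B p = X; tcod A B p = Y\<rbrakk> \<Longrightarrow> tclass A B p \<in> hom T X Y"
  by (simp add: in_hom_iff)

lemma tensor_Comp_assoc:
  assumes "f \<in> hom T a b" "g \<in> hom T b c" "h \<in> hom T c d"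
  shows "(h \<cdot>\<^bsub>T\<^esub> g) \<cdot>\<^bsub>T\<^esub> f = h \<cdot>\<^bsub>T\<^esub> (g \<cdot>\<^bsub>T\<^esub> f)"
  using assms by (auto simp: tclass_Comp parallel_def elim!: tensor_homE del: equalityI intro!: tclass_gen tgen.comp_assoc)

lemma tensor_Comp_Ide:
  assumes "f \<in> hom T a b"
  shows "f \<cdot>\<^bsub>T\<^esub> tclass A B (TIde a) = f" "tclass A B (TIde b) \<cdot>\<^bsub>T\<^esub> f = f"
  using assms by (auto simp: tclass_Comp parallel_def elim!: tensor_homE del: equalityI
      intro!: tclass_gen tgen.comp_ide tgen.ide_comp)

text \<open>The tensor of two arrows is built from whiskerings; conversely, a whiskering is a tensor
  with an identity. This reconciles the relations, written with whiskerings, with the axioms,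
  written with \<open>\<odot>\<close>.\<close>

lemma tclass_tten_Ide:
  assumes "wf_arr A B p" "wf_obj A B X"
  shows "tclass A B (tten A B p (TIde X)) = tclass A B (p \<rhd>\<^sub>t X)"
    "tclass A B (tten A B (TIde X) p) = tclass A B (X \<lhd>\<^sub>t p)"
proof -
  have "tclass A B (tten A B p (TIde X)) = tclass A B (p \<rhd>\<^sub>t X) \<cdot>\<^bsub>T\<^esub> tclass A B (tdom A B p \<lhd>\<^sub>t TIde X)"
    using assms by (simp add: tten_def tclass_Comp)
  also have "tclass A B (tdom A B p \<lhd>\<^sub>t TIde X) = tclass A B (TIde (tdom A B p \<otimes>\<^sub>t X))"
    using assms by (intro tclass_gen tgen.left_ide) (simp add: parallel_def)
  finally show "tclass A B (tten A B p (TIde X)) = tclass A B (p \<rhd>\<^sub>t X)"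
    using assms tensor_Comp_Ide(1)[of "tclass A B (p \<rhd>\<^sub>t X)"] by (simp add: in_hom_iff)
  have "tclass A B (tten A B (TIde X) p) = tclass A B (TIde X \<rhd>\<^sub>t tcod A B p) \<cdot>\<^bsub>T\<^esub> tclass A B (X \<lhd>\<^sub>t p)"
    using assms by (simp add: tten_def tclass_Comp)
  also have "tclass A B (TIde X \<rhd>\<^sub>t tcod A B p) = tclass A B (TIde (X \<otimes>\<^sub>t tcod A B p))"
    using assms by (intro tclass_gen tgen.right_ide) (simp add: parallel_def)
  finally show "tclass A B (tten A B (TIde X) p) = tclass A B (X \<lhd>\<^sub>t p)"
    using assms tensor_Comp_Ide(2)[of "tclass A B (X \<lhd>\<^sub>t p)"] by (simp add: in_hom_iff)
qed

text \<open>Functoriality of the two whiskerings splits the left side into four arrows; the relation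
  \<open>left_right\<close> exchanges the middle two, and regrouping gives the right side.\<close>

lemma tensor_TenA_Comp:
  assumes f: "wf_arr A B f" "wf_arr A B f'" "tdom A B f' = tcod A B f"
    and g: "wf_arr A B g" "wf_arr A B g'" "tdom A B g' = tcod A B g"
  shows "tclass A B (tten A B (f' \<cdot>\<^sub>t f) (g' \<cdot>\<^sub>t g)) = tclass A B (tten A B f' g' \<cdot>\<^sub>t tten A B f g)"
proof -
  let ?c = "tclass A B" and ?d = "tdom A B f"
  note wf = f g
  have "?c (tten A B (f' \<cdot>\<^sub>t f) (g' \<cdot>\<^sub>t g)) = ?c ((f' \<cdot>\<^sub>t f) \<rhd>\<^sub>t tcod A B g') \<cdot>\<^bsub>T\<^esub> ?c (?d \<lhd>\<^sub>t (g' \<cdot>\<^sub>t g))"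
    using wf by (simp add: tten_def tclass_Comp)
  also have "?c ((f' \<cdot>\<^sub>t f) \<rhd>\<^sub>t tcod A B g') = ?c ((f' \<rhd>\<^sub>t tcod A B g') \<cdot>\<^sub>t (f \<rhd>\<^sub>t tcod A B g'))"
    using wf by (intro tclass_gen tgen.right_comp) (simp add: parallel_def)
  also have "?c (?d \<lhd>\<^sub>t (g' \<cdot>\<^sub>t g)) = ?c ((?d \<lhd>\<^sub>t g') \<cdot>\<^sub>t (?d \<lhd>\<^sub>t g))"
    using wf by (intro tclass_gen tgen.left_comp) (simp add: parallel_def)
  also have "?c ((f' \<rhd>\<^sub>t tcod A B g') \<cdot>\<^sub>t (f \<rhd>\<^sub>t tcod A B g')) \<cdot>\<^bsub>T\<^esub> ?c ((?d \<lhd>\<^sub>t g') \<cdot>\<^sub>t (?d \<lhd>\<^sub>t g))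
    = ?c (f' \<rhd>\<^sub>t tcod A B g') \<cdot>\<^bsub>T\<^esub> (?c (f \<rhd>\<^sub>t tcod A B g') \<cdot>\<^bsub>T\<^esub> (?c (?d \<lhd>\<^sub>t g') \<cdot>\<^bsub>T\<^esub> ?c (?d \<lhd>\<^sub>t g)))"
    using wf by (subst tensor_Comp_assoc[symmetric]) (auto simp: in_hom_iff tclass_Comp)
  also have "?c (f \<rhd>\<^sub>t tcod A B g') \<cdot>\<^bsub>T\<^esub> (?c (?d \<lhd>\<^sub>t g') \<cdot>\<^bsub>T\<^esub> ?c (?d \<lhd>\<^sub>t g))
    = ?c ((f \<rhd>\<^sub>t tcod A B g') \<cdot>\<^sub>t (?d \<lhd>\<^sub>t g')) \<cdot>\<^bsub>T\<^esub> ?c (?d \<lhd>\<^sub>t g)"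
    using wf by (subst tensor_Comp_assoc[symmetric]) (auto simp: in_hom_iff tclass_Comp)
  \<comment> \<open>The exchange: f acts on the left factor and g' on the right one.\<close>
  also have "?c ((f \<rhd>\<^sub>t tcod A B g') \<cdot>\<^sub>t (?d \<lhd>\<^sub>t g')) = ?c ((tcod A B f \<lhd>\<^sub>t g') \<cdot>\<^sub>t (f \<rhd>\<^sub>t tdom A B g'))"
    using wf by (intro tclass_gen tgen.left_right) (simp add: parallel_def)
  also have "?c (f' \<rhd>\<^sub>t tcod A B g') \<cdot>\<^bsub>T\<^esub> (?c ((tcod A B f \<lhd>\<^sub>t g') \<cdot>\<^sub>t (f \<rhd>\<^sub>t tdom A B g')) \<cdot>\<^bsub>T\<^esub> ?c (?d \<lhd>\<^sub>t g))
    = ?c (f' \<rhd>\<^sub>t tcod A B g') \<cdot>\<^bsub>T\<^esub> (?c (tcod A B f \<lhd>\<^sub>t g') \<cdot>\<^bsub>T\<^esub> (?c (f \<rhd>\<^sub>t tdom A B g') \<cdot>\<^bsub>T\<^esub> ?c (?d \<lhd>\<^sub>t g)))"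
    using wf by (subst tensor_Comp_assoc[symmetric]) (auto simp: in_hom_iff tclass_Comp)
  also have "\<dots> = (?c (f' \<rhd>\<^sub>t tcod A B g') \<cdot>\<^bsub>T\<^esub> ?c (tcod A B f \<lhd>\<^sub>t g')) \<cdot>\<^bsub>T\<^esub> (?c (f \<rhd>\<^sub>t tdom A B g') \<cdot>\<^bsub>T\<^esub> ?c (?d \<lhd>\<^sub>t g))"
    using wf by (subst tensor_Comp_assoc) (auto simp: in_hom_iff tclass_Comp)
  also have "\<dots> = ?c (tten A B f' g' \<cdot>\<^sub>t tten A B f g)"
    using wf by (simp add: tclass_Comp tten_def)
  finally show ?thesis .
qed

lemma inverses_tensor:
  assumes "wf_obj A B X" "wf_obj A B Y" "wf_obj A B Z"
  shows "inverses T (tclass A B (TAss X Y Z)) (tclass A B (TAssInv X Y Z))"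
    "inverses T (tclass A B (TRun X)) (tclass A B (TRunInv X))"
    "inverses T (tclass A B (TLun X)) (tclass A B (TLunInv X))"
  using assms by (auto simp: inverses_def in_hom_iff tclass_Comp tensor_structure parallel_def
      del: equalityI intro!: tclass_gen tgen.intros)

theorem sm_category_tensor: "sm_category T"
proof
  fix f g f' g' a a' a'' b b' b''
  assume "f \<in> hom T a a'" "f' \<in> hom T a' a''" "g \<in> hom T b b'" "g' \<in> hom T b' b''"
  then show "(f' \<cdot>\<^bsub>T\<^esub> f) \<odot>\<^bsub>T\<^esub> (g' \<cdot>\<^bsub>T\<^esub> g) = (f' \<odot>\<^bsub>T\<^esub> g') \<cdot>\<^bsub>T\<^esub> (f \<odot>\<^bsub>T\<^esub> g)"
    by (auto simp: tclass_Comp tclass_TenA tensor_TenA_Comp elim!: tensor_homE)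
next
  fix a b assume "a \<in> Obj T" "b \<in> Obj T"
  then show "Ide T a \<odot>\<^bsub>T\<^esub> Ide T b = Ide T (a \<otimes>\<^bsub>T\<^esub> b)"
    by (auto simp: tensor_structure tclass_TenA tclass_tten_Ide parallel_def del: equalityI intro!: tclass_gen tgen.intros)
qed (auto simp: tensor_structure tclass_Comp tclass_TenA tclass_tten_Ide parallel_def tensor_Comp_assoc
    tensor_Comp_Ide iso_def elim!: Arr_tensorE tensor_homE del: equalityI
    intro!: tclass_gen tgen.intros tensor_homI inverses_tensor)

end

section \<open>The functor \<eta>\<close>

lemma eta_at_simps [simp]:
  "b \<in> Obj B \<Longrightarrow> FO (eta_at A B a) b = TGen a b"
  "g \<in> Arr B \<Longrightarrow> FA (eta_at A B a) g = tclass A B (GenR a g)"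
  "F0 (eta_at A B a) = tclass A B (Beta a)"
  "\<lbrakk>b \<in> Obj B; b' \<in> Obj B\<rbrakk> \<Longrightarrow> F2 (eta_at A B a) b b' = tclass A B (Delta a b b')"
  "FO (eta_at A B a) \<in> extensional (Obj B)" "FA (eta_at A B a) \<in> extensional (Arr B)"
  "F2 (eta_at A B a) \<in> extensional (Obj B)" "b \<in> Obj B \<Longrightarrow> F2 (eta_at A B a) b \<in> extensional (Obj B)"
  by (simp_all add: eta_at_def)

lemma eta_simps [simp]:
  "a \<in> Obj A \<Longrightarrow> FO (eta A B) a = eta_at A B a"
  "f \<in> Arr A \<Longrightarrow> Src (FA (eta A B) f) = eta_at A B (Dom A f)"
  "f \<in> Arr A \<Longrightarrow> Tgt (FA (eta A B) f) = eta_at A B (Cod A f)"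
  "\<lbrakk>f \<in> Arr A; b \<in> Obj B\<rbrakk> \<Longrightarrow> Cpt (FA (eta A B) f) b = tclass A B (GenL f b)"
  "f \<in> Arr A \<Longrightarrow> Cpt (FA (eta A B) f) \<in> extensional (Obj B)"
  "Src (F0 (eta A B)) = unit_smf B (tensor A B)" "Tgt (F0 (eta A B)) = eta_at A B \<one>\<^bsub>A\<^esub>"
  "b \<in> Obj B \<Longrightarrow> Cpt (F0 (eta A B)) b = tclass A B (Alpha b)"
  "Cpt (F0 (eta A B)) \<in> extensional (Obj B)"
  "\<lbrakk>a \<in> Obj A; a' \<in> Obj A\<rbrakk> \<Longrightarrow> Src (F2 (eta A B) a a') = box_smf B (tensor A B) (eta_at A B a) (eta_at A B a')"
  "\<lbrakk>a \<in> Obj A; a' \<in> Obj A\<rbrakk> \<Longrightarrow> Tgt (F2 (eta A B) a a') = eta_at A B (a \<otimes>\<^bsub>A\<^esub> a')"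
  "\<lbrakk>a \<in> Obj A; a' \<in> Obj A; b \<in> Obj B\<rbrakk> \<Longrightarrow> Cpt (F2 (eta A B) a a') b = tclass A B (Gamma a a' b)"
  "\<lbrakk>a \<in> Obj A; a' \<in> Obj A\<rbrakk> \<Longrightarrow> Cpt (F2 (eta A B) a a') \<in> extensional (Obj B)"
  "FO (eta A B) \<in> extensional (Obj A)" "FA (eta A B) \<in> extensional (Arr A)"
  "F2 (eta A B) \<in> extensional (Obj A)" "a \<in> Obj A \<Longrightarrow> F2 (eta A B) a \<in> extensional (Obj A)"
  by (simp_all add: eta_def)

sublocale sm_category_pair \<subseteq> T: sm_category "tensor A B"
  by (rule sm_category_tensor)

context sm_category_pair
begin

lemma inv_arr_tensor:
  assumes "wf_obj A B X" "wf_obj A B Y" "wf_obj A B Z"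
  shows "inv_arr T (tclass A B (TAss X Y Z)) = tclass A B (TAssInv X Y Z)"
    "inv_arr T (tclass A B (TRun X)) = tclass A B (TRunInv X)"
    "inv_arr T (tclass A B (TLun X)) = tclass A B (TLunInv X)"
  using inverses_tensor[OF assms] T.inv_arr_eqI by auto

lemma interchange_tensor:
  assumes "wf_obj A B X" "wf_obj A B Y" "wf_obj A B Z" "wf_obj A B W"
  shows "interchange T X Y Z W = tclass A B (tinterchange X Y Z W)"
  using assms
  by (simp add: interchange_def tinterchange_def tensor_structure inv_arr_tensor tclass_TenA tclass_tten_Ide tclass_Comp)

lemma tinterchange_simps [simp]:
  "wf_arr A B (tinterchange X Y Z W) \<longleftrightarrow> wf_obj A B X \<and> wf_obj A B Y \<and> wf_obj A B Z \<and> wf_obj A B W"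
  "tdom A B (tinterchange X Y Z W) = (X \<otimes>\<^sub>t Y) \<otimes>\<^sub>t (Z \<otimes>\<^sub>t W)"
  "tcod A B (tinterchange X Y Z W) = (X \<otimes>\<^sub>t Z) \<otimes>\<^sub>t (Y \<otimes>\<^sub>t W)"
  by (auto simp: tinterchange_def)

text \<open>Up to writing whiskerings as tensors with identities, every axiom is one of the
  generating relations on \<open>GenR\<close>, \<open>Beta\<close> and \<open>Delta\<close>.\<close>

lemma sm_functor_eta_at:
  assumes [simp]: "a \<in> Obj A"
  shows "sm_functor B T (eta_at A B a)"
proof (rule sm_functorI)
  show "sm_category B" "sm_category T" by unfold_locales
qed (auto simp: tclass_Comp tclass_TenA tclass_tten_Ide tensor_structure parallel_def del: equalityI
    intro!: tclass_gen tgen.intros)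

lemma alpha_run:
  "tclass A B (Alpha (b \<otimes>\<^bsub>B\<^esub> b')) \<cdot>\<^bsub>T\<^esub> tclass A B (TRun TUnit)
    = tclass A B (Delta \<one>\<^bsub>A\<^esub> b b') \<cdot>\<^bsub>T\<^esub> (tclass A B (Alpha b) \<odot>\<^bsub>T\<^esub> tclass A B (Alpha b'))"
  if [simp]: "b \<in> Obj B" "b' \<in> Obj B"
  by (auto simp: tclass_Comp tclass_TenA parallel_def del: equalityI intro!: tclass_gen tgen.intros)

text \<open>Naturality, unit axiom and tensor axiom are the relations \<open>genR_alpha\<close>,
  \<open>alpha_beta\<close> and \<open>alpha_delta\<close>.\<close>

lemma sm_transformation_alpha: "sm_transformation B T (F0 (eta A B))"
proof (rule sm_transformationI)
  fix g assume [simp]: "g \<in> Arr B"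
  have "tclass A B (Alpha (Cod B g)) = tclass A B (GenR \<one>\<^bsub>A\<^esub> g) \<cdot>\<^bsub>T\<^esub> tclass A B (Alpha (Dom B g))"
    by (auto simp: tclass_Comp parallel_def del: equalityI intro!: tclass_gen[symmetric] tgen.intros)
  then show "Cpt (F0 (eta A B)) (Cod B g) \<cdot>\<^bsub>T\<^esub> FA (Src (F0 (eta A B))) g
      = FA (Tgt (F0 (eta A B))) g \<cdot>\<^bsub>T\<^esub> Cpt (F0 (eta A B)) (Dom B g)"
    by simp
next
  have "tclass A B (Alpha \<one>\<^bsub>B\<^esub>) = tclass A B (Beta \<one>\<^bsub>A\<^esub>)"
    by (auto simp: parallel_def del: equalityI intro!: tclass_gen[symmetric] tgen.intros)
  then show "Cpt (F0 (eta A B)) \<one>\<^bsub>B\<^esub> \<cdot>\<^bsub>T\<^esub> F0 (Src (F0 (eta A B))) = F0 (Tgt (F0 (eta A B)))"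
    by (simp del: tensor_sel(2)) (simp del: tensor_sel(2) flip: tensor_sel(2)[of A B])
next
  fix b b' assume [simp]: "b \<in> Obj B" "b' \<in> Obj B"
  show "Cpt (F0 (eta A B)) (b \<otimes>\<^bsub>B\<^esub> b') \<cdot>\<^bsub>T\<^esub> F2 (Src (F0 (eta A B))) b b'
    = F2 (Tgt (F0 (eta A B))) b b' \<cdot>\<^bsub>T\<^esub> (Cpt (F0 (eta A B)) b \<odot>\<^bsub>T\<^esub> Cpt (F0 (eta A B)) b')"
    by (simp add: tensor_structure alpha_run)
qed (auto intro: sm_functor_unit_smf sm_functor_eta_at A.sm_category_axioms B.sm_category_axioms T.sm_category_axioms)

lemma sm_transformation_genL:
  assumes [simp]: "f \<in> Arr A"
  shows "sm_transformation B T (FA (eta A B) f)"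
  by (rule sm_transformationI)
    (auto simp: tclass_Comp tclass_TenA parallel_def sm_functor_eta_at del: equalityI intro!: tclass_gen tgen.intros)

text \<open>The relations \<open>beta_gamma\<close> and \<open>gamma_delta\<close> have the
  canonical isomorphism on the side opposite to the one where \<open>box_smf\<close> has it.
  Composing with the inverse of \<open>run\<close>, respectively with an interchange in the other
  order, brings them into the form of the unit and tensor axioms.\<close>

lemma sm_transformation_gamma:
  assumes [simp]: "a \<in> Obj A" "a' \<in> Obj A"
  shows "sm_transformation B T (F2 (eta A B) a a')"
proof (rule sm_transformationI)
  have "tclass A B (Beta (a \<otimes>\<^bsub>A\<^esub> a')) \<cdot>\<^bsub>T\<^esub> run T \<one>\<^bsub>T\<^esub>
      = tclass A B (Gamma a a' \<one>\<^bsub>B\<^esub>) \<cdot>\<^bsub>T\<^esub> (tclass A B (Beta a) \<odot>\<^bsub>T\<^esub> tclass A B (Beta a'))"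
    by (auto simp: tclass_Comp tclass_TenA parallel_def tensor_structure del: equalityI intro!: tclass_gen tgen.intros)
  then have "(tclass A B (Beta (a \<otimes>\<^bsub>A\<^esub> a')) \<cdot>\<^bsub>T\<^esub> run T \<one>\<^bsub>T\<^esub>) \<cdot>\<^bsub>T\<^esub> inv_arr T (run T \<one>\<^bsub>T\<^esub>)
      = (tclass A B (Gamma a a' \<one>\<^bsub>B\<^esub>) \<cdot>\<^bsub>T\<^esub> (tclass A B (Beta a) \<odot>\<^bsub>T\<^esub> tclass A B (Beta a'))) \<cdot>\<^bsub>T\<^esub> inv_arr T (run T \<one>\<^bsub>T\<^esub>)"
    by simp
  then show "Cpt (F2 (eta A B) a a') \<one>\<^bsub>B\<^esub> \<cdot>\<^bsub>T\<^esub> F0 (Src (F2 (eta A B) a a')) = F0 (Tgt (F2 (eta A B) a a'))"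
    by simp
next
  fix b b' assume [simp]: "b \<in> Obj B" "b' \<in> Obj B"
  have "Cpt (F2 (eta A B) a a') (b \<otimes>\<^bsub>B\<^esub> b') \<cdot>\<^bsub>T\<^esub> (tclass A B (Delta a b b') \<odot>\<^bsub>T\<^esub> tclass A B (Delta a' b b'))
    = tclass A B (Delta (a \<otimes>\<^bsub>A\<^esub> a') b b') \<cdot>\<^bsub>T\<^esub> (tclass A B (Gamma a a' b) \<odot>\<^bsub>T\<^esub> tclass A B (Gamma a a' b'))
      \<cdot>\<^bsub>T\<^esub> interchange T (TGen a b) (TGen a b') (TGen a' b) (TGen a' b')"
    by (auto simp: tclass_Comp tclass_TenA interchange_tensor parallel_def del: equalityI intro!: tclass_gen tgen.intros)
  then have "(Cpt (F2 (eta A B) a a') (b \<otimes>\<^bsub>B\<^esub> b') \<cdot>\<^bsub>T\<^esub> (tclass A B (Delta a b b') \<odot>\<^bsub>T\<^esub> tclass A B (Delta a' b b')))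
      \<cdot>\<^bsub>T\<^esub> interchange T (TGen a b) (TGen a' b) (TGen a b') (TGen a' b')
    = tclass A B (Delta (a \<otimes>\<^bsub>A\<^esub> a') b b') \<cdot>\<^bsub>T\<^esub> (tclass A B (Gamma a a' b) \<odot>\<^bsub>T\<^esub> tclass A B (Gamma a a' b'))
      \<cdot>\<^bsub>T\<^esub> (interchange T (TGen a b) (TGen a b') (TGen a' b) (TGen a' b')
      \<cdot>\<^bsub>T\<^esub> interchange T (TGen a b) (TGen a' b) (TGen a b') (TGen a' b'))"
    by simp
  then show "Cpt (F2 (eta A B) a a') (b \<otimes>\<^bsub>B\<^esub> b') \<cdot>\<^bsub>T\<^esub> F2 (Src (F2 (eta A B) a a')) b b'
    = F2 (Tgt (F2 (eta A B) a a')) b b' \<cdot>\<^bsub>T\<^esub> (Cpt (F2 (eta A B) a a') b \<odot>\<^bsub>T\<^esub> Cpt (F2 (eta A B) a a') b')"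
    by (simp add: T.interchange_involution)
next
  fix g assume [simp]: "g \<in> Arr B"
  show "Cpt (F2 (eta A B) a a') (Cod B g) \<cdot>\<^bsub>T\<^esub> FA (Src (F2 (eta A B) a a')) g
    = FA (Tgt (F2 (eta A B) a a')) g \<cdot>\<^bsub>T\<^esub> Cpt (F2 (eta A B) a a') (Dom B g)"
    by (auto simp: tclass_Comp tclass_TenA parallel_def del: equalityI intro!: tclass_gen[symmetric] tgen.intros)
qed (auto simp: sm_functor_eta_at sm_functor_box_smf tclass_Comp tclass_TenA parallel_def
    del: equalityI intro!: tclass_gen tgen.intros)

text \<open>The axioms are equations between transformations; their components at b are the
  relations \<open>genL_ide\<close>, \<open>genL_comp\<close> and those of the \<open>gamma_\<close>
  group that involve a single b.\<close>

theorem sm_functor_eta: "sm_functor A (ihom B T) (eta A B)"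
proof (rule sm_functorI)
  show "sm_category A" "sm_category (ihom B T)"
    by (auto intro: sm_category_ihom A.sm_category_axioms B.sm_category_axioms T.sm_category_axioms)
qed (auto simp: tclass_Comp tclass_TenA tclass_tten_Ide tensor_structure parallel_def
    sm_functor_eta_at sm_transformation_genL sm_transformation_alpha sm_transformation_gamma del: equalityI
    intro!: smt_eqI[where A = B] tclass_gen tgen.intros)

end

section \<open>The functors \<open>En\<close> and \<open>Rn\<close>\<close>

lemma en_simps [simp]:
  "wf_obj A B X \<Longrightarrow> FO (en A B C F) X = en_obj C F X"
  "F0 (en A B C F) = Ide C \<one>\<^bsub>C\<^esub>"
  "\<lbrakk>wf_obj A B X; wf_obj A B Y\<rbrakk> \<Longrightarrow> F2 (en A B C F) X Y = Ide C (en_obj C F X \<otimes>\<^bsub>C\<^esub> en_obj C F Y)"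
  by (simp_all add: en_def)

lemma en_ext:
  "FO (en A B C F) \<in> extensional (Obj (tensor A B))" "FA (en A B C F) \<in> extensional (Arr (tensor A B))"
  "F2 (en A B C F) \<in> extensional (Obj (tensor A B))"
  "X \<in> Obj (tensor A B) \<Longrightarrow> F2 (en A B C F) X \<in> extensional (Obj (tensor A B))"
  by (simp_all add: en_def del: tensor_sel)

text \<open>A functor into the internal hom, viewed as a functor of two variables. The rules below
  type the components of its values, so that interpretations of formal arrows can be composed by
  rewriting.\<close>

locale sm_bifunctor = sm_category_pair A B + C: sm_category C + F: sm_functor A "ihom B C" F
  for A :: "('oa, 'ma) smc" and B :: "('ob, 'mb) smc" and C :: "('oc, 'mc) smc"
    and F :: "('oa, 'ma, ('ob, 'mb, 'oc, 'mc) smf, ('ob, 'mb, 'oc, 'mc) smt) smf"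
begin

lemma sm_functor_FO: "a \<in> Obj A \<Longrightarrow> sm_functor B C (FO F a)"
  using F.FO_in by simp

lemma sm_transformation_FA:
  assumes "f \<in> Arr A"
  shows "sm_transformation B C (FA F f)" "Src (FA F f) = FO F (Dom A f)" "Tgt (FA F f) = FO F (Cod A f)"
  using F.FA_simps[OF assms] by simp_all

lemma sm_transformation_F0:
  "sm_transformation B C (F0 F)" "Src (F0 F) = unit_smf B C" "Tgt (F0 F) = FO F \<one>\<^bsub>A\<^esub>"
  using F.F0_simps by simp_all

lemma sm_transformation_F2:
  assumes "a \<in> Obj A" "a' \<in> Obj A"
  shows "sm_transformation B C (F2 F a a')" "Src (F2 F a a') = box_smf B C (FO F a) (FO F a')"
    "Tgt (F2 F a a') = FO F (a \<otimes>\<^bsub>A\<^esub> a')"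
  using F.F2_simps[OF assms] by simp_all

lemma FO_FO_in [simp]: "a \<in> Obj A \<Longrightarrow> b \<in> Obj B \<Longrightarrow> FO (FO F a) b \<in> Obj C"
  using sm_functor_FO by (rule sm_functor.FO_in)

lemma FA_FO_simps [simp]:
  assumes "a \<in> Obj A" "g \<in> Arr B"
  shows "FA (FO F a) g \<in> Arr C" "Dom C (FA (FO F a) g) = FO (FO F a) (Dom B g)"
    "Cod C (FA (FO F a) g) = FO (FO F a) (Cod B g)"
  using sm_functor.FA_simps[OF sm_functor_FO] assms by auto

lemma F0_FO_simps [simp]:
  assumes "a \<in> Obj A"
  shows "F0 (FO F a) \<in> Arr C" "Dom C (F0 (FO F a)) = \<one>\<^bsub>C\<^esub>" "Cod C (F0 (FO F a)) = FO (FO F a) \<one>\<^bsub>B\<^esub>"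
  using sm_functor.F0_simps[OF sm_functor_FO] assms by auto

lemma F2_FO_simps [simp]:
  assumes "a \<in> Obj A" "b \<in> Obj B" "b' \<in> Obj B"
  shows "F2 (FO F a) b b' \<in> Arr C" "Dom C (F2 (FO F a) b b') = FO (FO F a) b \<otimes>\<^bsub>C\<^esub> FO (FO F a) b'"
    "Cod C (F2 (FO F a) b b') = FO (FO F a) (b \<otimes>\<^bsub>B\<^esub> b')"
  using sm_functor.F2_simps[OF sm_functor_FO] assms by auto

lemma Cpt_FA_simps [simp]:
  assumes "f \<in> Arr A" "b \<in> Obj B"
  shows "Cpt (FA F f) b \<in> Arr C" "Dom C (Cpt (FA F f) b) = FO (FO F (Dom A f)) b"
    "Cod C (Cpt (FA F f) b) = FO (FO F (Cod A f)) b"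
  using sm_transformation.Cpt_simps[OF sm_transformation_FA(1)] assms sm_transformation_FA[OF assms(1)] by auto

lemma Cpt_F0_simps [simp]:
  assumes "b \<in> Obj B"
  shows "Cpt (F0 F) b \<in> Arr C" "Dom C (Cpt (F0 F) b) = \<one>\<^bsub>C\<^esub>" "Cod C (Cpt (F0 F) b) = FO (FO F \<one>\<^bsub>A\<^esub>) b"
  using sm_transformation.Cpt_simps[OF sm_transformation_F0(1)] assms sm_transformation_F0 by auto

lemma Cpt_F2_simps [simp]:
  assumes "a \<in> Obj A" "a' \<in> Obj A" "b \<in> Obj B"
  shows "Cpt (F2 F a a') b \<in> Arr C" "Dom C (Cpt (F2 F a a') b) = FO (FO F a) b \<otimes>\<^bsub>C\<^esub> FO (FO F a') b"
    "Cod C (Cpt (F2 F a a') b) = FO (FO F (a \<otimes>\<^bsub>A\<^esub> a')) b"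
  using sm_transformation.Cpt_simps[OF sm_transformation_F2(1)] assms sm_transformation_F2[OF assms(1,2)] by auto

lemma en_obj_in [simp]: "wf_obj A B X \<Longrightarrow> en_obj C F X \<in> Obj C"
  by (induction X) auto

lemma en_arr_simps [simp]:
  assumes "wf_arr A B p"
  shows "en_arr C F p \<in> Arr C" "Dom C (en_arr C F p) = en_obj C F (tdom A B p)"
    "Cod C (en_arr C F p) = en_obj C F (tcod A B p)"
proof -
  have "en_arr C F p \<in> Arr C \<and> Dom C (en_arr C F p) = en_obj C F (tdom A B p) \<and> Cod C (en_arr C F p) = en_obj C F (tcod A B p)"
    using assms by (induction p) auto
  then show "en_arr C F p \<in> Arr C" "Dom C (en_arr C F p) = en_obj C F (tdom A B p)"
    "Cod C (en_arr C F p) = en_obj C F (tcod A B p)" by auto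
qed

lemma en_arr_tten [simp]:
  "wf_arr A B p \<Longrightarrow> wf_arr A B q \<Longrightarrow> en_arr C F (tten A B p q) = en_arr C F p \<odot>\<^bsub>C\<^esub> en_arr C F q"
  by (simp add: tten_def C.TenA_merge)

lemma en_arr_tinterchange [simp]:
  "en_arr C F (tinterchange X Y Z W) = interchange C (en_obj C F X) (en_obj C F Y) (en_obj C F Z) (en_obj C F W)"
  by (simp add: tinterchange_def interchange_def)

text \<open>Soundness of the interpretation. Relations on \<open>GenR\<close> and
  \<open>Delta\<close> alone become axioms of the functor \<open>FO F a\<close>, those on
  \<open>GenL\<close> and \<open>Gamma\<close> alone become axioms of F, and the mixed ones say that
  \<open>FA F f\<close>, \<open>F0 F\<close> and \<open>F2 F a a'\<close> are monoidal
  transformations.\<close>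

lemma en_arr_tgen:
  assumes "tgen A B p q" "parallel A B p q"
  shows "en_arr C F p = en_arr C F q"
  using assms
proof cases
  case (ass_nat p q r)
  with assms show ?thesis by (simp add: parallel_def C.ass_nat)
next
  case (run_nat p)
  with assms show ?thesis by (simp add: parallel_def C.run_nat)
next
  case (lun_nat p)
  with assms show ?thesis by (simp add: parallel_def C.lun_nat)
next
  case (sym_nat p q)
  with assms show ?thesis by (simp add: parallel_def C.braid_nat)
next
  case (genR_ide a b)
  then interpret a: sm_functor B C "FO F a" using assms sm_functor_FO by (simp add: parallel_def)
  show ?thesis using genR_ide assms by (simp add: parallel_def)
next
  case (genR_comp a h g)
  then interpret a: sm_functor B C "FO F a" using assms sm_functor_FO by (simp add: parallel_def)
  show ?thesis using genR_comp assms by (simp add: parallel_def)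
next
  case (delta_nat a g h)
  then interpret a: sm_functor B C "FO F a" using assms sm_functor_FO by (simp add: parallel_def)
  show ?thesis using delta_nat assms a.F2_nat[of g h] by (simp add: parallel_def)
next
  case (delta_ass a b b' b'')
  then interpret a: sm_functor B C "FO F a" using assms sm_functor_FO by (simp add: parallel_def)
  show ?thesis using delta_ass assms a.F2_ass by (simp add: parallel_def)
next
  case (delta_run a b)
  then interpret a: sm_functor B C "FO F a" using assms sm_functor_FO by (simp add: parallel_def)
  show ?thesis using delta_run assms a.F2_run by (simp add: parallel_def)
next
  case (delta_lun a b)
  then interpret a: sm_functor B C "FO F a" using assms sm_functor_FO by (simp add: parallel_def)
  show ?thesis using delta_lun assms a.F2_lun by (simp add: parallel_def)
next
  case (delta_sym a b b')
  then interpret a: sm_functor B C "FO F a" using assms sm_functor_FO by (simp add: parallel_def)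
  show ?thesis using delta_sym assms a.F2_sym by (simp add: parallel_def)
next
  case (genL_ide a b)
  with assms show ?thesis by (simp add: parallel_def)
next
  case (genL_comp h f b)
  with assms show ?thesis by (simp add: parallel_def)
next
  \<comment> \<open>The axioms of F are equations between transformations in the internal hom; the
    relation is their component at b.\<close>
  case (gamma_nat f h b)
  with assms show ?thesis
    using arg_cong[OF F.F2_nat[of f h], of "Cod A f" "Cod A h" "\<lambda>\<sigma>. Cpt \<sigma> b"] by (simp add: parallel_def)
next
  case (gamma_ass a a' a'' b)
  with assms show ?thesis
    using arg_cong[OF F.F2_ass[of a a' a''], of "\<lambda>\<sigma>. Cpt \<sigma> b"] by (simp add: parallel_def)
next
  case (gamma_run a b)
  with assms show ?thesis
    using arg_cong[OF F.F2_run[of a], of "\<lambda>\<sigma>. Cpt \<sigma> b"] by (simp add: parallel_def)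
next
  case (gamma_lun a b)
  with assms show ?thesis
    using arg_cong[OF F.F2_lun[of a], of "\<lambda>\<sigma>. Cpt \<sigma> b"] by (simp add: parallel_def)
next
  case (gamma_sym a a' b)
  with assms show ?thesis
    using arg_cong[OF F.F2_sym[of a a'], of "\<lambda>\<sigma>. Cpt \<sigma> b"] by (simp add: parallel_def)
next
  case (genL_genR f g)
  with assms show ?thesis
    using sm_transformation.Cpt_nat[OF sm_transformation_FA(1), of f g] sm_transformation_FA[of f] by (simp add: parallel_def)
next
  case (genL_beta f)
  with assms show ?thesis
    using sm_transformation.Cpt_unit[OF sm_transformation_FA(1), of f] sm_transformation_FA[of f] by (simp add: parallel_def)
next
  case (genL_delta f b b')
  with assms show ?thesis
    using sm_transformation.Cpt_tensor[OF sm_transformation_FA(1), of f b b'] sm_transformation_FA[of f] by (simp add: parallel_def)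
next
  case (genR_alpha g)
  with assms show ?thesis
    using sm_transformation.Cpt_nat[OF sm_transformation_F0(1), of g] sm_transformation_F0 by (simp add: parallel_def)
next
  case (genR_gamma a a' g)
  with assms show ?thesis
    using sm_transformation.Cpt_nat[OF sm_transformation_F2(1), of a a' g] sm_transformation_F2[of a a'] by (simp add: parallel_def)
next
  case (alpha_delta b b')
  with assms show ?thesis
    using sm_transformation.Cpt_tensor[OF sm_transformation_F0(1), of b b'] sm_transformation_F0 by (simp add: parallel_def)
next
  case (beta_gamma a a')
  let ?r = "run C \<one>\<^bsub>C\<^esub>"
  \<comment> \<open>The unit comparison of a pointwise tensor contains the inverse of
    \<open>run\<close>; composing with \<open>run\<close> brings the unit axiom into the form of the
    relation.\<close>
  have "F0 (FO F (a \<otimes>\<^bsub>A\<^esub> a')) \<cdot>\<^bsub>C\<^esub> ?r = (Cpt (F2 F a a') \<one>\<^bsub>B\<^esub> \<cdot>\<^bsub>C\<^esub> (F0 (FO F a) \<odot>\<^bsub>C\<^esub> F0 (FO F a')) \<cdot>\<^bsub>C\<^esub> inv_arr C ?r) \<cdot>\<^bsub>C\<^esub> ?r"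
    using beta_gamma assms sm_transformation.Cpt_unit[OF sm_transformation_F2(1), of a a'] sm_transformation_F2[of a a']
    by (simp add: parallel_def)
  then show ?thesis using beta_gamma assms by (simp add: parallel_def)
next
  case alpha_beta
  with assms show ?thesis
    using sm_transformation.Cpt_unit[OF sm_transformation_F0(1)] sm_transformation_F0 by (simp add: parallel_def)
next
  case (gamma_delta a a' b b')
  then have w [simp]: "a \<in> Obj A" "a' \<in> Obj A" "b \<in> Obj B" "b' \<in> Obj B" using assms by (auto simp: parallel_def)
  let ?I = "interchange C (FO (FO F a) b) (FO (FO F a) b') (FO (FO F a') b) (FO (FO F a') b')"
  let ?J = "interchange C (FO (FO F a) b) (FO (FO F a') b) (FO (FO F a) b') (FO (FO F a') b')"
  \<comment> \<open>Inserting ?J followed after ?I, which is an identity, produces the comparison of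
    the pointwise tensor, the source of \<open>F2 F a a'\<close>.\<close>
  have "Cpt (F2 F a a') (b \<otimes>\<^bsub>B\<^esub> b') \<cdot>\<^bsub>C\<^esub> (F2 (FO F a) b b' \<odot>\<^bsub>C\<^esub> F2 (FO F a') b b')
    = (Cpt (F2 F a a') (b \<otimes>\<^bsub>B\<^esub> b') \<cdot>\<^bsub>C\<^esub> (F2 (FO F a) b b' \<odot>\<^bsub>C\<^esub> F2 (FO F a') b b') \<cdot>\<^bsub>C\<^esub> ?J) \<cdot>\<^bsub>C\<^esub> ?I"
    by (simp add: C.interchange_involution)
  also have "\<dots> = F2 (FO F (a \<otimes>\<^bsub>A\<^esub> a')) b b' \<cdot>\<^bsub>C\<^esub> (Cpt (F2 F a a') b \<odot>\<^bsub>C\<^esub> Cpt (F2 F a a') b') \<cdot>\<^bsub>C\<^esub> ?I"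
    using sm_transformation.Cpt_tensor[OF sm_transformation_F2(1), of a a' b b'] sm_transformation_F2[of a a'] by simp
  finally show ?thesis using gamma_delta by simp
next
  case (comp_ide X)
  have "wf_arr A B (q \<cdot>\<^sub>t TIde X)" using assms(2) unfolding parallel_def comp_ide by (rule conjunct1)
  then have "wf_arr A B q" "tdom A B q = X" by simp_all
  then show ?thesis unfolding comp_ide by simp
next
  case (ide_comp X)
  have "wf_arr A B (TIde X \<cdot>\<^sub>t q)" using assms(2) unfolding parallel_def ide_comp by (rule conjunct1)
  then have "wf_arr A B q" "tcod A B q = X" by simp_all
  then show ?thesis unfolding ide_comp by simp
qed (use assms in \<open>simp_all add: parallel_def C.TenA_merge C.sym_sym C.pentagon C.triangle C.hexagon C.unit_sym[symmetric]\<close>)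

lemma en_arr_teq: "teq A B p q \<Longrightarrow> en_arr C F p = en_arr C F q"
  by (induction rule: teq.induct) (auto intro: en_arr_tgen)

lemma FA_en [simp]: "wf_arr A B p \<Longrightarrow> FA (en A B C F) (tclass A B p) = en_arr C F p"
  by (simp add: en_def en_arr_teq[OF teq.symm[OF teq_trep]])

theorem sm_functor_en: "sm_functor T C (en A B C F)"
proof (rule sm_functorI)
  show "sm_category T" "sm_category C" by unfold_locales
qed (auto simp: tclass_Comp tclass_TenA tensor_structure en_ext[unfolded tensor_sel] C.run_Unit elim!: Arr_tensorE)

end

section \<open>The action of En on 2-cells\<close>

lemma en2_simps [simp]:
  "Src (en2 A B C \<sigma>) = en A B C (Src \<sigma>)" "Tgt (en2 A B C \<sigma>) = en A B C (Tgt \<sigma>)"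
  "wf_obj A B X \<Longrightarrow> Cpt (en2 A B C \<sigma>) X = en2_cpt C \<sigma> X"
  by (simp_all add: en2_def)

lemma en2_ext: "Cpt (en2 A B C \<sigma>) \<in> extensional (Obj (tensor A B))"
  by (simp add: en2_def del: tensor_sel)

locale sm_category_triple = sm_category_pair A B + C: sm_category C
  for A :: "('oa, 'ma) smc" and B :: "('ob, 'mb) smc" and C :: "('oc, 'mc) smc"
begin

lemma sm_bifunctorI: "sm_functor A (ihom B C) F \<Longrightarrow> sm_bifunctor A B C F"
  by (intro sm_bifunctor.intro sm_category_pair_axioms C.sm_category_axioms)

lemma sm_functor_en: "sm_functor A (ihom B C) F \<Longrightarrow> sm_functor T C (en A B C F)"
  by (rule sm_bifunctor.sm_functor_en) (rule sm_bifunctorI)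

text \<open>Naturality is proved by induction on arrow terms. For \<open>Alpha\<close>,
  \<open>Gamma\<close> and \<open>GenL\<close> it is a component at b of an axiom of \<sigma>; for
  \<open>Beta\<close>, \<open>Delta\<close> and \<open>GenR\<close> it is an axiom of the
  transformation \<open>Cpt \<sigma> a\<close>. Unit and tensor axioms are immediate, as both ends
  are strict.\<close>

lemma sm_transformation_en2:
  assumes "sm_transformation A (ihom B C) \<sigma>"
  shows "sm_transformation T C (en2 A B C \<sigma>)"
proof -
  interpret s: sm_transformation A "ihom B C" \<sigma> by fact
  interpret F: sm_bifunctor A B C "Src \<sigma>" by (rule sm_bifunctorI) unfold_locales
  interpret G: sm_bifunctor A B C "Tgt \<sigma>" by (rule sm_bifunctorI) unfold_locales
  have sa: "sm_transformation B C (Cpt \<sigma> a)" and [simp]: "Src (Cpt \<sigma> a) = FO (Src \<sigma>) a" "Tgt (Cpt \<sigma> a) = FO (Tgt \<sigma>) a"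
    if "a \<in> Obj A" for a
    using s.Cpt_simps[OF that] by simp_all
  have [simp]: "Cpt (Cpt \<sigma> a) b \<in> Arr C" "Dom C (Cpt (Cpt \<sigma> a) b) = FO (FO (Src \<sigma>) a) b"
    "Cod C (Cpt (Cpt \<sigma> a) b) = FO (FO (Tgt \<sigma>) a) b" if "a \<in> Obj A" "b \<in> Obj B" for a b
    using sm_transformation.Cpt_simps[OF sa[OF that(1)] that(2)] that by simp_all
  have c: "en2_cpt C \<sigma> X \<in> Arr C \<and> Dom C (en2_cpt C \<sigma> X) = en_obj C (Src \<sigma>) X \<and> Cod C (en2_cpt C \<sigma> X) = en_obj C (Tgt \<sigma>) X"
    if "wf_obj A B X" for X
    using that by (induction X) auto
  then have [simp]: "en2_cpt C \<sigma> X \<in> Arr C" "Dom C (en2_cpt C \<sigma> X) = en_obj C (Src \<sigma>) X"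
    "Cod C (en2_cpt C \<sigma> X) = en_obj C (Tgt \<sigma>) X" if "wf_obj A B X" for X
    using that by auto
  have nat: "en2_cpt C \<sigma> (tcod A B p) \<cdot>\<^bsub>C\<^esub> en_arr C (Src \<sigma>) p = en_arr C (Tgt \<sigma>) p \<cdot>\<^bsub>C\<^esub> en2_cpt C \<sigma> (tdom A B p)"
    if "wf_arr A B p" for p
    using that
  proof (induction p)
    case (TComp q p)
    have "en2_cpt C \<sigma> (tcod A B (q \<cdot>\<^sub>t p)) \<cdot>\<^bsub>C\<^esub> en_arr C (Src \<sigma>) (q \<cdot>\<^sub>t p)
      = (en2_cpt C \<sigma> (tcod A B q) \<cdot>\<^bsub>C\<^esub> en_arr C (Src \<sigma>) q) \<cdot>\<^bsub>C\<^esub> en_arr C (Src \<sigma>) p"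
      using TComp.prems by simp
    also have "\<dots> = en_arr C (Tgt \<sigma>) q \<cdot>\<^bsub>C\<^esub> (en2_cpt C \<sigma> (tcod A B p) \<cdot>\<^bsub>C\<^esub> en_arr C (Src \<sigma>) p)"
      using TComp by simp
    also have "\<dots> = en_arr C (Tgt \<sigma>) (q \<cdot>\<^sub>t p) \<cdot>\<^bsub>C\<^esub> en2_cpt C \<sigma> (tdom A B (q \<cdot>\<^sub>t p))"
      using TComp by simp
    finally show ?case .
  next
    case (TAssInv X Y Z)
    then show ?case by (simp add: C.ass_inv_nat)
  next
    case (TRunInv X)
    then show ?case by (simp add: C.run_inv_nat)
  next
    case (TLunInv X)
    then show ?case using C.naturality_inv[OF _ _ C.lun_nat[of "en2_cpt C \<sigma> X"]] by simp
  next
    case (Alpha b)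
    then show ?case using arg_cong[OF s.Cpt_unit, of "\<lambda>\<tau>. Cpt \<tau> b"] by simp
  next
    case (Beta a)
    then show ?case using sm_transformation.Cpt_unit[OF sa[of a]] by simp
  next
    case (Gamma a a' b)
    then show ?case using arg_cong[OF s.Cpt_tensor[of a a'], of "\<lambda>\<tau>. Cpt \<tau> b"] by simp
  next
    case (Delta a b b')
    then show ?case using sm_transformation.Cpt_tensor[OF sa[of a], of b b'] by simp
  next
    case (GenR a g)
    then show ?case using sm_transformation.Cpt_nat[OF sa[of a], of g] by simp
  next
    case (GenL f b)
    then show ?case using arg_cong[OF s.Cpt_nat[of f], of "\<lambda>\<tau>. Cpt \<tau> b"] by simp
  qed (simp_all add: C.TenA_merge C.ass_nat C.run_nat C.lun_nat C.braid_nat)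
  show ?thesis
    by (rule sm_transformationI)
      (auto simp: F.sm_functor_en G.sm_functor_en en2_ext[unfolded tensor_sel] nat elim!: Arr_tensorE)
qed

text \<open>The object map of \<open>Rn\<close> with its domain restriction stripped, so that it
  unfolds without a side condition.\<close>

abbreviation rn where
  "rn F \<equiv> comp_smf A (ihom B C) (ihom_map B T C F) (eta A B)"

lemma sm_functor_rn:
  assumes "sm_functor T C F"
  shows "sm_functor A (ihom B C) (rn F)"
  by (rule sm_functor_comp_smf[OF sm_functor_eta sm_functor_ihom_map[OF B.sm_category_axioms assms]])

declare sm_functor_eta_at [simp] sm_transformation_alpha [simp] sm_transformation_genL [simp]
  sm_transformation_gamma [simp]

end

section \<open>The counit\<close>

lemma eps_simps [simp]:
  "Src (eps A B C F) = en A B C (FO (Rn A B C) F)" "Tgt (eps A B C F) = F"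
  "wf_obj A B X \<Longrightarrow> Cpt (eps A B C F) X = eps_cpt C F X"
  by (simp_all add: eps_def)

lemma eps_ext: "Cpt (eps A B C F) \<in> extensional (Obj (tensor A B))"
  by (simp add: eps_def del: tensor_sel)

lemma FO_Rn [simp]:
  "sm_functor (tensor A B) C F \<Longrightarrow> FO (Rn A B C) F = comp_smf A (ihom B C) (ihom_map B (tensor A B) C F) (eta A B)"
  by (simp add: Rn_def Let_def)

context sm_category_triple
begin

text \<open>Naturality goes by induction on arrow terms. Structural arrows use the lax axioms of F,
  whiskerings the naturality of its comparison. On a generating arrow the transpose is, by
  construction, the image under F preceded by the comparison of F that the counit supplies.\<close>

lemma sm_transformation_eps:
  assumes F: "sm_functor T C F"
  shows "sm_transformation T C (eps A B C F)"
proof -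
  interpret F: sm_functor T C F by fact
  interpret R: sm_bifunctor A B C "rn F" by (intro sm_bifunctorI sm_functor_rn F)
  let ?e = "eps_cpt C F" and ?n = "en_arr C (rn F)" and ?c = "tclass A B"
  have c: "?e X \<in> Arr C \<and> Dom C (?e X) = en_obj C (rn F) X \<and> Cod C (?e X) = FO F X"
    if "wf_obj A B X" for X
    using that by (induction X) auto
  then have [simp]: "?e X \<in> Arr C" "Dom C (?e X) = en_obj C (rn F) X" "Cod C (?e X) = FO F X" if "wf_obj A B X" for X
    using that by auto
  have ass: "?e ((X \<otimes>\<^sub>t Y) \<otimes>\<^sub>t Z) \<cdot>\<^bsub>C\<^esub> ?n (TAss X Y Z) = FA F (?c (TAss X Y Z)) \<cdot>\<^bsub>C\<^esub> ?e (X \<otimes>\<^sub>t (Y \<otimes>\<^sub>t Z))"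
    if [simp]: "wf_obj A B X" "wf_obj A B Y" "wf_obj A B Z" for X Y Z
  proof -
    have "?e ((X \<otimes>\<^sub>t Y) \<otimes>\<^sub>t Z) \<cdot>\<^bsub>C\<^esub> ?n (TAss X Y Z)
      = F2 F (X \<otimes>\<^sub>t Y) Z \<cdot>\<^bsub>C\<^esub> (F2 F X Y \<odot>\<^bsub>C\<^esub> Ide C (FO F Z)) \<cdot>\<^bsub>C\<^esub> (((?e X \<odot>\<^bsub>C\<^esub> ?e Y) \<odot>\<^bsub>C\<^esub> ?e Z)
        \<cdot>\<^bsub>C\<^esub> ass C (en_obj C (rn F) X) (en_obj C (rn F) Y) (en_obj C (rn F) Z))"
      by (simp add: C.TenA_merge')
    also have "\<dots> = (F2 F (X \<otimes>\<^sub>t Y) Z \<cdot>\<^bsub>C\<^esub> (F2 F X Y \<odot>\<^bsub>C\<^esub> Ide C (FO F Z)) \<cdot>\<^bsub>C\<^esub> ass C (FO F X) (FO F Y) (FO F Z))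
      \<cdot>\<^bsub>C\<^esub> (?e X \<odot>\<^bsub>C\<^esub> (?e Y \<odot>\<^bsub>C\<^esub> ?e Z))"
      using C.ass_nat[of "?e X" "?e Y" "?e Z"] by simp
    also have "\<dots> = FA F (?c (TAss X Y Z)) \<cdot>\<^bsub>C\<^esub> ?e (X \<otimes>\<^sub>t (Y \<otimes>\<^sub>t Z))"
      using F.F2_ass[of X Y Z] by (simp add: tensor_structure C.TenA_merge)
    finally show ?thesis .
  qed
  have run: "?e X \<cdot>\<^bsub>C\<^esub> ?n (TRun X) = FA F (?c (TRun X)) \<cdot>\<^bsub>C\<^esub> ?e (X \<otimes>\<^sub>t TUnit)" if [simp]: "wf_obj A B X" for X
  proof -
    have "FA F (?c (TRun X)) \<cdot>\<^bsub>C\<^esub> ?e (X \<otimes>\<^sub>t TUnit)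
      = (FA F (?c (TRun X)) \<cdot>\<^bsub>C\<^esub> F2 F X TUnit \<cdot>\<^bsub>C\<^esub> (Ide C (FO F X) \<odot>\<^bsub>C\<^esub> F0 F)) \<cdot>\<^bsub>C\<^esub> (?e X \<odot>\<^bsub>C\<^esub> Ide C \<one>\<^bsub>C\<^esub>)"
      by (simp add: C.TenA_merge)
    also have "\<dots> = ?e X \<cdot>\<^bsub>C\<^esub> ?n (TRun X)"
      using F.F2_run[of X] by (simp add: tensor_structure C.run_nat)
    finally show ?thesis by simp
  qed
  have lun: "?e X \<cdot>\<^bsub>C\<^esub> ?n (TLun X) = FA F (?c (TLun X)) \<cdot>\<^bsub>C\<^esub> ?e (TUnit \<otimes>\<^sub>t X)" if [simp]: "wf_obj A B X" for X
  proof -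
    have "FA F (?c (TLun X)) \<cdot>\<^bsub>C\<^esub> ?e (TUnit \<otimes>\<^sub>t X)
      = (FA F (?c (TLun X)) \<cdot>\<^bsub>C\<^esub> F2 F TUnit X \<cdot>\<^bsub>C\<^esub> (F0 F \<odot>\<^bsub>C\<^esub> Ide C (FO F X))) \<cdot>\<^bsub>C\<^esub> (Ide C \<one>\<^bsub>C\<^esub> \<odot>\<^bsub>C\<^esub> ?e X)"
      by (simp add: C.TenA_merge)
    also have "\<dots> = ?e X \<cdot>\<^bsub>C\<^esub> ?n (TLun X)"
      using F.F2_lun[of X] by (simp add: tensor_structure C.lun_nat)
    finally show ?thesis by simp
  qed
  have nat: "?e (tcod A B p) \<cdot>\<^bsub>C\<^esub> ?n p = FA F (?c p) \<cdot>\<^bsub>C\<^esub> ?e (tdom A B p)"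
    if "wf_arr A B p" for p
    using that
  proof (induction p)
    case (TIde X)
    then show ?case using F.FA_Ide[of X] by (simp add: tensor_structure)
  next
    case (TComp q p)
    have "?e (tcod A B (q \<cdot>\<^sub>t p)) \<cdot>\<^bsub>C\<^esub> ?n (q \<cdot>\<^sub>t p) = (?e (tcod A B q) \<cdot>\<^bsub>C\<^esub> ?n q) \<cdot>\<^bsub>C\<^esub> ?n p"
      using TComp.prems by simp
    also have "\<dots> = FA F (?c q) \<cdot>\<^bsub>C\<^esub> (?e (tcod A B p) \<cdot>\<^bsub>C\<^esub> ?n p)"
      using TComp by simp
    also have "\<dots> = (FA F (?c q) \<cdot>\<^bsub>C\<^esub> FA F (?c p)) \<cdot>\<^bsub>C\<^esub> ?e (tdom A B (q \<cdot>\<^sub>t p))"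
      using TComp by simp
    also have "FA F (?c q) \<cdot>\<^bsub>C\<^esub> FA F (?c p) = FA F (?c (q \<cdot>\<^sub>t p))"
      using TComp.prems by (simp flip: F.FA_Comp_simp add: tclass_Comp)
    finally show ?case .
  next
    case (TLeft X p)
    \<comment> \<open>As a tensor with an identity, the whiskering falls under the naturality of
      \<open>F2 F\<close>.\<close>
    have "Ide T X \<odot>\<^bsub>T\<^esub> ?c p = ?c (X \<lhd>\<^sub>t p)"
      using TLeft.prems by (simp add: tensor_structure tclass_TenA tclass_tten_Ide)
    then have "FA F (?c (X \<lhd>\<^sub>t p)) \<cdot>\<^bsub>C\<^esub> F2 F X (tdom A B p) = F2 F X (tcod A B p) \<cdot>\<^bsub>C\<^esub> (Ide C (FO F X) \<odot>\<^bsub>C\<^esub> FA F (?c p))"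
      using TLeft.prems F.F2_nat[of "Ide T X" "?c p" X "tcod A B p"] by simp
    then have "FA F (?c (X \<lhd>\<^sub>t p)) \<cdot>\<^bsub>C\<^esub> ?e (tdom A B (X \<lhd>\<^sub>t p))
      = (F2 F X (tcod A B p) \<cdot>\<^bsub>C\<^esub> (Ide C (FO F X) \<odot>\<^bsub>C\<^esub> FA F (?c p))) \<cdot>\<^bsub>C\<^esub> (?e X \<odot>\<^bsub>C\<^esub> ?e (tdom A B p))"
      using TLeft.prems by (simp flip: C.Comp_assoc_simp)
    then show ?case using TLeft by (simp add: C.TenA_merge)
  next
    case (TRight p X)
    have "?c p \<odot>\<^bsub>T\<^esub> Ide T X = ?c (p \<rhd>\<^sub>t X)"
      using TRight.prems by (simp add: tensor_structure tclass_TenA tclass_tten_Ide)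
    then have "FA F (?c (p \<rhd>\<^sub>t X)) \<cdot>\<^bsub>C\<^esub> F2 F (tdom A B p) X = F2 F (tcod A B p) X \<cdot>\<^bsub>C\<^esub> (FA F (?c p) \<odot>\<^bsub>C\<^esub> Ide C (FO F X))"
      using TRight.prems F.F2_nat[of "?c p" "Ide T X" "tcod A B p" X] by simp
    then have "FA F (?c (p \<rhd>\<^sub>t X)) \<cdot>\<^bsub>C\<^esub> ?e (tdom A B (p \<rhd>\<^sub>t X))
      = (F2 F (tcod A B p) X \<cdot>\<^bsub>C\<^esub> (FA F (?c p) \<odot>\<^bsub>C\<^esub> Ide C (FO F X))) \<cdot>\<^bsub>C\<^esub> (?e (tdom A B p) \<odot>\<^bsub>C\<^esub> ?e X)"
      using TRight.prems by (simp flip: C.Comp_assoc_simp)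
    then show ?case using TRight by (simp add: C.TenA_merge)
  next
    case (TAss X Y Z)
    then show ?case using ass by simp
  next
    case (TAssInv X Y Z)
    then have [simp]: "wf_obj A B X" "wf_obj A B Y" "wf_obj A B Z" by simp_all
    \<comment> \<open>F takes the formal inverse to an inverse, so the square already proved for the
      associator is turned around.\<close>
    have "inv_arr C (FA F (?c (TAss X Y Z))) \<cdot>\<^bsub>C\<^esub> ?e ((X \<otimes>\<^sub>t Y) \<otimes>\<^sub>t Z) = ?e (X \<otimes>\<^sub>t (Y \<otimes>\<^sub>t Z)) \<cdot>\<^bsub>C\<^esub> inv_arr C (?n (TAss X Y Z))"
      using T.ass_simps(4)[of X Y Z] by (intro C.naturality_inv ass[symmetric]) (simp_all add: tensor_structure)
    then show ?case
      using T.ass_simps(4)[of X Y Z] inv_arr_tensor(1)[of X Y Z] F.FA_inv_arr[of "ass T X Y Z"] by (simp add: tensor_structure)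
  next
    case (TRun X)
    then show ?case using run by simp
  next
    case (TRunInv X)
    then have [simp]: "wf_obj A B X" by simp
    have "inv_arr C (FA F (?c (TRun X))) \<cdot>\<^bsub>C\<^esub> ?e X = ?e (X \<otimes>\<^sub>t TUnit) \<cdot>\<^bsub>C\<^esub> inv_arr C (?n (TRun X))"
      using T.run_simps(4)[of X] by (intro C.naturality_inv run[symmetric]) (simp_all add: tensor_structure)
    then show ?case
      using T.run_simps(4)[of X] inv_arr_tensor(2)[of X X X] F.FA_inv_arr[of "run T X"] by (simp add: tensor_structure)
  next
    case (TLun X)
    then show ?case using lun by simp
  next
    case (TLunInv X)
    then have [simp]: "wf_obj A B X" by simp
    have "inv_arr C (FA F (?c (TLun X))) \<cdot>\<^bsub>C\<^esub> ?e X = ?e (TUnit \<otimes>\<^sub>t X) \<cdot>\<^bsub>C\<^esub> inv_arr C (?n (TLun X))"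
      using T.lun_simps(4)[of X] by (intro C.naturality_inv lun[symmetric]) (simp_all add: tensor_structure)
    then show ?case
      using T.lun_simps(4)[of X] inv_arr_tensor(3)[of X X X] F.FA_inv_arr[of "lun T X"] by (simp add: tensor_structure)
  next
    case (TSym X Y)
    then have [simp]: "wf_obj A B X" "wf_obj A B Y" by simp_all
    have "FA F (?c (TSym X Y)) \<cdot>\<^bsub>C\<^esub> ?e (X \<otimes>\<^sub>t Y) = (FA F (?c (TSym X Y)) \<cdot>\<^bsub>C\<^esub> F2 F X Y) \<cdot>\<^bsub>C\<^esub> (?e X \<odot>\<^bsub>C\<^esub> ?e Y)"
      by simp
    also have "\<dots> = ?e (Y \<otimes>\<^sub>t X) \<cdot>\<^bsub>C\<^esub> ?n (TSym X Y)"
      using F.F2_sym[of X Y] by (simp add: tensor_structure C.braid_nat)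
    finally show ?case by simp
  qed simp_all
  show ?thesis
    by (rule sm_transformationI)
      (auto simp: F sm_functor_en[OF sm_functor_rn[OF F]] eps_ext[unfolded tensor_sel] nat elim!: Arr_tensorE)
qed

end

section \<open>Compatibility of precomposition and of [A, F] with the pointwise structure\<close>

lemma box_comp_smf:
  assumes "sm_functor A B H" "sm_functor B C F" "sm_functor B C G"
  shows "box_smf A C (comp_smf A C F H) (comp_smf A C G H) = comp_smf A C (box_smf B C F G) H"
proof -
  interpret H: sm_functor A B H by fact
  interpret F: sm_functor B C F by fact
  interpret G: sm_functor B C G by fact
  show ?thesis by (rule smf_eqI[where A = A]) (simp_all add: F.B.TenA_merge')
qed

lemma unit_comp_smf:
  assumes "sm_functor A B H" "sm_category C"
  shows "comp_smf A C (unit_smf B C) H = unit_smf A C"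
proof -
  interpret H: sm_functor A B H by fact
  interpret C: sm_category C by fact
  show ?thesis by (rule smf_eqI[where A = A]) simp_all
qed

lemma inv_arr_ihom:
  assumes "sm_transformation A B \<sigma>" "\<And>x. x \<in> Obj A \<Longrightarrow> iso B (Cpt \<sigma> x)"
  shows "sm_transformation A B (inv_arr (ihom A B) \<sigma>)"
    "Src (inv_arr (ihom A B) \<sigma>) = Tgt \<sigma>" "Tgt (inv_arr (ihom A B) \<sigma>) = Src \<sigma>"
    "x \<in> Obj A \<Longrightarrow> Cpt (inv_arr (ihom A B) \<sigma>) x = inv_arr B (Cpt \<sigma> x)"
proof -
  interpret s: sm_transformation A B \<sigma> by fact
  interpret H: sm_category "ihom A B" by (rule sm_category_ihom) unfold_locales
  have i: "inverses (ihom A B) \<sigma> \<lparr>Src = Tgt \<sigma>, Tgt = Src \<sigma>, Cpt = (\<lambda>x\<in>Obj A. inv_arr B (Cpt \<sigma> x))\<rparr>"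
    by (rule inverses_ihom[OF assms])
  then have "inv_arr (ihom A B) \<sigma> = \<lparr>Src = Tgt \<sigma>, Tgt = Src \<sigma>, Cpt = (\<lambda>x\<in>Obj A. inv_arr B (Cpt \<sigma> x))\<rparr>"
    by (rule H.inv_arr_eqI)
  with i show "sm_transformation A B (inv_arr (ihom A B) \<sigma>)"
    "Src (inv_arr (ihom A B) \<sigma>) = Tgt \<sigma>" "Tgt (inv_arr (ihom A B) \<sigma>) = Src \<sigma>"
    "x \<in> Obj A \<Longrightarrow> Cpt (inv_arr (ihom A B) \<sigma>) x = inv_arr B (Cpt \<sigma> x)"
    by (auto simp: inverses_def in_hom_iff)
qed

lemma interchange_ihom:
  assumes "sm_functor A B F" "sm_functor A B G" "sm_functor A B H" "sm_functor A B K"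
  shows "x \<in> Obj A \<Longrightarrow> Cpt (interchange (ihom A B) F G H K) x = interchange B (FO F x) (FO G x) (FO H x) (FO K x)"
    "Src (interchange (ihom A B) F G H K) = box_smf A B (box_smf A B F G) (box_smf A B H K)"
    "Tgt (interchange (ihom A B) F G H K) = box_smf A B (box_smf A B F H) (box_smf A B G K)"
    "Cpt (interchange (ihom A B) F G H K) \<in> extensional (Obj A)"
proof -
  interpret F: sm_functor A B F by fact
  interpret G: sm_functor A B G by fact
  interpret H: sm_functor A B H by fact
  interpret K: sm_functor A B K by fact
  have a: "sm_transformation A B (ass (ihom A B) X Y Z)" "\<And>x. x \<in> Obj A \<Longrightarrow> iso B (Cpt (ass (ihom A B) X Y Z) x)"
    if "sm_functor A B X" "sm_functor A B Y" "sm_functor A B Z" for X Y Z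
    using that sm_functor.FO_in[OF that(1)] sm_functor.FO_in[OF that(2)] sm_functor.FO_in[OF that(3)]
    by (simp_all add: sm_transformation_ass)
  note [simp] = inv_arr_ihom[OF a] assms sm_functor_box_smf
  show "x \<in> Obj A \<Longrightarrow> Cpt (interchange (ihom A B) F G H K) x = interchange B (FO F x) (FO G x) (FO H x) (FO K x)"
    by (simp add: interchange_def)
  show "Src (interchange (ihom A B) F G H K) = box_smf A B (box_smf A B F G) (box_smf A B H K)"
    "Tgt (interchange (ihom A B) F G H K) = box_smf A B (box_smf A B F H) (box_smf A B G K)"
    "Cpt (interchange (ihom A B) F G H K) \<in> extensional (Obj A)"
    by (simp_all add: interchange_def)
qed

text \<open>An equality on the nose; it is the reason why transposition preserves pointwise tensors
  strictly (\<open>rn_box\<close>). The comparison on the right contains an interchange of functors,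
  whose components are interchanges in C by \<open>interchange_ihom\<close>.\<close>

lemma ihom_map_box:
  assumes "sm_category A" "sm_functor B C F" "sm_functor B C G"
  shows "ihom_map A B C (box_smf B C F G) = box_smf (ihom A B) (ihom A C) (ihom_map A B C F) (ihom_map A B C G)"
proof -
  interpret A: sm_category A by fact
  interpret F: sm_functor B C F by fact
  interpret G: sm_functor B C G by fact
  have obj: "FO K x \<in> Obj B" if "sm_functor A B K" "x \<in> Obj A" for K x
    using that by (rule sm_functor.FO_in)
  have cpt: "Cpt \<sigma> x \<in> Arr B" "Dom B (Cpt \<sigma> x) = FO (Src \<sigma>) x" "Cod B (Cpt \<sigma> x) = FO (Tgt \<sigma>) x"
    if "sm_transformation A B \<sigma>" "x \<in> Obj A" for \<sigma> x
    using that by (simp_all add: sm_transformation.Cpt_simps)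
  have u: "sm_functor A B (unit_smf A B)" "sm_functor A C (unit_smf A C)"
    by (auto intro: sm_functor_unit_smf assms F.A.sm_category_axioms F.B.sm_category_axioms)
  have r: "sm_transformation A C (run (ihom A C) (unit_smf A C))"
    "\<And>x. x \<in> Obj A \<Longrightarrow> iso C (Cpt (run (ihom A C) (unit_smf A C)) x)"
    by (simp_all add: sm_transformation_run u)
  show ?thesis
    by (rule smf_eqI[where A = "ihom A B"])
      (auto simp: ihom_map_ext[unfolded ihom_sel] assms box_comp_smf[OF _ assms(2,3)] sm_functor_comp_smf sm_functor_box_smf obj cpt sm_functor_Src_Tgt u
        inv_arr_ihom[OF r] interchange_ihom box_simps(5-8)[where A = "ihom A B", unfolded ihom_sel]
        intro!: smt_eqI[where A = A])
qed

lemma ihom_map_unit: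
  assumes "sm_category A" "sm_category B" "sm_category C"
  shows "ihom_map A B C (unit_smf B C) = unit_smf (ihom A B) (ihom A C)"
proof -
  interpret A: sm_category A by fact
  interpret B: sm_category B by fact
  interpret C: sm_category C by fact
  have obj: "FO K x \<in> Obj B" if "sm_functor A B K" "x \<in> Obj A" for K x
    using that by (rule sm_functor.FO_in)
  have cpt: "Cpt \<sigma> x \<in> Arr B" if "sm_transformation A B \<sigma>" "x \<in> Obj A" for \<sigma> x
    using that by (simp add: sm_transformation.Cpt_simps)
  show ?thesis
    by (rule smf_eqI[where A = "ihom A B"])
      (auto simp: ihom_map_ext[unfolded ihom_sel] assms unit_comp_smf sm_functor_unit_smf sm_functor_Src_Tgt obj cpt
        sm_functor_box_smf unit_smf_simps(5-8)[where A = "ihom A B", unfolded ihom_sel]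
        intro!: smt_eqI[where A = A])
qed

lemma ihom_map2_simps [simp]:
  "Src (ihom_map2 A B C \<sigma>) = ihom_map A B C (Src \<sigma>)" "Tgt (ihom_map2 A B C \<sigma>) = ihom_map A B C (Tgt \<sigma>)"
  "sm_functor A B H \<Longrightarrow> Cpt (ihom_map2 A B C \<sigma>) H = whisker_right A C \<sigma> H"
  by (simp_all add: ihom_map2_def)

lemma ihom_map2_ext: "Cpt (ihom_map2 A B C \<sigma>) \<in> extensional (Obj (ihom A B))"
  by (simp add: ihom_map2_def del: ihom_sel)

lemma sm_transformation_ihom_map2:
  assumes "sm_category A" "sm_transformation B C \<sigma>"
  shows "sm_transformation (ihom A B) (ihom A C) (ihom_map2 A B C \<sigma>)"
proof -
  interpret A: sm_category A by fact
  interpret s: sm_transformation B C \<sigma> by fact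
  have obj: "FO K x \<in> Obj B" if "sm_functor A B K" "x \<in> Obj A" for K x
    using that by (rule sm_functor.FO_in)
  have nat: "Cpt \<sigma> (FO (Tgt \<theta>) x) \<cdot>\<^bsub>C\<^esub> FA (Src \<sigma>) (Cpt \<theta> x) = FA (Tgt \<sigma>) (Cpt \<theta> x) \<cdot>\<^bsub>C\<^esub> Cpt \<sigma> (FO (Src \<theta>) x)"
    if "sm_transformation A B \<theta>" "x \<in> Obj A" for \<theta> x
    using s.Cpt_nat[of "Cpt \<theta> x"] sm_transformation.Cpt_simps[OF that] by simp
  have u: "sm_functor A B (unit_smf A B)"
    by (intro sm_functor_unit_smf A.sm_category_axioms s.S.A.sm_category_axioms)
  note sS = s.S.sm_functor_axioms and sT = s.T.sm_functor_axioms
  show ?thesis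
    by (rule sm_transformationI)
      (auto simp: ihom_map2_ext[unfolded ihom_sel] sm_functor_ihom_map A.sm_category_axioms sS sT sm_functor_Src_Tgt obj nat u
        sm_transformation_whisker_right[OF assms(2)] sm_functor_box_smf s.Cpt_unit s.Cpt_tensor intro!: smt_eqI[where A = A])
qed

section \<open>Strong functors on a tensor product\<close>

definition strong_smf :: "('oa, 'ma) smc \<Rightarrow> ('ob, 'mb) smc \<Rightarrow> ('oa, 'ma, 'ob, 'mb) smf \<Rightarrow> bool" where
  "strong_smf A B F \<longleftrightarrow> iso B (F0 F) \<and> (\<forall>x\<in>Obj A. \<forall>y\<in>Obj A. iso B (F2 F x y))"

lemma strong_unit_smf: "sm_category B \<Longrightarrow> strong_smf A B (unit_smf A B)"
  by (simp add: strong_smf_def sm_category.iso_Ide sm_category.Unit_in sm_category.run_iso)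

lemma strong_box_smf:
  assumes "sm_functor A B F" "sm_functor A B G" "strong_smf A B F" "strong_smf A B G"
  shows "strong_smf A B (box_smf A B F G)"
proof -
  interpret F: sm_functor A B F by fact
  interpret G: sm_functor A B G by fact
  show ?thesis using assms(3,4) by (simp add: strong_smf_def)
qed

context sm_category_triple
begin

lemma strong_en:
  assumes "sm_functor A (ihom B C) F"
  shows "strong_smf T C (en A B C F)"
proof -
  interpret F: sm_bifunctor A B C F by (rule sm_bifunctorI) fact
  show ?thesis by (simp add: strong_smf_def)
qed

text \<open>The unit and tensor axioms determine a transformation on \<open>I\<close> and on \<open>X \<otimes> Y\<close>.\<close>

lemma tensor_transformation_eqI:
  assumes "sm_transformation T C \<sigma>" "sm_transformation T C \<tau>" "Src \<sigma> = Src \<tau>" "Tgt \<sigma> = Tgt \<tau>"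
    and strong: "strong_smf T C (Src \<tau>)"
    and gen: "\<And>a b. \<lbrakk>a \<in> Obj A; b \<in> Obj B\<rbrakk> \<Longrightarrow> Cpt \<sigma> (TGen a b) = Cpt \<tau> (TGen a b)"
  shows "\<sigma> = \<tau>"
proof (rule smt_eqI)
  interpret s: sm_transformation T C \<sigma> by fact
  interpret t: sm_transformation T C \<tau> by fact
  note [simp] = assms(3,4)
  show "Cpt \<sigma> \<in> extensional (Obj T)" "Cpt \<tau> \<in> extensional (Obj T)"
    by (rule s.Cpt_ext t.Cpt_ext)+
  fix X assume "X \<in> Obj T"
  then have "wf_obj A B X" by simp
  then show "Cpt \<sigma> X = Cpt \<tau> X"
  proof (induction X)
    case TUnit
    have "Cpt \<sigma> TUnit \<cdot>\<^bsub>C\<^esub> F0 (Src \<tau>) = Cpt \<tau> TUnit \<cdot>\<^bsub>C\<^esub> F0 (Src \<tau>)"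
      using s.Cpt_unit t.Cpt_unit by simp
    then show ?case
      by (rule C.iso_cancel_right) (use strong s.Cpt_simps[of TUnit] t.Cpt_simps[of TUnit] in \<open>simp_all add: strong_smf_def\<close>)
  next
    case (TTen X Y)
    then have [simp]: "wf_obj A B X" "wf_obj A B Y" by simp_all
    have "Cpt \<sigma> (X \<otimes>\<^sub>t Y) \<cdot>\<^bsub>C\<^esub> F2 (Src \<tau>) X Y = Cpt \<tau> (X \<otimes>\<^sub>t Y) \<cdot>\<^bsub>C\<^esub> F2 (Src \<tau>) X Y"
      using s.Cpt_tensor[of X Y] t.Cpt_tensor[of X Y] TTen by simp
    then show ?case
      by (rule C.iso_cancel_right)
        (use strong s.Cpt_simps[of "X \<otimes>\<^sub>t Y"] t.Cpt_simps[of "X \<otimes>\<^sub>t Y"] t.S.F2_simps[of X Y] in \<open>simp_all add: strong_smf_def\<close>)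
  qed (use gen in simp)
qed fact+

lemma rn_box:
  assumes "sm_functor T C F" "sm_functor T C G"
  shows "box_smf A (ihom B C) (rn F) (rn G) = rn (box_smf T C F G)"
  unfolding ihom_map_box[OF B.sm_category_axioms assms]
  by (rule box_comp_smf[OF sm_functor_eta]) (intro sm_functor_ihom_map B.sm_category_axioms assms)+

lemma rn_unit: "rn (unit_smf T C) = unit_smf A (ihom B C)"
  unfolding ihom_map_unit[OF B.sm_category_axioms T.sm_category_axioms C.sm_category_axioms]
  by (intro unit_comp_smf[OF sm_functor_eta] sm_category_ihom B.sm_category_axioms C.sm_category_axioms)

text \<open>Transposing looks only at objects TGen a b and at the generating arrows, where
  \<open>en\<close> takes the values of F by definition. Extensionality of all maps makes this an
  equality.\<close>

lemma rn_en:
  assumes "sm_functor A (ihom B C) F"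
  shows "rn (en A B C F) = F"
proof -
  interpret F: sm_bifunctor A B C F by (rule sm_bifunctorI) fact
  have en: "sm_functor T C (en A B C F)" by (rule F.sm_functor_en)
  have o: "comp_smf B C (en A B C F) (eta_at A B a) = FO F a" if a [simp]: "a \<in> Obj A" for a
  proof -
    interpret a: sm_functor B C "FO F a" by (rule F.sm_functor_FO) fact
    show ?thesis
      by (rule smf_eqI[where A = B]) (simp_all add: a.FO_ext a.FA_ext a.F2_ext a.F2_ext')
  qed
  show ?thesis
  proof (rule smf_eqI[where A = A])
    fix f assume f [simp]: "f \<in> Arr A"
    interpret f: sm_transformation B C "FA F f" using F.sm_transformation_FA by simp
    show "FA (rn (en A B C F)) f = FA F f"
      by (rule smt_eqI[where A = B]) (simp_all add: o F.sm_transformation_FA(2,3) f.Cpt_ext)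
  next
    interpret f: sm_transformation B C "F0 F" by (rule F.sm_transformation_F0)
    show "F0 (rn (en A B C F)) = F0 F"
      by (rule smt_eqI[where A = B]) (simp_all add: o F.sm_transformation_F0(2,3) f.Cpt_ext)
  next
    fix x y assume [simp]: "x \<in> Obj A" "y \<in> Obj A"
    interpret f: sm_transformation B C "F2 F x y" by (rule F.sm_transformation_F2) simp_all
    show "F2 (rn (en A B C F)) x y = F2 F x y"
      by (rule smt_eqI[where A = B]) (simp_all add: o F.sm_transformation_F2(2,3) f.Cpt_ext)
  qed (simp_all add: o F.F.FO_ext F.F.FA_ext F.F.F2_ext F.F.F2_ext')
qed

end

section \<open>Rn and En as symmetric monoidal functors\<close>

lemma Rn_simps [simp]:
  "sm_transformation (tensor A B) C \<sigma> \<Longrightarrow> FA (Rn A B C) \<sigma>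
    = whisker_right A (ihom B C) (ihom_map2 B (tensor A B) C \<sigma>) (eta A B)"
  "F0 (Rn A B C) = Ide (ihom A (ihom B C)) (unit_smf A (ihom B C))"
  "\<lbrakk>sm_functor (tensor A B) C F; sm_functor (tensor A B) C G\<rbrakk> \<Longrightarrow> F2 (Rn A B C) F G
    = Ide (ihom A (ihom B C)) (box_smf A (ihom B C)
       (comp_smf A (ihom B C) (ihom_map B (tensor A B) C F) (eta A B))
       (comp_smf A (ihom B C) (ihom_map B (tensor A B) C G) (eta A B)))"
  by (simp_all add: Rn_def Let_def)

lemma Rn_ext:
  "FO (Rn A B C) \<in> extensional (Obj (ihom (tensor A B) C))" "FA (Rn A B C) \<in> extensional (Arr (ihom (tensor A B) C))"
  "F2 (Rn A B C) \<in> extensional (Obj (ihom (tensor A B) C))"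
  "F \<in> Obj (ihom (tensor A B) C) \<Longrightarrow> F2 (Rn A B C) F \<in> extensional (Obj (ihom (tensor A B) C))"
  by (simp_all add: Rn_def Let_def del: ihom_sel)

lemma En_simps [simp]:
  "sm_functor A (ihom B C) F \<Longrightarrow> FO (En A B C) F = en A B C F"
  "sm_transformation A (ihom B C) \<sigma> \<Longrightarrow> FA (En A B C) \<sigma> = en2 A B C \<sigma>"
  "F0 (En A B C) = inv_arr (ihom (tensor A B) C) (eps A B C (unit_smf (tensor A B) C))"
  "\<lbrakk>sm_functor A (ihom B C) F; sm_functor A (ihom B C) G\<rbrakk> \<Longrightarrow> F2 (En A B C) F G
    = inv_arr (ihom (tensor A B) C) (eps A B C (box_smf (tensor A B) C (en A B C F) (en A B C G)))"
  by (simp_all add: En_def Let_def)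

lemma En_ext:
  "FO (En A B C) \<in> extensional (Obj (ihom A (ihom B C)))" "FA (En A B C) \<in> extensional (Arr (ihom A (ihom B C)))"
  "F2 (En A B C) \<in> extensional (Obj (ihom A (ihom B C)))"
  "F \<in> Obj (ihom A (ihom B C)) \<Longrightarrow> F2 (En A B C) F \<in> extensional (Obj (ihom A (ihom B C)))"
  by (simp_all add: En_def Let_def del: ihom_sel)

text \<open>That unit and tensor of objects are preserved is not a clause of its own: it follows
  from the codomains of the two comparisons, as \<open>strict_FO\<close> shows.\<close>

definition strict_smf :: "('oa, 'ma) smc \<Rightarrow> ('ob, 'mb) smc \<Rightarrow> ('oa, 'ma, 'ob, 'mb) smf \<Rightarrow> bool" where
  "strict_smf A B F \<longleftrightarrow> F0 F = Ide B \<one>\<^bsub>B\<^esub> \<and> (\<forall>x\<in>Obj A. \<forall>y\<in>Obj A. F2 F x y = Ide B (FO F x \<otimes>\<^bsub>B\<^esub> FO F y))"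

lemma strict_FO:
  assumes "sm_functor A B F" "strict_smf A B F"
  shows "FO F \<one>\<^bsub>A\<^esub> = \<one>\<^bsub>B\<^esub>" "\<lbrakk>x \<in> Obj A; y \<in> Obj A\<rbrakk> \<Longrightarrow> FO F (x \<otimes>\<^bsub>A\<^esub> y) = FO F x \<otimes>\<^bsub>B\<^esub> FO F y"
proof -
  interpret F: sm_functor A B F by fact
  show "FO F \<one>\<^bsub>A\<^esub> = \<one>\<^bsub>B\<^esub>" using assms(2) F.F0_simps(3) by (simp add: strict_smf_def)
  show "FO F (x \<otimes>\<^bsub>A\<^esub> y) = FO F x \<otimes>\<^bsub>B\<^esub> FO F y" if "x \<in> Obj A" "y \<in> Obj A"
    using assms(2) F.F2_simps(3)[OF that] that by (simp add: strict_smf_def)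
qed

lemma strict_comp_smf:
  assumes F: "sm_functor A B F" "strict_smf A B F" and G: "sm_functor B C G" "strict_smf B C G"
  shows "strict_smf A C (comp_smf A C G F)"
proof -
  interpret F: sm_functor A B F by fact
  interpret G: sm_functor B C G by fact
  show ?thesis
    using F(2) G(2) strict_FO[OF F] strict_FO[OF G] by (simp add: strict_smf_def)
qed

context sm_category_triple
begin

lemma categories:
  "sm_category A" "sm_category B" "sm_category C" "sm_category T" "sm_category (ihom B C)" "sm_category (ihom T C)"
  "sm_category (ihom A (ihom B C))"
  by (intro sm_category_ihom A.sm_category_axioms B.sm_category_axioms C.sm_category_axioms T.sm_category_axioms)+

text \<open>The identity comparisons are well typed by \<open>rn_unit\<close> and
  \<open>rn_box\<close>; the equations are then compared at the components a and b.\<close>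

lemma sm_functor_Rn: "sm_functor (ihom T C) (ihom A (ihom B C)) (Rn A B C)"
proof -
  have obj: "FO F (TGen a b) \<in> Obj C" if "sm_functor T C F" "a \<in> Obj A" "b \<in> Obj B" for F a b
    using sm_functor.FO_in[OF that(1)] that by simp
  have cpt: "Cpt \<sigma> (TGen a b) \<in> Arr C" "Dom C (Cpt \<sigma> (TGen a b)) = FO (Src \<sigma>) (TGen a b)"
    "Cod C (Cpt \<sigma> (TGen a b)) = FO (Tgt \<sigma>) (TGen a b)"
    if "sm_transformation T C \<sigma>" "a \<in> Obj A" "b \<in> Obj B" for \<sigma> a b
    using sm_transformation.Cpt_simps[OF that(1), of "TGen a b"] that by simp_all
  have w: "sm_transformation A (ihom B C) (whisker_right A (ihom B C) (ihom_map2 B T C \<sigma>) (eta A B))"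
    if "sm_transformation T C \<sigma>" for \<sigma>
    by (rule sm_transformation_whisker_right[OF sm_transformation_ihom_map2[OF categories(2) that] sm_functor_eta])
  note T = sm_transformation_Ide sm_transformation_Comp sm_transformation_TenA sm_transformation_ass
    sm_transformation_run sm_transformation_lun sm_transformation_braid
  show ?thesis
    by (rule sm_functorI[OF categories(6,7) Rn_ext])
      (auto simp: T sm_functor_rn w obj cpt sm_functor_box_smf sm_functor_unit_smf categories rn_box rn_unit
        sm_functor_Src_Tgt box_comp_smf[OF sm_functor_eta_at]
       intro!: smt_eqI[where A = A] smt_eqI[where A = B])
qed

lemma eps_iso:
  assumes "sm_functor T C F" "strong_smf T C F" "wf_obj A B X"
  shows "iso C (eps_cpt C F X)"
proof -
  interpret F: sm_functor T C F by fact
  interpret e: sm_transformation T C "eps A B C F" by (rule sm_transformation_eps) fact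
  show ?thesis
    using assms(3)
  proof (induction X)
    case (TTen X Y)
    then have "wf_obj A B X" "wf_obj A B Y" by simp_all
    with TTen assms(2) e.Cpt_simps(1,3)[of X] e.Cpt_simps(1,3)[of Y] F.F2_simps[of X Y] show ?case
      by (simp add: strong_smf_def)
  qed (use assms(2) in \<open>simp_all add: strong_smf_def\<close>)
qed

text \<open>The inverse counit is the comparison of \<open>En\<close>. Its values are recorded at
  generators only, since \<open>tensor_transformation_eqI\<close> asks for no others.\<close>

lemma inv_eps:
  assumes "sm_functor T C F" "strong_smf T C F"
  shows "sm_transformation T C (inv_arr (ihom T C) (eps A B C F))"
    "Src (inv_arr (ihom T C) (eps A B C F)) = F" "Tgt (inv_arr (ihom T C) (eps A B C F)) = en A B C (rn F)"
    "\<lbrakk>a \<in> Obj A; b \<in> Obj B\<rbrakk> \<Longrightarrow> Cpt (inv_arr (ihom T C) (eps A B C F)) (TGen a b) = Ide C (FO F (TGen a b))"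
proof -
  have i: "\<And>X. X \<in> Obj T \<Longrightarrow> iso C (Cpt (eps A B C F) X)"
    by (simp add: eps_iso[OF assms])
  note inv = inv_arr_ihom[OF sm_transformation_eps[OF assms(1)] i]
  show "sm_transformation T C (inv_arr (ihom T C) (eps A B C F))"
    "Src (inv_arr (ihom T C) (eps A B C F)) = F" "Tgt (inv_arr (ihom T C) (eps A B C F)) = en A B C (rn F)"
    using inv(1-3) assms(1) by simp_all
  show "\<lbrakk>a \<in> Obj A; b \<in> Obj B\<rbrakk> \<Longrightarrow> Cpt (inv_arr (ihom T C) (eps A B C F)) (TGen a b) = Ide C (FO F (TGen a b))"
    using sm_functor.FO_in[OF assms(1), of "TGen a b"] inv(4)[of "TGen a b"] by simp
qed

text \<open>In every axiom the source of the transformations is a functor \<open>en F\<close>, the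
  unit, or a pointwise tensor of such, hence strong. At generators all comparisons are identities,
  and the claim becomes an equation of C.\<close>

lemma sm_functor_En: "sm_functor (ihom A (ihom B C)) (ihom T C) (En A B C)"
proof -
  have obj: "FO (FO F a) b \<in> Obj C" if "sm_functor A (ihom B C) F" "a \<in> Obj A" "b \<in> Obj B" for F a b
    using sm_bifunctor.FO_FO_in[OF sm_bifunctorI] that by blast
  have cpt: "Cpt (Cpt \<sigma> a) b \<in> Arr C" "Dom C (Cpt (Cpt \<sigma> a) b) = FO (FO (Src \<sigma>) a) b"
    "Cod C (Cpt (Cpt \<sigma> a) b) = FO (FO (Tgt \<sigma>) a) b"
    if "sm_transformation A (ihom B C) \<sigma>" "a \<in> Obj A" "b \<in> Obj B" for \<sigma> a b
    using sm_transformation.Cpt_simps[OF that(1,2)] sm_transformation.Cpt_simps[of B C "Cpt \<sigma> a" b] that by simp_all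
  note T = sm_transformation_Ide sm_transformation_Comp sm_transformation_TenA sm_transformation_ass
    sm_transformation_run sm_transformation_lun sm_transformation_braid
  have u: "sm_functor T C (unit_smf T C)" "strong_smf T C (unit_smf T C)"
    by (intro sm_functor_unit_smf strong_unit_smf categories)+
  have b: "sm_functor T C (box_smf T C (en A B C F) (en A B C G))"
    "strong_smf T C (box_smf T C (en A B C F) (en A B C G))"
    if "sm_functor A (ihom B C) F" "sm_functor A (ihom B C) G" for F G
    using that by (auto intro: sm_functor_box_smf strong_box_smf sm_functor_en strong_en)
  \<comment> \<open>This makes the inverse counit at a pointwise tensor of two functors
    \<open>en\<close> end at \<open>en\<close> of the pointwise tensor, as the binary comparison
    must.\<close>
  have r: "rn (box_smf T C (en A B C F) (en A B C G)) = box_smf A (ihom B C) F G"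
    if "sm_functor A (ihom B C) F" "sm_functor A (ihom B C) G" for F G
    using that by (simp add: rn_box[symmetric] rn_en sm_functor_en)
  show ?thesis
    by (rule sm_functorI[OF categories(7,6) En_ext])
      (auto simp: T obj cpt sm_functor_box_smf sm_functor_unit_smf sm_functor_en strong_en strong_box_smf strong_unit_smf
        categories u b r rn_unit inv_eps sm_transformation_en2 sm_functor_Src_Tgt
       intro!: tensor_transformation_eqI)
qed

lemma strict_en: "strict_smf T C (en A B C F)"
  by (simp add: strict_smf_def)

text \<open>For strict S all components of the counit are identities; its naturality then says that
  the two functors agree on arrows.\<close>

lemma en_rn_strict:
  assumes S: "sm_functor T C S" and strict: "strict_smf T C S"
  shows "en A B C (rn S) = S"
proof -
  interpret S: sm_functor T C S by fact
  interpret R: sm_bifunctor A B C "rn S" by (intro sm_bifunctorI sm_functor_rn S)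
  interpret e: sm_transformation T C "eps A B C S" by (rule sm_transformation_eps) fact
  have F0: "F0 S = Ide C \<one>\<^bsub>C\<^esub>"
    and F2: "\<And>X Y. \<lbrakk>wf_obj A B X; wf_obj A B Y\<rbrakk> \<Longrightarrow> F2 S X Y = Ide C (FO S X \<otimes>\<^bsub>C\<^esub> FO S Y)"
    using strict by (simp_all add: strict_smf_def)
  have FO2: "FO S (X \<otimes>\<^sub>t Y) = FO S X \<otimes>\<^bsub>C\<^esub> FO S Y" if "wf_obj A B X" "wf_obj A B Y" for X Y
    using S.F2_simps(3)[of X Y] F2[OF that] that by simp
  have FOu: "FO S TUnit = \<one>\<^bsub>C\<^esub>"
    using S.F0_simps(3) F0 by simp
  have o: "en_obj C (rn S) X = FO S X" if "wf_obj A B X" for X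
    using that by (induction X) (auto simp: FO2 FOu)
  have c: "eps_cpt C S X = Ide C (FO S X)" if "wf_obj A B X" for X
    using that by (induction X) (auto simp: FO2 FOu F0 F2)
  have a: "en_arr C (rn S) p = FA S (tclass A B p)" if "wf_arr A B p" for p
    using e.Cpt_nat[of "tclass A B p"] R.en_arr_simps[OF that] that by (simp add: c o S)
  show ?thesis
    by (rule smf_eqI[where A = T])
      (auto simp: en_ext[unfolded tensor_sel] S.FO_ext[unfolded tensor_sel] S.FA_ext S.F2_ext[unfolded tensor_sel]
        S.F2_ext'[unfolded tensor_sel] o a F0 F2 elim!: Arr_tensorE)
qed

end

section \<open>The associativity arrows\<close>

lemma sm_functor_id_smf: "sm_category A \<Longrightarrow> sm_functor A A (id_smf A)"
proof -
  assume "sm_category A"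
  then interpret A: sm_category A .
  show ?thesis
    by (rule sm_functorI) (simp_all add: id_smf_def A.sm_category_axioms)
qed

lemma id_smf_simps [simp]:
  "x \<in> Obj A \<Longrightarrow> FO (id_smf A) x = x" "f \<in> Arr A \<Longrightarrow> FA (id_smf A) f = f" "F0 (id_smf A) = Ide A \<one>\<^bsub>A\<^esub>"
  "\<lbrakk>x \<in> Obj A; y \<in> Obj A\<rbrakk> \<Longrightarrow> F2 (id_smf A) x y = Ide A (x \<otimes>\<^bsub>A\<^esub> y)"
  by (simp_all add: id_smf_def)

lemma id_smf_ext:
  "FO (id_smf A) \<in> extensional (Obj A)" "FA (id_smf A) \<in> extensional (Arr A)"
  "F2 (id_smf A) \<in> extensional (Obj A)" "x \<in> Obj A \<Longrightarrow> F2 (id_smf A) x \<in> extensional (Obj A)"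
  by (simp_all add: id_smf_def)

lemma strict_id_smf: "strict_smf A A (id_smf A)"
  by (simp add: strict_smf_def)

lemma id_comp_smf:
  assumes "sm_functor A B F"
  shows "comp_smf A B (id_smf B) F = F"
proof -
  interpret F: sm_functor A B F by fact
  show ?thesis
    by (rule smf_eqI[where A = A]) (simp_all add: F.FO_ext F.FA_ext F.F2_ext F.F2_ext')
qed

lemma comp_smf_assoc:
  assumes "sm_functor A B F" "sm_functor B C G" "sm_functor C D H"
  shows "comp_smf A D (comp_smf B D H G) F = comp_smf A D H (comp_smf A C G F)"
proof -
  interpret F: sm_functor A B F by fact
  interpret G: sm_functor B C G by fact
  interpret H: sm_functor C D H by fact
  show ?thesis by (rule smf_eqI[where A = A]) simp_all
qed

text \<open>Functoriality of [A, -] on the nose, by which the transpose of a composite can be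
  computed factor by factor.\<close>

lemma ihom_map_comp:
  assumes "sm_category A" "sm_functor B C F" "sm_functor C D G"
  shows "ihom_map A B D (comp_smf B D G F) = comp_smf (ihom A B) (ihom A D) (ihom_map A C D G) (ihom_map A B C F)"
proof -
  interpret A: sm_category A by fact
  interpret F: sm_functor B C F by fact
  interpret G: sm_functor C D G by fact
  interpret M: sm_functor "ihom A B" "ihom A C" "ihom_map A B C F"
    by (rule sm_functor_ihom_map) fact+
  have t: "sm_transformation A C (F0 (ihom_map A B C F))"
    "\<And>H K. \<lbrakk>sm_functor A B H; sm_functor A B K\<rbrakk> \<Longrightarrow> sm_transformation A C (F2 (ihom_map A B C F) H K)"
    using M.F0_simps(1) M.F2_simps(1) by simp_all
  have obj: "FO K x \<in> Obj B" if "sm_functor A B K" "x \<in> Obj A" for K x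
    using that by (rule sm_functor.FO_in)
  have cpt: "Cpt \<sigma> x \<in> Arr B" if "sm_transformation A B \<sigma>" "x \<in> Obj A" for \<sigma> x
    using that by (simp add: sm_transformation.Cpt_simps)
  have u: "sm_functor A B (unit_smf A B)"
    by (auto intro: sm_functor_unit_smf A.sm_category_axioms F.A.sm_category_axioms)
  note comp_simps = comp_smf_simps(5-8)[where A = "ihom A B", unfolded ihom_sel]
  note assoc = comp_smf_assoc[OF _ assms(2,3), where A = A]
  show ?thesis
    by (rule smf_eqI[where A = "ihom A B"])
      (auto simp: ihom_map_ext[unfolded ihom_sel] comp_simps assoc sm_functor_comp_smf[OF _ assms(2)] sm_functor_Src_Tgt obj cpt t u
        sm_transformation_whisker_left[OF _ assms(2)] sm_functor_box_smf intro!: smt_eqI[where A = A])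
qed

lemma ihom_map_id:
  assumes "sm_category A" "sm_category B"
  shows "ihom_map A B B (id_smf B) = id_smf (ihom A B)"
proof -
  interpret A: sm_category A by fact
  interpret B: sm_category B by fact
  have obj: "FO K x \<in> Obj B" if "sm_functor A B K" "x \<in> Obj A" for K x
    using that by (rule sm_functor.FO_in)
  have cpt: "Cpt \<sigma> x \<in> Arr B" "Cpt \<sigma> \<in> extensional (Obj A)" if "sm_transformation A B \<sigma>" "x \<in> Obj A" for \<sigma> x
    using that by (simp_all add: sm_transformation.Cpt_simps sm_transformation.Cpt_ext)
  have u: "sm_functor A B (unit_smf A B)"
    by (intro sm_functor_unit_smf assms)
  show ?thesis
    by (rule smf_eqI[where A = "ihom A B"])
      (auto simp: ihom_map_ext[unfolded ihom_sel] id_smf_ext[where A = "ihom A B", unfolded ihom_sel] id_comp_smf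
        sm_functor_box_smf sm_functor_Src_Tgt obj cpt u sm_transformation.Cpt_ext intro!: smt_eqI[where A = A])
qed

section \<open>The functors from which the two associativity arrows are built\<close>

locale sm_categories = A: sm_category A + B: sm_category B + C: sm_category C
  for A :: "('oa, 'ma) smc" and B :: "('ob, 'mb) smc" and C :: "('oc, 'mc) smc"

sublocale sm_categories \<subseteq> AB: sm_category_pair A B ..
sublocale sm_categories \<subseteq> BC: sm_category_pair B C ..
sublocale sm_categories \<subseteq> A_BC: sm_category_pair A "tensor B C" ..
sublocale sm_categories \<subseteq> AB_C: sm_category_pair "tensor A B" C ..

context sm_categories
begin

text \<open>\<open>U\<close> and \<open>V\<close> are the two bracketings. At a, b, c the functor
  \<open>M\<close> has the value (a \<otimes> b) \<otimes> c, and \<open>G\<close> is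
  \<open>M\<close> followed by \<open>En\<close>, so that A is \<open>en\<close> of
  \<open>G\<close>. Likewise \<open>K\<close> has the value a \<otimes> (b \<otimes> c),
  \<open>L\<close> is \<open>en\<close> of \<open>K\<close>, and A' is \<open>en\<close> of
  \<open>L\<close>. \<open>S\<close> is A' after A.\<close>

abbreviation U where "U \<equiv> tensor A (tensor B C)"
abbreviation V where "V \<equiv> tensor (tensor A B) C"
abbreviation M where "M \<equiv> comp_smf A (ihom B (ihom C V)) (ihom_map B (tensor A B) (ihom C V) (eta (tensor A B) C)) (eta A B)"
abbreviation G where "G \<equiv> comp_smf A (ihom (tensor B C) V) (En B C V) M"
abbreviation K where "K \<equiv> comp_smf A (ihom B (ihom C U)) (Rn B C U) (eta A (tensor B C))"
abbreviation L where "L \<equiv> en A B (ihom C U) K"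
abbreviation S where "S \<equiv> comp_smf U U (assoc_arrow' A B C) (assoc_arrow A B C)"

lemma triples:
  "sm_category_triple A (tensor B C) U" "sm_category_triple A (tensor B C) V"
  "sm_category_triple B C U" "sm_category_triple B C V"
  "sm_category_triple A B (ihom C U)" "sm_category_triple A B (ihom C V)" "sm_category_triple (tensor A B) C U"
  by (intro sm_category_triple.intro sm_category_ihom AB.sm_category_pair_axioms BC.sm_category_pair_axioms
      A_BC.sm_category_pair_axioms AB_C.sm_category_pair_axioms A_BC.T.sm_category_axioms AB_C.T.sm_category_axioms
      C.sm_category_axioms)+

lemma sm_functor_M: "sm_functor A (ihom B (ihom C V)) M"
  by (rule sm_category_triple.sm_functor_rn[OF triples(6) AB_C.sm_functor_eta])

lemma sm_functor_G: "sm_functor A (ihom (tensor B C) V) G"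
  by (rule sm_functor_comp_smf[OF sm_functor_M sm_category_triple.sm_functor_En[OF triples(4)]])

lemma sm_functor_K: "sm_functor A (ihom B (ihom C U)) K"
  by (rule sm_functor_comp_smf[OF A_BC.sm_functor_eta sm_category_triple.sm_functor_Rn[OF triples(3)]])

lemma sm_functor_L: "sm_functor (tensor A B) (ihom C U) L"
  by (rule sm_category_triple.sm_functor_en[OF triples(5) sm_functor_K])

lemma assoc_arrow_eq: "assoc_arrow A B C = en A (tensor B C) V G"
  unfolding assoc_arrow_def Let_def by (rule En_simps(1)[OF sm_functor_G])

lemma assoc_arrow'_eq: "assoc_arrow' A B C = en (tensor A B) C U L"
  unfolding assoc_arrow'_def Let_def
  by (simp only: En_simps(1)[OF sm_functor_K] En_simps(1)[OF sm_functor_L])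

lemma sm_functor_assoc_arrow: "sm_functor U V (assoc_arrow A B C)"
  unfolding assoc_arrow_eq by (rule sm_category_triple.sm_functor_en[OF triples(2) sm_functor_G])

lemma sm_functor_assoc_arrow': "sm_functor V U (assoc_arrow' A B C)"
  unfolding assoc_arrow'_eq by (rule sm_category_triple.sm_functor_en[OF triples(7) sm_functor_L])

lemma strict_assoc_arrow: "strict_smf U V (assoc_arrow A B C)"
  unfolding assoc_arrow_eq by (rule sm_category_triple.strict_en[OF triples(2)])

lemma strict_assoc_arrow': "strict_smf V U (assoc_arrow' A B C)"
  unfolding assoc_arrow'_eq by (rule sm_category_triple.strict_en[OF triples(7)])

lemma strict_S: "strict_smf U U S"
  by (rule strict_comp_smf[OF sm_functor_assoc_arrow strict_assoc_arrow sm_functor_assoc_arrow' strict_assoc_arrow'])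

lemma sm_functor_S: "sm_functor U U S"
  by (rule sm_functor_comp_smf[OF sm_functor_assoc_arrow sm_functor_assoc_arrow'])

end

sublocale sm_categories \<subseteq> G: sm_bifunctor A "tensor B C" V G
  by (rule sm_category_triple.sm_bifunctorI[OF triples(2) sm_functor_G])
sublocale sm_categories \<subseteq> M: sm_bifunctor A B "ihom C V" M
  by (rule sm_category_triple.sm_bifunctorI[OF triples(6) sm_functor_M])
sublocale sm_categories \<subseteq> K: sm_bifunctor A B "ihom C U" K
  by (rule sm_category_triple.sm_bifunctorI[OF triples(5) sm_functor_K])
sublocale sm_categories \<subseteq> L: sm_bifunctor "tensor A B" C U L
  by (rule sm_category_triple.sm_bifunctorI[OF triples(7) sm_functor_L])

section \<open>Values of the composite on generators\<close>

context sm_categories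
begin

lemma FA_G:
  assumes [simp]: "f \<in> Arr A" "b \<in> Obj B" "c \<in> Obj C"
  shows "Cpt (FA G f) (TGen b c) = tclass (tensor A B) C (GenL (tclass A B (GenL f b)) c)"
proof -
  have "sm_transformation B (ihom C V) (FA M f)" by (rule M.sm_transformation_FA) simp
  then show ?thesis by (simp add: AB.sm_transformation_genL AB_C.sm_transformation_genL)
qed

text \<open>The factor contributed by \<open>En\<close> is an inverse counit, an identity at b
  \<otimes> c. What remains is the unit comparison of \<open>M\<close>, a composite of the \<alpha>
  of V with the image of the \<alpha> of A \<otimes> B. \<open>F2_G\<close> has the same shape with
  \<gamma>.\<close>

lemma F0_G:
  assumes [simp]: "b \<in> Obj B" "c \<in> Obj C"
  shows "Cpt (F0 G) (TGen b c) = tclass (tensor A B) C (GenL (tclass A B (Alpha b)) c) \<cdot>\<^bsub>V\<^esub> tclass (tensor A B) C (Alpha c)"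
proof -
  interpret t: sm_category_triple B C V by (rule triples)
  have "sm_transformation B (ihom C V) (F0 M)" by (rule M.sm_transformation_F0)
  moreover have "sm_functor (tensor B C) V (unit_smf (tensor B C) V)" "strong_smf (tensor B C) V (unit_smf (tensor B C) V)"
    by (intro sm_functor_unit_smf strong_unit_smf BC.T.sm_category_axioms AB_C.T.sm_category_axioms)+
  ultimately show ?thesis
    by (simp add: t.inv_eps AB.sm_transformation_alpha)
qed

lemma F2_G:
  assumes [simp]: "a \<in> Obj A" "a' \<in> Obj A" "b \<in> Obj B" "c \<in> Obj C"
  shows "Cpt (F2 G a a') (TGen b c) = tclass (tensor A B) C (GenL (tclass A B (Gamma a a' b)) c)
    \<cdot>\<^bsub>V\<^esub> tclass (tensor A B) C (Gamma (TGen a b) (TGen a' b) c)"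
proof -
  interpret t: sm_category_triple B C V by (rule triples)
  have "sm_transformation B (ihom C V) (F2 M a a')" by (rule M.sm_transformation_F2) simp_all
  moreover have m: "sm_functor B (ihom C V) (FO M a)" "sm_functor B (ihom C V) (FO M a')"
    by (rule M.sm_functor_FO, simp)+
  moreover have "sm_functor (tensor B C) V (box_smf (tensor B C) V (en B C V (FO M a)) (en B C V (FO M a')))"
    "strong_smf (tensor B C) V (box_smf (tensor B C) V (en B C V (FO M a)) (en B C V (FO M a')))"
    by (intro sm_functor_box_smf strong_box_smf t.sm_functor_en t.strong_en m)+
  ultimately have "Cpt (F2 G a a') (TGen b c) = Cpt (Cpt (F2 M a a') b) c
      \<cdot>\<^bsub>V\<^esub> Ide V (FO (FO (FO M a) b) c \<otimes>\<^sub>t FO (FO (FO M a') b) c)"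
    unfolding comp_smf_simps(4)[OF assms(1,2), where C = "ihom (tensor B C) V"]
    by (simp add: t.inv_eps del: comp_smf_simps)
  then show ?thesis by (simp add: AB.sm_functor_eta_at AB.sm_transformation_gamma)
qed

lemma FO_K: "\<lbrakk>a \<in> Obj A; b \<in> Obj B; c \<in> Obj C\<rbrakk> \<Longrightarrow> FO (FO (FO K a) b) c = TGen a (TGen b c)"
  by (simp add: A_BC.sm_functor_eta_at BC.sm_functor_eta_at)

lemma FA_K:
  assumes [simp]: "f \<in> Arr A" "b \<in> Obj B" "c \<in> Obj C"
  shows "Cpt (Cpt (FA K f) b) c = tclass A (tensor B C) (GenL f (TGen b c))"
  by (simp add: A_BC.sm_transformation_genL BC.sm_functor_eta_at)

lemma F0_K:
  assumes [simp]: "b \<in> Obj B" "c \<in> Obj C"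
  shows "Cpt (Cpt (F0 K) b) c = tclass A (tensor B C) (Alpha (TGen b c))"
  by (simp add: A_BC.sm_transformation_alpha BC.sm_functor_eta_at)

lemma F2_K:
  assumes [simp]: "a \<in> Obj A" "a' \<in> Obj A" "b \<in> Obj B" "c \<in> Obj C"
  shows "Cpt (Cpt (F2 K a a') b) c = tclass A (tensor B C) (Gamma a a' (TGen b c))"
  by (simp add: A_BC.sm_transformation_gamma A_BC.sm_functor_eta_at BC.sm_functor_eta_at)

lemma FO_G:
  assumes [simp]: "a \<in> Obj A" "b \<in> Obj B" "c \<in> Obj C"
  shows "FO (FO G a) (TGen b c) = TGen (TGen a b) c"
proof -
  have "sm_functor B (ihom C V) (FO M a)" by (rule M.sm_functor_FO) simp
  then have "FO (FO G a) (TGen b c) = FO (FO (FO M a) b) c"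
    unfolding comp_smf_simps(1)[OF assms(1), where C = "ihom (tensor B C) V"] by (simp del: comp_smf_simps)
  then show ?thesis by (simp add: AB.sm_functor_eta_at)
qed

lemma FO_S:
  "\<lbrakk>a \<in> Obj A; b \<in> Obj B; c \<in> Obj C\<rbrakk> \<Longrightarrow> FO S (TGen a (TGen b c)) = TGen a (TGen b c)"
  by (simp add: assoc_arrow_eq assoc_arrow'_eq FO_G FO_K comp_smf_simps(1)[where A = U] del: comp_smf_simps)

lemma FA_S: "wf_arr A (tensor B C) p \<Longrightarrow> FA S (tclass A (tensor B C) p) = FA (assoc_arrow' A B C) (en_arr V G p)"
  by (simp add: assoc_arrow_eq)

lemma FA_assoc_arrow':
  "wf_arr (tensor A B) C p \<Longrightarrow> FA (assoc_arrow' A B C) (tclass (tensor A B) C p) = en_arr U L p"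
  by (simp add: assoc_arrow'_eq)

lemma S_GenL:
  assumes [simp]: "f \<in> Arr A" "b \<in> Obj B" "c \<in> Obj C"
  shows "FA S (tclass A (tensor B C) (GenL f (TGen b c))) = tclass A (tensor B C) (GenL f (TGen b c))"
  by (simp add: FA_S FA_G FA_assoc_arrow' FA_K del: comp_smf_simps)

text \<open>A splits \<alpha> at b \<otimes> c into an inner and an outer \<alpha>. Since
  \<open>L\<close> is strict, A' sends the outer one to an identity, and it sends the inner one back
  to \<alpha> at b \<otimes> c.\<close>

lemma S_Alpha:
  assumes [simp]: "b \<in> Obj B" "c \<in> Obj C"
  shows "FA S (tclass A (tensor B C) (Alpha (TGen b c))) = tclass A (tensor B C) (Alpha (TGen b c))"
proof -
  interpret a: sm_functor V U "assoc_arrow' A B C" by (rule sm_functor_assoc_arrow')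
  show ?thesis
    by (simp add: FA_S F0_G FA_assoc_arrow' F0_K del: comp_smf_simps)
qed

text \<open>The same splitting for \<gamma>: A' makes the outer \<gamma> an identity by strictness
  of \<open>L\<close>, and it turns the inner one into the original \<gamma>.\<close>

lemma S_Gamma:
  assumes [simp]: "a \<in> Obj A" "a' \<in> Obj A" "b \<in> Obj B" "c \<in> Obj C"
  shows "FA S (tclass A (tensor B C) (Gamma a a' (TGen b c))) = tclass A (tensor B C) (Gamma a a' (TGen b c))"
proof -
  interpret a: sm_functor V U "assoc_arrow' A B C" by (rule sm_functor_assoc_arrow')
  show ?thesis
    by (simp add: FA_S F2_G FA_assoc_arrow' F2_K FO_K del: comp_smf_simps)
qed

text \<open>The transpose of S \<eta>(a) is computed by pushing A' outwards: it is [C, A'] applied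
  to the transpose of A \<eta>(a), and Rn En = 1 then peels off A, A' and \<open>L\<close> in turn
  until the transpose \<open>FO K a\<close> of \<eta>(a) is left.\<close>

lemma eta_at_S:
  assumes [simp]: "a \<in> Obj A"
  shows "en B C U (comp_smf B (ihom C U) (ihom_map C (tensor B C) U (eta_at A (tensor B C) a)) (eta B C))
    = comp_smf (tensor B C) U S (eta_at A (tensor B C) a)"
proof -
  interpret t: sm_category_triple B C U by (rule triples)
  interpret v: sm_category_triple B C V by (rule triples)
  let ?e = "eta_at A (tensor B C) a" and ?A = "assoc_arrow A B C" and ?A' = "assoc_arrow' A B C"
  let ?g = "comp_smf B (ihom C V) (eta (tensor A B) C) (eta_at A B a)"
  have e: "sm_functor (tensor B C) U ?e" by (rule A_BC.sm_functor_eta_at) simp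
  have g: "sm_functor B (ihom C V) ?g"
    by (rule sm_functor_comp_smf[OF AB.sm_functor_eta_at AB_C.sm_functor_eta]) simp
  have Se: "sm_functor (tensor B C) U (comp_smf (tensor B C) U S ?e)"
    by (rule sm_functor_comp_smf[OF e sm_functor_S])
  \<comment> \<open>Rn En = 1 for \<open>G\<close>, evaluated at a.\<close>
  have "comp_smf (tensor B C) V ?A ?e = FO G a"
    using arg_cong[OF sm_category_triple.rn_en[OF triples(2) sm_functor_G], of "\<lambda>F. FO F a"] e
    by (simp add: assoc_arrow_eq del: comp_smf_simps) (simp del: comp_smf_simps add: comp_smf_simps(1)[where A = A])
  also have "\<dots> = en B C V ?g"
    using g by (simp add: AB.sm_functor_eta_at)
  finally have Ae: "comp_smf (tensor B C) V ?A ?e = en B C V ?g" .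
  have S: "comp_smf (tensor B C) U S ?e = comp_smf (tensor B C) U ?A' (en B C V ?g)"
    by (simp add: comp_smf_assoc[OF e sm_functor_assoc_arrow sm_functor_assoc_arrow'] Ae)
  have "t.rn (comp_smf (tensor B C) U S ?e)
    = comp_smf B (ihom C U) (ihom_map C V U ?A') (v.rn (en B C V ?g))"
    unfolding S ihom_map_comp[OF C.sm_category_axioms v.sm_functor_en[OF g] sm_functor_assoc_arrow']
    by (rule comp_smf_assoc[OF BC.sm_functor_eta]) (intro sm_functor_ihom_map C.sm_category_axioms v.sm_functor_en g sm_functor_assoc_arrow')+
  also have "\<dots> = comp_smf B (ihom C U) (ihom_map C V U ?A') ?g"
    by (simp add: v.rn_en g)
  also have "\<dots> = comp_smf B (ihom C U) (comp_smf (tensor A B) (ihom C U) (ihom_map C V U ?A') (eta (tensor A B) C)) (eta_at A B a)"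
    by (rule comp_smf_assoc[symmetric, OF AB.sm_functor_eta_at AB_C.sm_functor_eta])
      (simp_all add: sm_functor_ihom_map C.sm_category_axioms sm_functor_assoc_arrow')
  \<comment> \<open>Rn En = 1 for \<open>L\<close>, as A' is its \<open>en\<close>.\<close>
  also have "\<dots> = comp_smf B (ihom C U) L (eta_at A B a)"
    unfolding assoc_arrow'_eq by (simp add: sm_category_triple.rn_en[OF triples(7) sm_functor_L])
  \<comment> \<open>Rn En = 1 for \<open>K\<close>, evaluated at a.\<close>
  also have "\<dots> = FO K a"
    using arg_cong[OF sm_category_triple.rn_en[OF triples(5) sm_functor_K], of "\<lambda>F. FO F a"]
    by (simp del: comp_smf_simps add: comp_smf_simps(1)[where A = A] AB.sm_functor_eta_at)
  also have "\<dots> = t.rn ?e"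
    using e by simp
  finally have rn: "t.rn (comp_smf (tensor B C) U S ?e) = t.rn ?e" .
  \<comment> \<open>S \<eta>(a) is strict although \<eta>(a) is only lax: A turns \<eta>(a) into the
    strict functor \<open>en B C V ?g\<close>, and A' is strict.\<close>
  have "strict_smf (tensor B C) U (comp_smf (tensor B C) U S ?e)"
    unfolding S by (intro strict_comp_smf[where B = V] v.sm_functor_en v.strict_en g sm_functor_assoc_arrow' strict_assoc_arrow')
  then have "en B C U (t.rn (comp_smf (tensor B C) U S ?e)) = comp_smf (tensor B C) U S ?e"
    by (rule t.en_rn_strict[OF Se])
  then show ?thesis by (simp add: rn)
qed

section \<open>The 2-cell between the transposes\<close>

abbreviation rnS where
  "rnS \<equiv> comp_smf A (ihom (tensor B C) U) (ihom_map (tensor B C) U U S) (eta A (tensor B C))"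

definition phi where
  "phi = \<lparr>Src = rnS, Tgt = eta A (tensor B C), Cpt = (\<lambda>a\<in>Obj A. eps B C U (eta_at A (tensor B C) a))\<rparr>"

lemma phi_simps [simp]:
  "Src phi = rnS" "Tgt phi = eta A (tensor B C)" "Cpt phi \<in> extensional (Obj A)"
  "a \<in> Obj A \<Longrightarrow> Cpt phi a = eps B C U (eta_at A (tensor B C) a)"
  by (simp_all add: phi_def)

lemma sm_functor_rnS: "sm_functor A (ihom (tensor B C) U) rnS"
  by (rule sm_category_triple.sm_functor_rn[OF triples(1) sm_functor_S])

lemma FO_rnS: "a \<in> Obj A \<Longrightarrow> FO rnS a = comp_smf (tensor B C) U S (eta_at A (tensor B C) a)"
  by (simp add: A_BC.sm_functor_eta_at)

text \<open>\<open>eta_at_S\<close> exhibits this functor as an \<open>en\<close>; this is the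
  strong source that lets \<open>phi\<close> be checked on generators.\<close>

lemma strong_rnS: "a \<in> Obj A \<Longrightarrow> strong_smf (tensor B C) U (FO rnS a)"
proof -
  interpret t: sm_category_triple B C U by (rule triples)
  assume a: "a \<in> Obj A"
  show ?thesis
    unfolding FO_rnS[OF a] eta_at_S[OF a, symmetric]
    by (intro t.strong_en t.sm_functor_rn A_BC.sm_functor_eta_at a)
qed

text \<open>The components have the declared source by \<open>eta_at_S\<close>. The sources in the
  three axioms are S \<eta>(a), the unit functor and a pointwise tensor of two functors S \<eta>(a),
  all strong. On b \<otimes> c the components of \<open>phi\<close> are identities, so the axioms
  say that S fixes f \<otimes> (b \<otimes> c), \<alpha> and \<gamma> there.\<close>

lemma sm_transformation_phi: "sm_transformation A (ihom (tensor B C) U) phi"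
proof -
  interpret t: sm_category_triple B C U by (rule triples)
  interpret R: sm_bifunctor A "tensor B C" U rnS
    by (rule sm_category_triple.sm_bifunctorI[OF triples(1) sm_functor_rnS])
  interpret E: sm_bifunctor A "tensor B C" U "eta A (tensor B C)"
    by (rule sm_category_triple.sm_bifunctorI[OF triples(1) A_BC.sm_functor_eta])
  have p: "sm_transformation (tensor B C) U (Cpt phi a)" "Src (Cpt phi a) = FO rnS a"
    "Tgt (Cpt phi a) = FO (eta A (tensor B C)) a"
    and pc: "\<And>b c. \<lbrakk>b \<in> Obj B; c \<in> Obj C\<rbrakk> \<Longrightarrow> Cpt (Cpt phi a) (TGen b c) = Ide U (TGen a (TGen b c))"
    if a [simp]: "a \<in> Obj A" for a
  proof -
    have e: "sm_functor (tensor B C) U (eta_at A (tensor B C) a)" by (rule A_BC.sm_functor_eta_at) simp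
    show "sm_transformation (tensor B C) U (Cpt phi a)"
      using t.sm_transformation_eps[OF e] by simp
    show "Src (Cpt phi a) = FO rnS a" using eta_at_S[OF a] e by (simp add: FO_rnS)
    show "Tgt (Cpt phi a) = FO (eta A (tensor B C)) a" by simp
  qed simp
  note R = R.sm_transformation_FA R.sm_transformation_F0 R.sm_transformation_F2 R.sm_functor_FO
    E.sm_transformation_FA E.sm_transformation_F0 E.sm_transformation_F2 E.sm_functor_FO p
  have cF: "Cpt (FA rnS f) W = FA S (tclass A (tensor B C) (GenL f W))" if "f \<in> Arr A" "W \<in> Obj (tensor B C)" for f W
    using that by (simp add: A_BC.sm_transformation_genL)
  interpret S: sm_functor U U S by (rule sm_functor_S)
  \<comment> \<open>The unit comparison of S is an identity, so of the composite only the image of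
    \<alpha> under S survives.\<close>
  have c0: "Cpt (F0 rnS) W = FA S (tclass A (tensor B C) (Alpha W))" if "W \<in> Obj (tensor B C)" for W
    using that strict_S strict_FO(1)[OF sm_functor_S strict_S] S.FA_simps[of "tclass A (tensor B C) (Alpha W)"]
    by (simp add: strict_smf_def A_BC.sm_transformation_alpha comp_smf_simps(3)[where C = "ihom (tensor B C) U"]
        del: comp_smf_simps)
  show ?thesis
  proof (rule sm_transformationI)
    fix f assume [simp]: "f \<in> Arr A"
    show "Cpt phi (Cod A f) \<cdot>\<^bsub>ihom (tensor B C) U\<^esub> FA (Src phi) f = FA (Tgt phi) f \<cdot>\<^bsub>ihom (tensor B C) U\<^esub> Cpt phi (Dom A f)"
    proof (rule t.tensor_transformation_eqI)
      fix b c assume [simp]: "b \<in> Obj B" "c \<in> Obj C"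
      show "Cpt (Cpt phi (Cod A f) \<cdot>\<^bsub>ihom (tensor B C) U\<^esub> FA (Src phi) f) (TGen b c)
        = Cpt (FA (Tgt phi) f \<cdot>\<^bsub>ihom (tensor B C) U\<^esub> Cpt phi (Dom A f)) (TGen b c)"
        by (simp add: pc cF S_GenL del: phi_simps(4) comp_smf_simps)
    qed (simp_all add: R strong_rnS sm_transformation_Comp del: phi_simps(4) comp_smf_simps eta_simps)
  next
    show "Cpt phi \<one>\<^bsub>A\<^esub> \<cdot>\<^bsub>ihom (tensor B C) U\<^esub> F0 (Src phi) = F0 (Tgt phi)"
    proof (rule t.tensor_transformation_eqI)
      fix b c assume [simp]: "b \<in> Obj B" "c \<in> Obj C"
      show "Cpt (Cpt phi \<one>\<^bsub>A\<^esub> \<cdot>\<^bsub>ihom (tensor B C) U\<^esub> F0 (Src phi)) (TGen b c) = Cpt (F0 (Tgt phi)) (TGen b c)"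
        by (simp add: pc c0 S_Alpha del: phi_simps(4) comp_smf_simps)
    qed (simp_all add: R strong_unit_smf A_BC.T.sm_category_axioms sm_transformation_Comp del: phi_simps(4) comp_smf_simps eta_simps)
  next
    fix a a' assume [simp]: "a \<in> Obj A" "a' \<in> Obj A"
    show "Cpt phi (a \<otimes>\<^bsub>A\<^esub> a') \<cdot>\<^bsub>ihom (tensor B C) U\<^esub> F2 (Src phi) a a'
      = F2 (Tgt phi) a a' \<cdot>\<^bsub>ihom (tensor B C) U\<^esub> (Cpt phi a \<odot>\<^bsub>ihom (tensor B C) U\<^esub> Cpt phi a')"
    proof (rule t.tensor_transformation_eqI)
      fix b c assume [simp]: "b \<in> Obj B" "c \<in> Obj C"
      \<comment> \<open>S is strict and fixes both objects, so its comparison is an identity with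
        these very ends and drops out of \<open>F2 rnS\<close>.\<close>
      have "F2 S (TGen a (TGen b c)) (TGen a' (TGen b c)) = Ide U (TGen a (TGen b c) \<otimes>\<^sub>t TGen a' (TGen b c))"
        using strict_S FO_S by (simp add: strict_smf_def del: comp_smf_simps)
      then have "Cpt (F2 rnS a a') (TGen b c) = FA S (tclass A (tensor B C) (Gamma a a' (TGen b c)))"
        by (simp add: A_BC.sm_transformation_gamma A_BC.sm_functor_eta_at S_Gamma
            comp_smf_simps(4)[where C = "ihom (tensor B C) U"] del: comp_smf_simps)
      then show "Cpt (Cpt phi (a \<otimes>\<^bsub>A\<^esub> a') \<cdot>\<^bsub>ihom (tensor B C) U\<^esub> F2 (Src phi) a a') (TGen b c)
        = Cpt (F2 (Tgt phi) a a' \<cdot>\<^bsub>ihom (tensor B C) U\<^esub> (Cpt phi a \<odot>\<^bsub>ihom (tensor B C) U\<^esub> Cpt phi a')) (TGen b c)"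
        by (simp add: pc S_Gamma del: phi_simps(4) comp_smf_simps)
    qed (simp_all add: R strong_rnS strong_box_smf sm_transformation_Comp sm_transformation_TenA
        del: phi_simps(4) comp_smf_simps eta_simps)
  qed (simp_all add: R sm_functor_rnS A_BC.sm_functor_eta del: phi_simps(4) comp_smf_simps eta_simps)
qed

lemma en_rnS: "en A (tensor B C) U rnS = S"
  by (rule sm_category_triple.en_rn_strict[OF triples(1) sm_functor_S strict_S])

text \<open>\<eta> is the transpose of the identity functor, which is strict, so
  \<open>en_rn_strict\<close> recovers the identity from it.\<close>

lemma en_eta: "en A (tensor B C) U (eta A (tensor B C)) = id_smf U"
proof -
  have "comp_smf A (ihom (tensor B C) U) (ihom_map (tensor B C) U U (id_smf U)) (eta A (tensor B C)) = eta A (tensor B C)"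
    by (simp add: ihom_map_id BC.T.sm_category_axioms A_BC.T.sm_category_axioms id_comp_smf A_BC.sm_functor_eta)
  moreover have "en A (tensor B C) U (comp_smf A (ihom (tensor B C) U) (ihom_map (tensor B C) U U (id_smf U)) (eta A (tensor B C)))
      = id_smf U"
    by (rule sm_category_triple.en_rn_strict[OF triples(1)])
      (auto intro: sm_functor_id_smf strict_id_smf A_BC.T.sm_category_axioms)
  ultimately show ?thesis by simp
qed

end

theorem corollary19p8:
  fixes A :: "('oa, 'ma) smc" and B :: "('ob, 'mb) smc" and C :: "('oc, 'mc) smc"
  assumes "sm_category A" and "sm_category B" and "sm_category C"
  shows "\<exists>\<sigma>. sm_transformation (tensor A (tensor B C)) (tensor A (tensor B C)) \<sigma> \<and>
           Src \<sigma> = comp_smf (tensor A (tensor B C)) (tensor A (tensor B C))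
                     (assoc_arrow' A B C) (assoc_arrow A B C) \<and>
           Tgt \<sigma> = id_smf (tensor A (tensor B C))"
proof -
  interpret sm_categories A B C using assms by (rule sm_categories.intro)
  show ?thesis
    using sm_category_triple.sm_transformation_en2[OF triples(1) sm_transformation_phi]
    by (intro exI[of _ "en2 A (tensor B C) U phi"]) (simp add: en_rnS en_eta)
qed

end
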